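(* Let $n\ge3$, $1\le k\le n$, $c_0>0$, and let $u\in C^2(\overline{\mathbb{R}^n_+})$ be positive with $$\sigma_k(A^u)=2^k\binom nk,\quad g_u\in\Gamma_k^+\ \text{ in }\overline{\mathbb{R}^n_+},\qquad \mathcal{B}_k^{g_u}=c_0\ \text{ on }\partial\mathbb{R}^n_+ .$$ Assume that $u_{0,1}(x):=|x|^{2-n}u(x/|x|^2)$ can be extended to a positive function in $C^2(\overline{B_1^+})$. Then there exist $b>0$ and $\bar x\in\mathbb{R}^n$ with $u(x)=\big(\frac{\sqrt b}{1+b|x-\bar x|^2}\big)^{(n-2)/2}$ on $\overline{\mathbb{R}^n_+}$.
   Context: $B_R$ is the Euclidean ball of radius $R$ centered at $0$, $B_R^+=B_R\cap\mathbb{R}^n_+$, $\mathbb{R}^n_+=\{x_n>0\}$. For positive $C^2$ $u$: $g_u=u^{4/(n-2)}|dx|^2$, $A^u=-\frac{2}{n-2}u^{-\frac{n+2}{n-2}}\nabla^2u+\frac{2n}{(n-2)^2}u^{-\frac{2n}{n-2}}\nabla u\otimes\nabla u-\frac{2}{(n-2)^2}u^{-\frac{2n}{n-2}}|\nabla u|^2I_n$ (endomorphism form of the Schouten tensor of $g_u$); $\sigma_s$ is the $s$-th elementary symmetric function of eigenvalues; $\Gamma_k^+=\{\lambda:\sigma_1(\lambda)>0,\dots,\sigma_k(\lambda)>0\}$ and $g_u\in\Gamma_k^+$ means the eigenvalues of $A^u$ are in $\Gamma_k^+$ pointwise. On $\partial\mathbb{R}^n_+$: $h_{g_u}=-\frac{2}{n-2}u^{-\frac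 n{n-2}}\partial_{x_n}u$, $A^{\mathrm T}_{g_u}=((A^u)_{\alpha\beta})_{1\le\alpha,\beta\le n-1}$, $\mathcal{B}_k^{g_u}=\frac{(n-1)!}{(n-k)!(2k-1)!!}h_{g_u}^{2k-1}+\sum_{s=1}^{k-1}\frac{(n-1-s)!}{(n-k)!(2k-2s-1)!!}\sigma_s(A^{\mathrm T}_{g_u})h_{g_u}^{2k-2s-1}$. *)

theory Defs
  imports "HOL-Analysis.Analysis"
begin

text \<open>Points of R^n are vectors real^'n; the index e :: 'n plays the role of the
 normal coordinate x_n, so the half-space is {x. x$e > 0}.\<close>

definition closed_half_space :: "'n::finite \<Rightarrow> (real^'n) set" where
  "closed_half_space e = {x. x $ e \<ge> 0}"

definition C2_with :: "(real^'n) set \<Rightarrow> (real^'n \<Rightarrow> real) \<Rightarrow> (real^'n \<Rightarrow> real^'n)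
    \<Rightarrow> (real^'n \<Rightarrow> real^'n^'n) \<Rightarrow> bool" where
  "C2_with S f Df D2f \<longleftrightarrow>
     (\<forall>x\<in>S. (f has_derivative (\<lambda>h. Df x \<bullet> h)) (at x within S)) \<and>
     (\<forall>x\<in>S. (Df has_derivative (\<lambda>h. D2f x *v h)) (at x within S)) \<and>
     continuous_on S D2f"

definition C2_on :: "(real^'n) set \<Rightarrow> (real^'n \<Rightarrow> real) \<Rightarrow> bool" where
  "C2_on S f \<longleftrightarrow> (\<exists>Df D2f. C2_with S f Df D2f)"

text \<open>Schouten tensor A^u (endomorphism form) at a point, from value, gradient, Hessian.\<close>

definition schouten :: "real \<Rightarrow> real^'n \<Rightarrow> real^'n^'n \<Rightarrow> real^'n^'n" where
  "schouten v g H = (let n = real CARD('n) in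
     (\<chi> i j. - (2 / (n - 2)) * v powr (- (n + 2) / (n - 2)) * H $ i $ j
            + (2 * n / (n - 2)^2) * v powr (- 2 * n / (n - 2)) * (g $ i * g $ j)
            - (2 / (n - 2)^2) * v powr (- 2 * n / (n - 2)) * (norm g)^2
                * (if i = j then 1 else 0)))"

text \<open>sigma_s of the eigenvalues of the symmetric matrix M restricted to the index set I,
 written out as the sum of the principal s x s minors (Leibniz determinants).\<close>

definition sigma_on :: "'n set \<Rightarrow> nat \<Rightarrow> real^'n^'n \<Rightarrow> real" where
  "sigma_on I s M = (\<Sum>S\<in>{S. S \<subseteq> I \<and> card S = s}.
       \<Sum>p\<in>{p. p permutes S}. of_int (sign p) * (\<Prod>i\<in>S. M $ i $ p i))"

abbreviation sigma :: "nat \<Rightarrow> real^'n^'n \<Rightarrow> real" where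
  "sigma s M \<equiv> sigma_on UNIV s M"

definition odd_dfact :: "nat \<Rightarrow> nat" where
  "odd_dfact m = (\<Prod>i=1..m. 2 * i - 1)"

text \<open>Boundary operator B_k, with h the mean curvature and AT the tangential Schouten block.\<close>
definition Bk :: "'n \<Rightarrow> nat \<Rightarrow> real \<Rightarrow> real^'n \<Rightarrow> real^'n^'n \<Rightarrow> real" where
  "Bk e k v g H = (let n = CARD('n);
       h = - (2 / (real n - 2)) * v powr (- real n / (real n - 2)) * g $ e;
       A = schouten v g H in
     fact (n - 1) / (fact (n - k) * real (odd_dfact k)) * h ^ (2 * k - 1)
     + (\<Sum>s=1..k-1. fact (n - 1 - s) / (fact (n - k) * real (odd_dfact (k - s)))
           * sigma_on (UNIV - {e}) s A * h ^ (2 * k - 2 * s - 1)))"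

end

theory Submission
  imports Defs "HOL-Computational_Algebra.Fundamental_Theorem_Algebra"
begin

text \<open>
  Write \<open>g_u = v^-2 |dx|^2\<close>, so that the Schouten tensor is \<open>v D^2 v - |Dv|^2/2 I\<close> and the mean curvature is
  the normal derivative of \<open>v\<close>. The proof is by moving spheres centred at boundary points \<open>x\<close>. The
  extension hypothesis gives \<open>v y = al |y|^2 + cc . y + o(|y|)\<close>, which starts the process and bounds the
  radius. Ellipticity of \<open>sigma_k\<close> on the Garding cone and the monotonicity of the boundary operator in
  the mean curvature (its derivative is \<open>sigma_(k-1)\<close> of the tangential block) give one Hopf lemma,
  valid also at the corners where the spheres meet the boundary. Hence the spheres can only stop at
  the squared radius \<open>v x / al\<close>. Comparing first derivatives at \<open>x\<close> shows that \<open>v\<close> is quadratic on the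
  boundary, so the comparison is an equality there, and by the strong maximum principle everywhere:
  \<open>v\<close> is invariant under all these inversions. They have a common fixed point, and the equation reduces to
  an ordinary differential equation along a line, which has a first integral that forces \<open>A = 2 I\<close>.
\<close>

section \<open>Newton inequalities\<close>

text \<open>The difference of two solutions is never linearized. At a minimum of the difference
  minus a barrier, the two Schouten tensors are ordered up to a rank-one gain of order
  \<open>a^2\<close> and errors of order \<open>a\<close>, and \<open>elliptic_compact\<close> turns
  this into a strict inequality between the values of \<open>sigma\<close>. The facts on the cone
  behind it rest on one consequence of Newton's inequalities: deleting an eigenvalue lowers the
  degree of the cone by one, so adding a rank-one term increases \<open>sigma\<close>. The critical
  value \<open>v x / al\<close> comes from the two ends of a ray: with \<open>r * s = t\<close>
  fixed and \<open>r\<close> tending to 0, the reflection inequality compares \<open>v x\<close>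
  with \<open>al * t\<close>. At the critical value the next order compares the gradient at
  \<open>x\<close> with the linear term at infinity. Only boundary points serve as centres, so
  symmetry alone leaves one free function: \<open>v\<close> is \<open>y $ e\<close> times a function
  of the hyperbolic distance to the common fixed point. The equation on the axis has to decide
  it.\<close>

definition real_rooted :: "real poly \<Rightarrow> bool" where
  "real_rooted p \<longleftrightarrow> (\<exists>c A. p = smult c (\<Prod>r\<in>#A. [:-r, 1:]))"

lemma real_rooted_linear: "real_rooted [:a, b:]"
proof (cases "b = 0")
  case True
  then show ?thesis unfolding real_rooted_def
    by (intro exI[of _ a] exI[of _ "{#}"]) simp
next
  case False
  then show ?thesis unfolding real_rooted_def
    by (intro exI[of _ b] exI[of _ "{#-a/b#}"]) simp
qed

lemma real_rooted_mult:
  assumes "real_rooted p" "real_rooted q"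
  shows "real_rooted (p * q)"
proof -
  obtain c A d B where "p = smult c (\<Prod>r\<in>#A. [:-r, 1:])" "q = smult d (\<Prod>r\<in>#B. [:-r, 1:])"
    using assms unfolding real_rooted_def by blast
  then have "p * q = smult (c * d) (\<Prod>r\<in>#A + B. [:-r, 1:])" by (simp add: mult.commute)
  then show ?thesis unfolding real_rooted_def by blast
qed

lemma real_rooted_prod:
  assumes "finite I" "\<And>i. i \<in> I \<Longrightarrow> real_rooted (f i)"
  shows "real_rooted (\<Prod>i\<in>I. f i)"
  using assms
proof (induction I)
  case empty
  then show ?case using real_rooted_linear[of 1 0] by (simp add: one_pCons)
qed (auto intro: real_rooted_mult)

text \<open>For a product of factors \<open>x - r\<close> the quantity \<open>p'^2 - p p''\<close>
  is \<open>p^2\<close> times the sum of \<open>1 / (x - r)^2\<close>. The induction on the roots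
  proves nonnegativity without dividing, so it holds at the roots too.\<close>

lemma real_rooted_Laguerre:
  assumes "real_rooted p"
  shows "poly p x * poly (pderiv (pderiv p)) x \<le> (poly (pderiv p) x)\<^sup>2"
proof -
  have *: "poly q x * poly (pderiv (pderiv q)) x \<le> (poly (pderiv q) x)\<^sup>2"
    if "q = (\<Prod>r\<in>#A. [:-r, 1:])" for q :: "real poly" and A
    using that
  proof (induction A arbitrary: q)
    case empty
    then show ?case by simp
  next
    case (add r A)
    define g where "g = (\<Prod>r\<in>#A. [:-r, 1:])"
    have g: "poly g x * poly (pderiv (pderiv g)) x \<le> (poly (pderiv g) x)\<^sup>2"
      using add.IH g_def by simp
    have q: "q = [:-r, 1:] * g" using add.prems g_def by simp
    have 1: "poly q x = (x - r) * poly g x" unfolding q by (simp add: algebra_simps)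
    have d: "pderiv q = [:-r, 1:] * pderiv g + g" unfolding q pderiv_mult by (simp add: pderiv_pCons)
    have 2: "poly (pderiv q) x = (x - r) * poly (pderiv g) x + poly g x"
      unfolding d by (simp add: algebra_simps)
    have 3: "poly (pderiv (pderiv q)) x = (x - r) * poly (pderiv (pderiv g)) x + 2 * poly (pderiv g) x"
      unfolding d pderiv_add pderiv_mult by (simp add: pderiv_pCons algebra_simps)
    have "(poly (pderiv q) x)\<^sup>2 - poly q x * poly (pderiv (pderiv q)) x
      = (poly g x)\<^sup>2 + (x - r)\<^sup>2 * ((poly (pderiv g) x)\<^sup>2 - poly g x * poly (pderiv (pderiv g)) x)"
      unfolding 1 2 3 by (simp add: power2_eq_square algebra_simps)
    also have "\<dots> \<ge> 0" using g by (intro add_nonneg_nonneg mult_nonneg_nonneg) auto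
    finally show ?case by simp
  qed
  obtain c A where p: "p = smult c (\<Prod>r\<in>#A. [:-r, 1:])"
    using assms unfolding real_rooted_def by blast
  have "c\<^sup>2 * (poly (\<Prod>r\<in>#A. [:-r, 1:]) x * poly (pderiv (pderiv (\<Prod>r\<in>#A. [:-r, 1:]))) x)
      \<le> c\<^sup>2 * (poly (pderiv (\<Prod>r\<in>#A. [:-r, 1:])) x)\<^sup>2"
    by (intro mult_left_mono *[OF refl]) simp
  then show ?thesis unfolding p
    by (simp add: pderiv_smult power_mult_distrib power2_eq_square mult_ac)
qed

text \<open>Gauss--Lucas: off the real axis the imaginary parts of the summands
  \<open>1 / (z - r)\<close> of \<open>p' / p\<close> all have the same strict sign.\<close>

lemma Im_logderiv_real_roots:
  fixes A :: "real multiset"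
  assumes "Im z \<noteq> 0"
  defines "P \<equiv> (\<Prod>r\<in>#A. [:- complex_of_real r, 1:])"
  shows "poly P z \<noteq> 0 \<and> Im (poly (pderiv P) z / poly P z) * Im z \<le> 0
    \<and> (A \<noteq> {#} \<longrightarrow> Im (poly (pderiv P) z / poly P z) * Im z < 0)"
  unfolding P_def
proof (induction A)
  case empty
  then show ?case by simp
next
  case (add r A)
  define g where "g = (\<Prod>r\<in>#A. [:- complex_of_real r, 1:])"
  have zr: "z - of_real r \<noteq> 0" using assms by (metis Im_complex_of_real right_minus_eq)
  have g0: "poly g z \<noteq> 0" using add.IH g_def by simp
  have IH: "Im (poly (pderiv g) z / poly g z) * Im z \<le> 0" using add.IH g_def by simp
  have "poly (pderiv ([:- complex_of_real r, 1:] * g)) z / poly ([:- complex_of_real r, 1:] * g) z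
    = ((z - r) * poly (pderiv g) z + poly g z) / ((z - r) * poly g z)"
    unfolding pderiv_mult by (simp add: pderiv_pCons algebra_simps)
  also have "\<dots> = 1 / (z - r) + poly (pderiv g) z / poly g z"
    using zr g0 by (simp add: field_simps)
  finally have eq: "poly (pderiv ([:- complex_of_real r, 1:] * g)) z / poly ([:- complex_of_real r, 1:] * g) z
    = 1 / (z - r) + poly (pderiv g) z / poly g z" .
  have "Im (1 / (z - r)) * Im z = - ((Im z)\<^sup>2 / ((Re (z - r))\<^sup>2 + (Im (z - r))\<^sup>2))"
    by (simp add: Im_divide power2_eq_square)
  also have "\<dots> < 0" using assms by (simp add: sum_power2_gt_zero_iff)
  finally have "Im (1 / (z - r)) * Im z < 0" .
  then have "Im (1 / (z - r) + poly (pderiv g) z / poly g z) * Im z < 0"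
    using IH by (simp add: distrib_right)
  moreover have "poly ([:- complex_of_real r, 1:] * g) z \<noteq> 0"
    using zr g0 by simp
  ultimately show ?case using eq by (simp add: g_def)
qed

text \<open>The derivative factors over the complex numbers, every root is real by
  \<open>Im_logderiv_real_roots\<close>, and the factorization descends because the coefficient
  embedding is injective. A vanishing derivative is covered by the leading constant 0.\<close>

lemma real_rooted_pderiv:
  assumes "real_rooted p"
  shows "real_rooted (pderiv p)"
proof (cases "pderiv p = 0")
  case True
  then show ?thesis unfolding real_rooted_def by (intro exI[of _ 0]) simp
next
  case False
  obtain c A where p: "p = smult c (\<Prod>r\<in>#A. [:-r, 1:])"
    using assms unfolding real_rooted_def by blast
  let ?m = "map_poly complex_of_real"
  have m_mult: "?m (f * g) = ?m f * ?m g" for f g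
    by (rule poly_eqI) (simp add: coeff_map_poly coeff_mult)
  have m_pderiv: "?m (pderiv f) = pderiv (?m f)" for f
    by (rule poly_eqI) (simp add: coeff_map_poly coeff_pderiv)
  have m_smult: "?m (smult a f) = smult (of_real a) (?m f)" for a f
    by (rule poly_eqI) (simp add: coeff_map_poly)
  have m_lin: "?m [:-r, 1:] = [:- of_real r, 1:]" for r
    by (simp add: map_poly_pCons)
  have m_prod: "?m (\<Prod>r\<in>#B. [:-r, 1:]) = (\<Prod>r\<in>#B. [:- complex_of_real r, 1:])" for B
    by (induction B) (simp_all add: m_mult m_lin del: mult_pCons_left)
  have m_inj: "f = g" if "?m f = ?m g" for f g
    using that by (intro poly_eqI) (metis coeff_map_poly of_real_0 of_real_eq_iff)
  define q where "q = ?m (pderiv p)"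
  have q0: "q \<noteq> 0" using False m_inj[of "pderiv p" 0] by (auto simp: q_def)
  have c0: "c \<noteq> 0" using False p by auto
  have A0: "A \<noteq> {#}" using False p by (auto simp: pderiv_smult)
  have q: "q = smult (of_real c) (pderiv (\<Prod>r\<in>#A. [:- complex_of_real r, 1:]))"
    unfolding q_def m_pderiv p m_smult m_prod by (simp add: pderiv_smult)
  have real: "Im z = 0" if "poly q z = 0" for z
  proof (rule ccontr)
    assume z: "Im z \<noteq> 0"
    have "poly (pderiv (\<Prod>r\<in>#A. [:- complex_of_real r, 1:])) z = 0"
      using that c0 unfolding q by simp
    then show False using Im_logderiv_real_roots[OF z, of A] A0 by simp
  qed
  obtain B where B: "q = smult (lead_coeff q) (\<Prod>x\<in>#B. [:-x, 1:])"
    using alg_closed_imp_factorization[OF q0] by blast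
  have Breal: "complex_of_real (Re x) = x" if "x \<in># B" for x
  proof -
    have "[:-x, 1:] dvd (\<Prod>x\<in>#B. [:-x, 1:])"
      using that by (intro dvd_prod_mset) auto
    then have "poly (\<Prod>x\<in>#B. [:-x, 1:]) x = 0" by (simp add: poly_eq_0_iff_dvd)
    then have "poly q x = 0" by (subst B) simp
    then show ?thesis using real by (simp add: complex_eq_iff)
  qed
  have "(\<Prod>x\<in>#B. [:-x, 1:]) = (\<Prod>x\<in>#B. [:- complex_of_real (Re x), 1:])"
    using Breal by (metis (mono_tags, lifting) image_mset_cong)
  then have "q = smult (of_real (lead_coeff (pderiv p))) (?m (\<Prod>r\<in>#image_mset Re B. [:-r, 1:]))"
    using B unfolding m_prod by (simp add: q_def degree_map_poly coeff_map_poly image_mset.compositionality comp_def)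
  then have "pderiv p = smult (lead_coeff (pderiv p)) (\<Prod>r\<in>#image_mset Re B. [:-r, 1:])"
    unfolding q_def m_smult[symmetric] by (rule m_inj)
  then show ?thesis unfolding real_rooted_def by blast
qed

text \<open>Laguerre's inequality at 0 is the case \<open>m = 0\<close>; differentiation shifts the
  coefficients and preserves real-rootedness. In contrast to the sharp Newton inequality, the
  constant does not depend on the degree.\<close>

lemma newton_coeff:
  assumes "real_rooted p"
  shows "real (m + 2) * (coeff p m * coeff p (m + 2)) \<le> real (m + 1) * (coeff p (m + 1))\<^sup>2"
  using assms
proof (induction m arbitrary: p)
  case 0
  have "poly p 0 * poly (pderiv (pderiv p)) 0 \<le> (poly (pderiv p) 0)\<^sup>2"
    by (rule real_rooted_Laguerre) (use 0 in simp)
  then show ?case by (simp add: poly_0_coeff_0 coeff_pderiv numeral_2_eq_2 mult_ac)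
next
  case (Suc m)
  have "real (m + 2) * (coeff (pderiv p) m * coeff (pderiv p) (m + 2))
     \<le> real (m + 1) * (coeff (pderiv p) (m + 1))\<^sup>2"
    by (rule Suc.IH) (rule real_rooted_pderiv[OF Suc.prems])
  then have "(real (m + 2) * real (m + 1)) * (real (m + 3) * (coeff p (m+1) * coeff p (m+3)))
    \<le> (real (m + 2) * real (m + 1)) * (real (m + 2) * (coeff p (m + 2))\<^sup>2)"
    by (simp add: coeff_pderiv power_mult_distrib power2_eq_square mult_ac numeral_eq_Suc)
  then have "real (m + 3) * (coeff p (m+1) * coeff p (m+3)) \<le> real (m + 2) * (coeff p (m + 2))\<^sup>2"
    by (subst (asm) mult_le_cancel_left_pos) auto
  then show ?case by (simp add: numeral_eq_Suc)
qed

definition esym :: "'i set \<Rightarrow> nat \<Rightarrow> ('i \<Rightarrow> real) \<Rightarrow> real" where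
  "esym I s l = (\<Sum>S\<in>{S. S \<subseteq> I \<and> card S = s}. \<Prod>i\<in>S. l i)"

text \<open>The generating function of the elementary symmetric functions: it yields the recursion
  \<open>esym_insert\<close> and makes Newton's inequality a statement on a real-rooted
  polynomial.\<close>

lemma coeff_prod_linear:
  assumes "finite I"
  shows "coeff (\<Prod>i\<in>I. [:1, l i:]) s = esym I s l"
proof -
  have "(\<Prod>i\<in>I. [:1, l i:]) = (\<Prod>i\<in>I. monom (l i) 1 + 1)"
    by (intro prod.cong) (auto simp: monom_altdef one_pCons)
  also have "\<dots> = (\<Sum>X\<in>Pow I. (\<Prod>i\<in>X. monom (l i) 1) * (\<Prod>i\<in>I-X. 1))"
    by (rule prod_add) (rule assms)
  also have "\<dots> = (\<Sum>X\<in>Pow I. monom (\<Prod>i\<in>X. l i) (card X))"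
  proof (intro sum.cong refl)
    fix X assume "X \<in> Pow I"
    then have "finite X" using assms finite_subset by auto
    then have "(\<Prod>i\<in>X. monom (l i) 1) = monom (\<Prod>i\<in>X. l i) (card X)"
      by (induction X) (auto simp: mult_monom)
    then show "(\<Prod>i\<in>X. monom (l i) 1) * (\<Prod>i\<in>I-X. 1) = monom (\<Prod>i\<in>X. l i) (card X)" by simp
  qed
  finally have "coeff (\<Prod>i\<in>I. [:1, l i:]) s = (\<Sum>X\<in>Pow I. if card X = s then \<Prod>i\<in>X. l i else 0)"
    by (simp add: coeff_sum)
  also have "\<dots> = (\<Sum>X\<in>{X\<in>Pow I. card X = s}. \<Prod>i\<in>X. l i)"
    by (rule sum.inter_filter[symmetric]) (use assms in simp)
  finally show ?thesis by (simp add: esym_def Pow_def)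
qed

lemma esym_insert:
  assumes "finite I" "i \<notin> I"
  shows "esym (insert i I) (Suc s) l = esym I (Suc s) l + l i * esym I s l"
  using assms by (simp add: coeff_prod_linear[symmetric] coeff_pCons)

lemma esym_0: "finite I \<Longrightarrow> esym I 0 l = 1"
proof -
  assume "finite I"
  then have "{S. S \<subseteq> I \<and> card S = 0} = {{}}" by (auto dest: finite_subset)
  then show ?thesis by (simp add: esym_def)
qed

lemma esym_newton:
  assumes "finite I"
  shows "esym I s l * esym I (s + 2) l \<le> (esym I (s + 1) l)\<^sup>2"
proof -
  have "real_rooted (\<Prod>i\<in>I. [:1, l i:])"
    using assms by (intro real_rooted_prod real_rooted_linear)
  from newton_coeff[OF this, of s]
  have *: "real (s + 2) * (esym I s l * esym I (s + 2) l) \<le> real (s + 1) * (esym I (s + 1) l)\<^sup>2"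
    by (simp only: coeff_prod_linear[OF assms])
  also have "\<dots> \<le> real (s + 2) * (esym I (s + 1) l)\<^sup>2"
    by (intro mult_right_mono) auto
  finally show ?thesis by (subst (asm) mult_le_cancel_left_pos) auto
qed

text \<open>If the value of degree \<open>Suc k\<close> without \<open>i\<close> were nonpositive,
  the two positive functions containing \<open>l i\<close> would force \<open>l i > 0\<close> and
  then \<open>e_(k+1)^2 < e_k * e_(k+2)\<close>, against \<open>esym_newton\<close>. Since these
  values are the partial derivatives of the next \<open>esym\<close>, this is the ellipticity of the
  equation.\<close>

lemma esym_remove_pos:
  assumes "finite I" "i \<in> I" "\<And>j. 1 \<le> j \<Longrightarrow> j \<le> Suc k \<Longrightarrow> esym I j l > 0" 
  shows "esym (I - {i}) k l > 0"
  using assms(3)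
proof (induction k)
  case 0
  then show ?case using assms by (simp add: esym_0)
next
  case (Suc k)
  let ?J = "I - {i}" and ?e = "\<lambda>s. esym (I - {i}) s l"
  have IH: "?e k > 0" by (rule Suc.IH) (use Suc.prems in auto)
  have rec: "esym I (Suc s) l = ?e (Suc s) + l i * ?e s" for s
    using esym_insert[of ?J i s l] assms by (simp add: insert_absorb)
  have 1: "?e (Suc k) + l i * ?e k > 0" "?e (Suc (Suc k)) + l i * ?e (Suc k) > 0"
    using Suc.prems[of "Suc k"] Suc.prems[of "Suc (Suc k)"] rec by auto
  show ?case
  proof (rule ccontr)
    assume "\<not> ?e (Suc k) > 0"
    then have n: "- ?e (Suc k) \<ge> 0" by simp
    have li: "l i * ?e k > - ?e (Suc k)" using 1 by simp
    have lp: "l i > 0" using li n IH by (smt (verit) mult_nonpos_nonneg)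
    have "?e (Suc (Suc k)) > l i * (- ?e (Suc k))" using 1 by simp
    then have 2: "?e k * (l i * (- ?e (Suc k))) < ?e k * ?e (Suc (Suc k))"
      using IH by (rule mult_strict_left_mono)
    have "(- ?e (Suc k)) * (- ?e (Suc k)) \<le> (l i * ?e k) * (- ?e (Suc k))"
      using li n by (intro mult_right_mono) auto
    also have "\<dots> = ?e k * (l i * (- ?e (Suc k)))" by simp
    also note 2
    finally have "(?e (Suc k))\<^sup>2 < ?e k * ?e (Suc (Suc k))" by (simp add: power2_eq_square)
    then show False using esym_newton[of ?J k l] assms by simp
  qed
qed

section \<open>Elementary symmetric functions of matrices\<close>

definition minor :: "'n set \<Rightarrow> real^'n^'n \<Rightarrow> real" where
  "minor S M = (\<Sum>p\<in>{p. p permutes S}. of_int (sign p) * (\<Prod>i\<in>S. M $ i $ p i))"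

lemma sigma_on_minor:
  "sigma_on I s M = (\<Sum>S\<in>{S. S \<subseteq> I \<and> card S = s}. minor S M)"
  by (simp add: sigma_on_def minor_def)

lemma sigma_on_0: "sigma_on I 0 (M::real^'n^'n) = 1"
proof -
  have "{S::'n set. S \<subseteq> I \<and> card S = 0} = {{}}" by auto
  then show ?thesis by (simp add: sigma_on_minor minor_def)
qed

definition outer :: "real^'n \<Rightarrow> real^'n^'n" where
  "outer x = (\<chi> i j. x $ i * x $ j)"

definition diag :: "('n \<Rightarrow> real) \<Rightarrow> real^'n^'n" where
  "diag l = (\<chi> i j. if i = j then l i else 0)"

text \<open>Zeroing row and column \<open>e\<close>, rather than deleting them, keeps the tangential block in the same
  matrix type.\<close>

definition tang :: "'n \<Rightarrow> real^'n^'n \<Rightarrow> real^'n^'n" where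
  "tang e M = (\<chi> i j. if i = e \<or> j = e then 0 else M $ i $ j)"

text \<open>A principal minor whose index set contains \<open>e\<close> has a zero row. Thus every
  result on \<open>sigma\<close> becomes available for the tangential block.\<close>

lemma sigma_on_tang: "sigma_on (UNIV - {e}) s M = sigma s (tang e M)"
proof -
  have 0: "minor S (tang e M) = 0" if "e \<in> S" for S
    unfolding minor_def
  proof (intro sum.neutral ballI)
    fix p assume "p \<in> {p. p permutes S}"
    have "(\<Prod>i\<in>S. tang e M $ i $ p i) = 0"
      by (rule prod_zero) (use that in \<open>auto simp: tang_def\<close>)
    then show "of_int (sign p) * (\<Prod>i\<in>S. tang e M $ i $ p i) = 0" by simp
  qed
  have 1: "minor S (tang e M) = minor S M" if "e \<notin> S" for S
    unfolding minor_def
  proof (intro sum.cong refl arg_cong2[where f="(*)"] prod.cong)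
    fix p i assume "p \<in> {p. p permutes S}" "i \<in> S"
    then have "p i \<in> S" by (simp add: permutes_in_image)
    then show "tang e M $ i $ p i = M $ i $ p i" using that \<open>i \<in> S\<close> by (auto simp: tang_def)
  qed
  have "sigma s (tang e M) = (\<Sum>S\<in>{S. S \<subseteq> UNIV - {e} \<and> card S = s}. minor S (tang e M))"
    unfolding sigma_on_minor by (rule sum.mono_neutral_right) (auto intro: 0)
  also have "\<dots> = (\<Sum>S\<in>{S. S \<subseteq> UNIV - {e} \<and> card S = s}. minor S M)"
    by (intro sum.cong refl 1) auto
  finally show ?thesis by (simp add: sigma_on_minor)
qed

text \<open>The left side is invariant under orthogonal conjugation, and comparing coefficients of
  \<open>t\<close> carries this over to every \<open>sigma s\<close>.\<close>

lemma det_mat1_plus: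
  fixes M :: "real^'n^'n"
  shows "det (mat 1 + t *\<^sub>R M) = (\<Sum>s\<le>CARD('n). sigma s M * t ^ s)"
proof -
  \<comment> \<open>A permutation that moves an index outside \<open>S\<close> meets an off-diagonal
    zero of the identity, so only the permutations of \<open>S\<close> survive.\<close>
  have key: "(\<Sum>p\<in>{p. p permutes UNIV}. of_int (sign p) * ((\<Prod>i\<in>S. t * M $ i $ p i) * (\<Prod>i\<in>UNIV-S. if i = p i then 1 else 0)))
    = t ^ card S * minor S M" for S :: "'n set"
  proof -
    have "(\<Sum>p\<in>{p. p permutes UNIV}. of_int (sign p) * ((\<Prod>i\<in>S. t * M $ i $ p i) * (\<Prod>i\<in>UNIV-S. if i = p i then 1 else 0)))
      = (\<Sum>p\<in>{p. p permutes S}. of_int (sign p) * ((\<Prod>i\<in>S. t * M $ i $ p i) * (\<Prod>i\<in>UNIV-S. if i = p i then 1 else 0)))"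
    proof (rule sum.mono_neutral_right)
      show "\<forall>p\<in>{p. p permutes UNIV} - {p. p permutes S}. of_int (sign p) * ((\<Prod>i\<in>S. t * M $ i $ p i) * (\<Prod>i\<in>UNIV-S. if i = p i then 1 else 0)) = (0::real)"
      proof
        fix p assume p: "p \<in> {p. p permutes UNIV} - {p. p permutes S}"
        then have "\<exists>i. i \<notin> S \<and> p i \<noteq> i" by (auto simp: permutes_def)
        then obtain i where "i \<in> UNIV - S" "p i \<noteq> i" by auto
        then have "(\<Prod>i\<in>UNIV-S. if i = p i then 1 else 0) = (0::real)"
          by (intro prod_zero) (auto intro!: bexI[of _ i])
        then show "of_int (sign p) * ((\<Prod>i\<in>S. t * M $ i $ p i) * (\<Prod>i\<in>UNIV-S. if i = p i then 1 else 0)) = (0::real)"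
          by simp
      qed
    qed (auto simp: permutes_def finite_permutations)
    also have "\<dots> = (\<Sum>p\<in>{p. p permutes S}. t ^ card S * (of_int (sign p) * (\<Prod>i\<in>S. M $ i $ p i)))"
    proof (intro sum.cong refl)
      fix p assume "p \<in> {p. p permutes S}"
      then have "(\<Prod>i\<in>UNIV-S. if i = p i then 1 else 0) = (1::real)"
        by (intro prod.neutral) (auto simp: permutes_def)
      then show "of_int (sign p) * ((\<Prod>i\<in>S. t * M $ i $ p i) * (\<Prod>i\<in>UNIV-S. if i = p i then 1 else 0))
         = t ^ card S * (of_int (sign p) * (\<Prod>i\<in>S. M $ i $ p i))"
        by (simp add: prod.distrib prod_constant)
    qed
    finally show ?thesis by (simp add: minor_def sum_distrib_left)
  qed
  have "det (mat 1 + t *\<^sub>R M) = (\<Sum>p\<in>{p. p permutes UNIV}. of_int (sign p) *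
       (\<Prod>i\<in>UNIV. t * M $ i $ p i + (if i = p i then 1 else 0)))"
    unfolding det_def by (intro sum.cong refl arg_cong2[where f="(*)"] prod.cong) (auto simp: mat_def)
  also have "\<dots> = (\<Sum>p\<in>{p. p permutes UNIV}. \<Sum>S\<in>UNIV. of_int (sign p) *
       ((\<Prod>i\<in>S. t * M $ i $ p i) * (\<Prod>i\<in>UNIV-S. if i = p i then 1 else 0)))"
    by (subst prod_add) (simp_all add: sum_distrib_left)
  also have "\<dots> = (\<Sum>S\<in>UNIV. t ^ card S * minor S M)"
    by (subst sum.swap) (simp only: key)
  also have "\<dots> = (\<Sum>s\<in>{..CARD('n)}. \<Sum>S\<in>{S\<in>UNIV. card S = s}. t ^ card S * minor S M)"
    by (rule sum.group[symmetric]) (auto intro: card_mono)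
  also have "\<dots> = (\<Sum>s\<le>CARD('n). sigma s M * t ^ s)"
    unfolding sigma_on_minor sum_distrib_right
    by (intro sum.cong) (auto simp: mult.commute)
  finally show ?thesis .
qed

lemma sigma_gt_card: "CARD('n) < s \<Longrightarrow> sigma s (M::real^'n^'n) = 0"
proof -
  assume "CARD('n) < s"
  moreover have "card S \<le> CARD('n)" for S :: "'n set" by (rule card_mono) auto
  ultimately have "{S::'n set. S \<subseteq> UNIV \<and> card S = s} = {}" by (metis (mono_tags, lifting) empty_Collect_eq leD)
  then show ?thesis by (simp add: sigma_on_minor)
qed

lemma conj_add: "transpose Q ** (A + B) ** Q = transpose Q ** A ** Q + transpose Q ** B ** (Q::real^'n^'n)"
  by (simp add: vec_eq_iff matrix_matrix_mult_def sum.distrib distrib_left distrib_right)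

lemma conj_scaleR: "transpose Q ** (c *\<^sub>R A) ** Q = c *\<^sub>R (transpose Q ** A ** (Q::real^'n^'n))"
  by (simp add: vec_eq_iff matrix_matrix_mult_def sum_distrib_left mult_ac)

lemma conj_outer: "transpose Q ** outer x ** Q = outer (transpose Q *v x)"
  by (simp add: vec_eq_iff matrix_matrix_mult_def matrix_vector_mult_def vector_matrix_mult_def outer_def transpose_def
      sum_distrib_left sum_distrib_right mult_ac)

lemma sigma_orthogonal_conj:
  fixes M Q :: "real^'n^'n"
  assumes "orthogonal_matrix Q"
  shows "sigma s (transpose Q ** M ** Q) = sigma s M"
proof (cases "s \<le> CARD('n)")
  case False
  then show ?thesis by (simp add: sigma_gt_card)
next
  case True
  have QQ: "transpose Q ** Q = mat 1" using assms by (simp add: orthogonal_matrix_def)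
  have "det (mat 1 + t *\<^sub>R (transpose Q ** M ** Q)) = det (mat 1 + t *\<^sub>R M)" for t
  proof -
    have "mat 1 + t *\<^sub>R (transpose Q ** M ** Q) = transpose Q ** (mat 1 + t *\<^sub>R M) ** Q"
      by (simp add: conj_add conj_scaleR QQ)
    then have "det (mat 1 + t *\<^sub>R (transpose Q ** M ** Q)) = det (transpose Q ** Q) * det (mat 1 + t *\<^sub>R M)"
      by (simp only: det_mul) (simp add: mult_ac)
    then show ?thesis by (simp add: QQ)
  qed
  then have "\<forall>t. (\<Sum>s\<le>CARD('n). sigma s (transpose Q ** M ** Q) * t ^ s) = (\<Sum>s\<le>CARD('n). sigma s M * t ^ s)"
    by (simp add: det_mat1_plus)
  then show ?thesis using True unfolding polyfun_eq_coeffs by blast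
qed

lemma minor_diag: "minor S (diag l) = (\<Prod>i\<in>S. l i)"
proof -
  have "minor S (diag l) = (\<Sum>p\<in>{id}. of_int (sign p) * (\<Prod>i\<in>S. diag l $ i $ p i))"
    unfolding minor_def
  proof (rule sum.mono_neutral_right)
    show "\<forall>p\<in>{p. p permutes S} - {id}. of_int (sign p) * (\<Prod>i\<in>S. diag l $ i $ p i) = 0"
    proof
      fix p assume "p \<in> {p. p permutes S} - {id}"
      then obtain i where "i \<in> S" "p i \<noteq> i" by (auto simp: permutes_def fun_eq_iff)
      then have "(\<Prod>i\<in>S. diag l $ i $ p i) = 0"
        by (intro prod_zero) (auto simp: diag_def intro!: bexI[of _ i])
      then show "of_int (sign p) * (\<Prod>i\<in>S. diag l $ i $ p i) = 0" by simp
    qed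
  qed (auto simp: finite_permutations permutes_id)
  then show ?thesis by (simp add: diag_def sign_id)
qed

lemma sigma_on_diag: "sigma_on I s (diag l) = esym I s l"
  by (simp add: sigma_on_minor esym_def minor_diag)

lemma permutes_remove: "e \<in> S \<Longrightarrow> p permutes (S - {e}) \<longleftrightarrow> p permutes S \<and> p e = e"
  by (auto simp: permutes_def)

text \<open>Only the entry \<open>(e, e)\<close> changes, so the extra terms come from the
  permutations that fix \<open>e\<close>, and these are the permutations of
  \<open>S - {e}\<close>.\<close>

lemma minor_axis:
  "minor S (M + t *\<^sub>R outer (axis e 1)) = minor S M + (if e \<in> S then t * minor (S - {e}) M else 0)"
proof (cases "e \<in> S")
  case False
  then show ?thesis unfolding minor_def
    by (auto intro!: sum.cong prod.cong simp: outer_def axis_def)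
next
  case True
  let ?f = "\<lambda>p. of_int (sign p) * (\<Prod>i\<in>S-{e}. M $ i $ p i)"
  have "minor S (M + t *\<^sub>R outer (axis e 1))
    = (\<Sum>p\<in>{p. p permutes S}. of_int (sign p) * (\<Prod>i\<in>S. M $ i $ p i) + (if p e = e then t * ?f p else 0))"
    unfolding minor_def
  proof (intro sum.cong refl)
    fix p assume "p \<in> {p. p permutes S}"
    have "(\<Prod>i\<in>S-{e}. (M + t *\<^sub>R outer (axis e 1)) $ i $ p i) = (\<Prod>i\<in>S-{e}. M $ i $ p i)"
      by (intro prod.cong) (auto simp: outer_def axis_def)
    then have "(\<Prod>i\<in>S. (M + t *\<^sub>R outer (axis e 1)) $ i $ p i)
       = (M $ e $ p e + (if p e = e then t else 0)) * (\<Prod>i\<in>S-{e}. M $ i $ p i)"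
      using True by (subst prod.remove[of S e]) (auto simp: outer_def axis_def)
    moreover have "(\<Prod>i\<in>S. M $ i $ p i) = M $ e $ p e * (\<Prod>i\<in>S-{e}. M $ i $ p i)"
      using True by (subst prod.remove[of S e]) auto
    ultimately show "of_int (sign p) * (\<Prod>i\<in>S. (M + t *\<^sub>R outer (axis e 1)) $ i $ p i)
       = of_int (sign p) * (\<Prod>i\<in>S. M $ i $ p i) + (if p e = e then t * ?f p else 0)"
      by (simp add: algebra_simps)
  qed
  also have "\<dots> = minor S M + (\<Sum>p\<in>{p. p permutes S \<and> p e = e}. t * ?f p)"
    unfolding sum.distrib minor_def
    using sum.inter_filter[of "{p. p permutes S}" "\<lambda>p. t * ?f p" "\<lambda>p. p e = e"]
    by (simp add: finite_permutations)
  also have "{p. p permutes S \<and> p e = e} = {p. p permutes (S - {e})}"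
    using permutes_remove[OF True] by auto
  finally show ?thesis using True by (simp add: minor_def sum_distrib_left)
qed

text \<open>Double counting: \<open>(S, i)\<close> with \<open>i\<close> in \<open>S\<close>
  corresponds bijectively to \<open>(i, S - {i})\<close>.\<close>

lemma sum_subset_remove:
  fixes I :: "'i set" and f :: "'i \<Rightarrow> 'i set \<Rightarrow> real"
  assumes "finite I"
  shows "(\<Sum>S\<in>{S. S \<subseteq> I \<and> card S = Suc s}. \<Sum>i\<in>S. f i (S - {i}))
    = (\<Sum>i\<in>I. \<Sum>S\<in>{S. S \<subseteq> I - {i} \<and> card S = s}. f i S)"
proof -
  have fin: "finite S" if "S \<subseteq> I" for S using that assms finite_subset by auto
  have "(\<Sum>S\<in>{S. S \<subseteq> I \<and> card S = Suc s}. \<Sum>i\<in>S. f i (S - {i}))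
    = (\<Sum>(S,i)\<in>Sigma {S. S \<subseteq> I \<and> card S = Suc s} (\<lambda>S. S). f i (S - {i}))"
    by (rule sum.Sigma) (auto simp: assms fin)
  also have "\<dots> = (\<Sum>(i,S)\<in>Sigma I (\<lambda>i. {S. S \<subseteq> I - {i} \<and> card S = s}). f i S)"
    by (rule sum.reindex_bij_witness[where j="\<lambda>(S,i). (i, S - {i})" and i="\<lambda>(i,S). (insert i S, i)"])
       (auto simp: fin card_insert_if subset_Diff_insert intro!: card_Suc_Diff1 fin)
  also have "\<dots> = (\<Sum>i\<in>I. \<Sum>S\<in>{S. S \<subseteq> I - {i} \<and> card S = s}. f i S)"
    by (rule sum.Sigma[symmetric]) (auto simp: assms)
  finally show ?thesis .
qed

lemma sigma_axis:
  fixes M :: "real^'n^'n"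
  shows "sigma (Suc s) (M + t *\<^sub>R outer (axis e 1)) = sigma (Suc s) M + t * sigma_on (UNIV - {e}) s M"
proof -
  have "sigma (Suc s) (M + t *\<^sub>R outer (axis e 1)) = (\<Sum>S\<in>{S. card S = Suc s}. minor S M) +
     (\<Sum>S\<in>{S. card S = Suc s}. if e \<in> S then t * minor (S - {e}) M else 0)"
    by (simp add: sigma_on_minor minor_axis sum.distrib)
  also have "(\<Sum>S\<in>{S. card S = Suc s}. if e \<in> S then t * minor (S - {e}) M else 0)
    = (\<Sum>S\<in>{S. S \<subseteq> UNIV \<and> card S = Suc s}. \<Sum>i\<in>S. if i = e then t * minor (S - {i}) M else 0)"
    by (intro sum.cong) auto
  also have "\<dots> = t * sigma_on (UNIV - {e}) s M"
  proof -
    have "(\<Sum>i\<in>UNIV. \<Sum>S | S \<subseteq> UNIV - {i} \<and> card S = s. if i = e then t * minor S M else 0)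
      = (\<Sum>i\<in>UNIV. if i = e then t * sigma_on (UNIV - {e}) s M else 0)"
      by (intro sum.cong) (auto simp: sigma_on_minor sum_distrib_left)
    then show ?thesis by (subst sum_subset_remove) simp_all
  qed
  finally show ?thesis by (simp add: sigma_on_minor)
qed

text \<open>A rotation takes \<open>x\<close> to a multiple of a coordinate vector, where
  \<open>sigma_axis\<close> shows that the dependence on \<open>t\<close> is affine. An affine
  function is determined by its values at 0 and 1.\<close>

lemma sigma_rank1:
  fixes M :: "real^'n^'n"
  shows "sigma s (M + t *\<^sub>R outer x) = sigma s M + t * (sigma s (M + outer x) - sigma s M)"
proof (cases "s = 0 \<or> x = 0")
  case True
  moreover have "outer (0::real^'n) = 0" by (simp add: outer_def vec_eq_iff)
  ultimately show ?thesis by (auto simp: sigma_on_0)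
next
  case False
  then obtain r where r: "s = Suc r" by (cases s) auto
  define e :: 'n where "e = undefined"
  have "norm (x /\<^sub>R norm x) = 1" using False by simp
  then obtain Q where Q: "orthogonal_matrix Q" "Q *v axis e 1 = x /\<^sub>R norm x"
    using orthogonal_matrix_exists_basis by blast
  have "transpose Q *v x = norm x *\<^sub>R (transpose Q *v (x /\<^sub>R norm x))"
    using False by (simp only: matrix_vector_mult_scaleR) simp
  also have "transpose Q *v (x /\<^sub>R norm x) = axis e 1"
    unfolding Q(2)[symmetric] matrix_vector_mul_assoc using Q(1) by (simp add: orthogonal_matrix_def)
  finally have "transpose Q *v x = norm x *\<^sub>R axis e 1" .
  then have "transpose Q ** outer x ** Q = (norm x)\<^sup>2 *\<^sub>R outer (axis e 1)"
    by (simp only: conj_outer) (simp add: outer_def vec_eq_iff power2_eq_square)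
  then have eq: "transpose Q ** (M + t *\<^sub>R outer x) ** Q
    = transpose Q ** M ** Q + (t * (norm x)\<^sup>2) *\<^sub>R outer (axis e 1)" for t
    by (simp add: conj_add conj_scaleR)
  have *: "sigma s (M + t *\<^sub>R outer x) = sigma s M + t * (norm x)\<^sup>2 * sigma_on (UNIV - {e}) r (transpose Q ** M ** Q)" for t
  proof -
    have "sigma s (M + t *\<^sub>R outer x) = sigma s (transpose Q ** (M + t *\<^sub>R outer x) ** Q)"
      by (rule sigma_orthogonal_conj[OF Q(1), symmetric])
    also have "\<dots> = sigma s (transpose Q ** M ** Q) + t * (norm x)\<^sup>2 * sigma_on (UNIV - {e}) r (transpose Q ** M ** Q)"
      unfolding eq r by (rule sigma_axis)
    finally show ?thesis by (simp add: sigma_orthogonal_conj[OF Q(1)])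
  qed
  show ?thesis using *[of t] *[of 1] by simp
qed

text \<open>A permutation other than the identity moves at least two points. After one factor has
  been differentiated, another off-diagonal entry of \<open>diag l\<close> remains, and it is
  zero.\<close>

lemma deriv_minor_diag:
  fixes x :: "real^'n"
  shows "((\<lambda>t. minor S (diag l + t *\<^sub>R outer x)) has_real_derivative (\<Sum>i\<in>S. (x $ i)\<^sup>2 * (\<Prod>j\<in>S-{i}. l j))) (at 0)"
proof -
  let ?M = "\<lambda>t. diag l + t *\<^sub>R outer x"
  let ?D = "\<lambda>p. \<Sum>i\<in>S. x $ i * x $ p i * (\<Prod>j\<in>S-{i}. diag l $ j $ p j)"
  have ent: "((\<lambda>t. ?M t $ i $ j) has_real_derivative x $ i * x $ j) (at 0)" for i j
    by (auto intro!: derivative_eq_intros simp: outer_def)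
  have "((\<lambda>t. \<Prod>i\<in>S. ?M t $ i $ p i) has_real_derivative (\<Sum>i\<in>S. x $ i * x $ p i * (\<Prod>j\<in>S-{i}. ?M 0 $ j $ p j))) (at 0)" for p
    by (rule has_field_derivative_prod) (rule ent)
  then have *: "((\<lambda>t. \<Prod>i\<in>S. ?M t $ i $ p i) has_real_derivative ?D p) (at 0)" for p
    by simp
  have "((\<lambda>t. minor S (?M t)) has_real_derivative (\<Sum>p\<in>{p. p permutes S}. of_int (sign p) * ?D p)) (at 0)"
    unfolding minor_def by (intro DERIV_sum DERIV_cmult *)
  also have "(\<Sum>p\<in>{p. p permutes S}. of_int (sign p) * ?D p) = (\<Sum>p\<in>{id}. of_int (sign p) * ?D p)"
  proof (rule sum.mono_neutral_right)
    show "\<forall>p\<in>{p. p permutes S} - {id}. of_int (sign p) * ?D p = 0"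
    proof
      fix p assume p: "p \<in> {p. p permutes S} - {id}"
      have "?D p = 0"
      proof (intro sum.neutral ballI)
        fix i assume i: "i \<in> S"
        have "\<exists>j\<in>S-{i}. p j \<noteq> j"
        proof (rule ccontr)
          assume "\<not> ?thesis"
          then have a: "p j = j" if "j \<noteq> i" for j using that p by (auto simp: permutes_def)
          moreover have "p i = i"
            using a p by (metis Diff_iff mem_Collect_eq permutes_inj injD)
          ultimately have "p = id" by (metis eq_id_iff)
          then show False using p by simp
        qed
        then obtain j where j: "j \<in> S - {i}" "p j \<noteq> j" by blast
        then have "diag l $ j $ p j = 0" by (auto simp: diag_def)
        then have "(\<Prod>j\<in>S-{i}. diag l $ j $ p j) = 0"
          using j by (intro prod_zero) auto
        then show "x $ i * x $ p i * (\<Prod>j\<in>S-{i}. diag l $ j $ p j) = 0" by simp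
      qed
      then show "of_int (sign p) * ?D p = 0" by simp
    qed
  qed (auto simp: finite_permutations permutes_id)
  also have "\<dots> = (\<Sum>i\<in>S. (x $ i)\<^sup>2 * (\<Prod>j\<in>S-{i}. l j))"
    by (simp add: diag_def sign_id power2_eq_square)
  finally show ?thesis .
qed

text \<open>By \<open>sigma_rank1\<close> the function is affine in \<open>t\<close>, so its
  derivative at 0 is the whole increment.\<close>

lemma sigma_rank1_diag:
  fixes x :: "real^'n"
  shows "sigma (Suc s) (diag l + outer x) = sigma (Suc s) (diag l)
     + (\<Sum>i\<in>UNIV. (x $ i)\<^sup>2 * esym (UNIV - {i}) s l)"
proof -
  let ?b = "sigma (Suc s) (diag l + outer x) - sigma (Suc s) (diag l)"
  have "((\<lambda>t. sigma (Suc s) (diag l + t *\<^sub>R outer x)) has_real_derivative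
     (\<Sum>S\<in>{S. S \<subseteq> UNIV \<and> card S = Suc s}. \<Sum>i\<in>S. (x $ i)\<^sup>2 * (\<Prod>j\<in>S-{i}. l j))) (at 0)"
    unfolding sigma_on_minor by (intro DERIV_sum deriv_minor_diag)
  moreover have "((\<lambda>t. sigma (Suc s) (diag l + t *\<^sub>R outer x)) has_real_derivative ?b) (at 0)"
    unfolding sigma_rank1[of _ _ _ x] by (auto intro!: derivative_eq_intros)
  ultimately have "?b = (\<Sum>S\<in>{S. S \<subseteq> UNIV \<and> card S = Suc s}. \<Sum>i\<in>S. (x $ i)\<^sup>2 * (\<Prod>j\<in>S-{i}. l j))"
    using DERIV_unique by blast
  also have "\<dots> = (\<Sum>i\<in>UNIV. \<Sum>S\<in>{S. S \<subseteq> UNIV - {i} \<and> card S = s}. (x $ i)\<^sup>2 * (\<Prod>j\<in>S. l j))"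
    by (rule sum_subset_remove) simp
  finally show ?thesis by (simp add: esym_def sum_distrib_left)
qed

text \<open>Differentiation deletes one index from each minor, and a subset \<open>S\<close> of size
  \<open>s\<close> arises in this way from each of the \<open>card I - s\<close> indices outside
  it.\<close>

lemma deriv_sigma_on_mat1:
  fixes M :: "real^'n^'n"
  shows "((\<lambda>t. sigma_on I (Suc s) (M + t *\<^sub>R mat 1)) has_real_derivative
     (real (card I) - real s) * sigma_on I s (M + t *\<^sub>R mat 1)) (at t)"
proof -
  let ?M = "\<lambda>t. M + t *\<^sub>R mat 1"
  let ?d = "\<lambda>i j. if i = j then 1 else 0 :: real"
  have ent: "((\<lambda>t. ?M t $ i $ j) has_real_derivative ?d i j) (at t)" for i j
    by (auto intro!: derivative_eq_intros simp: mat_def)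
  have mn: "((\<lambda>t. minor S (?M t)) has_real_derivative (\<Sum>i\<in>S. minor (S - {i}) (?M t))) (at t)" for S
  proof -
    have "((\<lambda>t. minor S (?M t)) has_real_derivative
      (\<Sum>p\<in>{p. p permutes S}. of_int (sign p) * (\<Sum>i\<in>S. ?d i (p i) * (\<Prod>j\<in>S-{i}. ?M t $ j $ p j)))) (at t)"
      unfolding minor_def by (intro DERIV_sum DERIV_cmult has_field_derivative_prod ent)
    also have "(\<Sum>p\<in>{p. p permutes S}. of_int (sign p) * (\<Sum>i\<in>S. ?d i (p i) * (\<Prod>j\<in>S-{i}. ?M t $ j $ p j)))
      = (\<Sum>i\<in>S. \<Sum>p\<in>{p. p permutes S}. if p i = i then of_int (sign p) * (\<Prod>j\<in>S-{i}. ?M t $ j $ p j) else 0)"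
      unfolding sum_distrib_left by (subst sum.swap) (intro sum.cong refl, auto)
    also have "\<dots> = (\<Sum>i\<in>S. minor (S - {i}) (?M t))"
    proof (intro sum.cong refl)
      fix i assume i: "i \<in> S"
      let ?f = "\<lambda>p. of_int (sign p) * (\<Prod>j\<in>S-{i}. ?M t $ j $ p j)"
      have "(\<Sum>p\<in>{p. p permutes S}. if p i = i then ?f p else 0) = (\<Sum>p\<in>{p \<in> {p. p permutes S}. p i = i}. ?f p)"
        by (rule sum.inter_filter[symmetric]) (simp add: finite_permutations)
      also have "{p \<in> {p. p permutes S}. p i = i} = {p. p permutes (S - {i})}"
        using permutes_remove[OF i] by auto
      finally show "(\<Sum>p\<in>{p. p permutes S}. if p i = i then ?f p else 0) = minor (S - {i}) (?M t)"
        by (simp add: minor_def)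
    qed
    finally show ?thesis .
  qed
  have "((\<lambda>t. sigma_on I (Suc s) (?M t)) has_real_derivative
      (\<Sum>S\<in>{S. S \<subseteq> I \<and> card S = Suc s}. \<Sum>i\<in>S. minor (S - {i}) (?M t))) (at t)"
    unfolding sigma_on_minor by (intro DERIV_sum mn)
  also have "(\<Sum>S\<in>{S. S \<subseteq> I \<and> card S = Suc s}. \<Sum>i\<in>S. minor (S - {i}) (?M t))
     = (\<Sum>i\<in>I. \<Sum>S\<in>{S. S \<subseteq> I - {i} \<and> card S = s}. minor S (?M t))"
    by (rule sum_subset_remove) simp
  also have "\<dots> = (\<Sum>i\<in>I. \<Sum>S\<in>{S. S \<subseteq> I \<and> card S = s}. if i \<notin> S then minor S (?M t) else 0)"
  proof (rule sum.cong[OF refl])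
    fix i
    have "(\<Sum>S\<in>{S. S \<subseteq> I \<and> card S = s}. if i \<notin> S then minor S (?M t) else 0)
      = (\<Sum>S\<in>{S \<in> {S. S \<subseteq> I \<and> card S = s}. i \<notin> S}. minor S (?M t))"
      by (rule sum.inter_filter[symmetric]) simp
    also have "{S \<in> {S. S \<subseteq> I \<and> card S = s}. i \<notin> S} = {S. S \<subseteq> I - {i} \<and> card S = s}" by auto
    finally show "(\<Sum>S\<in>{S. S \<subseteq> I - {i} \<and> card S = s}. minor S (?M t))
       = (\<Sum>S\<in>{S. S \<subseteq> I \<and> card S = s}. if i \<notin> S then minor S (?M t) else 0)" by simp
  qed
  also have "\<dots> = (\<Sum>S\<in>{S. S \<subseteq> I \<and> card S = s}. \<Sum>i\<in>I. if i \<notin> S then minor S (?M t) else 0)"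
    by (rule sum.swap)
  also have "\<dots> = (\<Sum>S\<in>{S. S \<subseteq> I \<and> card S = s}. (real (card I) - real s) * minor S (?M t))"
  proof (intro sum.cong refl)
    fix S assume S: "S \<in> {S. S \<subseteq> I \<and> card S = s}"
    have "(\<Sum>i\<in>I. if i \<notin> S then minor S (?M t) else 0) = (\<Sum>i\<in>{i\<in>I. i \<notin> S}. minor S (?M t))"
      by (rule sum.inter_filter[symmetric]) simp
    also have "{i\<in>I. i \<notin> S} = I - S" by auto
    also have "(\<Sum>i\<in>I-S. minor S (?M t)) = real (card (I - S)) * minor S (?M t)" by simp
    also have "real (card (I - S)) = real (card I) - real s"
      using S card_mono[of I S] by (auto simp: card_Diff_subset of_nat_diff)
    finally show "(\<Sum>i\<in>I. if i \<notin> S then minor S (?M t) else 0) = (real (card I) - real s) * minor S (?M t)" .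
  qed
  finally show ?thesis by (simp add: sigma_on_minor sum_distrib_left)
qed

text \<open>Eigenvectors are found one at a time, as maximizers of the quadratic form on the unit
  sphere of the orthogonal complement \<open>W\<close> of the earlier ones. By symmetry
  \<open>M\<close> maps \<open>z\<close> back into \<open>W\<close>, so the defect
  \<open>y = M z - l z\<close> is an admissible variation.\<close>

lemma symmetric_eigenvectors:
  fixes M :: "real^'n^'n"
  assumes sym: "transpose M = M" and "m \<le> CARD('n)"
  shows "\<exists>B. finite B \<and> card B = m \<and> pairwise orthogonal B \<and> (\<forall>b\<in>B. norm b = 1 \<and> (\<exists>l. M *v b = l *\<^sub>R b))"
  using assms(2)
proof (induction m)
  case 0
  show ?case by (intro exI[of _ "{}"]) auto
next
  case (Suc m)
  then obtain B where B: "finite B" "card B = m" "pairwise orthogonal B"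
      "\<And>b. b \<in> B \<Longrightarrow> norm b = 1" "\<And>b. b \<in> B \<Longrightarrow> \<exists>l. M *v b = l *\<^sub>R b" by force
  have symd: "x \<bullet> (M *v y) = y \<bullet> (M *v x)" for x y
    by (metis sym dot_lmul_matrix inner_commute transpose_matrix_vector)
  define W where "W = {x. \<forall>b\<in>B. b \<bullet> x = 0}"
  have "dim B \<le> card B" using B(1) by (rule dim_le_card')
  then have "dim B < DIM(real^'n)" using Suc.prems B(2) by simp
  then obtain w where w: "w \<noteq> 0" "\<And>y. y \<in> span B \<Longrightarrow> orthogonal w y"
    using orthogonal_to_subspace_exists by blast
  then have "w \<in> W" by (auto simp: W_def orthogonal_def inner_commute span_base)
  have Wadd: "x + y \<in> W" if "x \<in> W" "y \<in> W" for x y using that by (auto simp: W_def inner_add_right)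
  have Wsc: "c *\<^sub>R x \<in> W" if "x \<in> W" for x c using that by (auto simp: W_def)
  have "closed W"
  proof -
    have "W = (\<Inter>b\<in>B. {x. b \<bullet> x = 0})" by (auto simp: W_def)
    then show ?thesis by (auto intro!: closed_INT closed_hyperplane)
  qed
  then have cpt: "compact (W \<inter> sphere 0 1)" by (intro closed_Int_compact) auto
  have "w /\<^sub>R norm w \<in> W \<inter> sphere 0 1" using w Wsc[OF \<open>w \<in> W\<close>] by auto
  then have "W \<inter> sphere 0 1 \<noteq> {}" by blast
  moreover have "continuous_on (W \<inter> sphere 0 1) (\<lambda>x. x \<bullet> (M *v x))"
    by (intro continuous_intros)
  ultimately obtain z where z': "z \<in> W \<inter> sphere 0 1" "\<forall>x\<in>W \<inter> sphere 0 1. x \<bullet> (M *v x) \<le> z \<bullet> (M *v z)"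
    using continuous_attains_sup[OF cpt] by blast
  then have z: "z \<in> W" "norm z = 1" and zmax: "\<And>x. x \<in> W \<Longrightarrow> norm x = 1 \<Longrightarrow> x \<bullet> (M *v x) \<le> z \<bullet> (M *v z)"
    by auto
  define l where "l = z \<bullet> (M *v z)"
  have le: "x \<bullet> (M *v x) \<le> l * (norm x)\<^sup>2" if "x \<in> W" for x
  proof (cases "x = 0")
    case False
    have "(x /\<^sub>R norm x) \<bullet> (M *v (x /\<^sub>R norm x)) \<le> l"
      unfolding l_def using zmax[OF Wsc[OF that, of "inverse (norm x)"]] False by simp
    then have "inverse (norm x) * (inverse (norm x) * (x \<bullet> (M *v x))) \<le> l"
      by (simp add: matrix_vector_mult_scaleR)
    then show ?thesis using False by (simp add: field_simps power2_eq_square)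
  qed simp
  define y where "y = M *v z - l *\<^sub>R z"
  have "M *v z \<in> W"
    unfolding W_def
  proof safe
    fix b assume b: "b \<in> B"
    then obtain c where "M *v b = c *\<^sub>R b" using B(5) by blast
    then have "b \<bullet> (M *v z) = c * (z \<bullet> b)" by (simp add: symd[of b z])
    then show "b \<bullet> (M *v z) = 0" using z(1) b by (simp add: W_def inner_commute)
  qed
  then have yW: "y \<in> W" unfolding y_def using Wadd[of _ "(-l) *\<^sub>R z"] Wsc[OF z(1), of "-l"] by simp
  have zz: "z \<bullet> z = 1" using z(2) by (simp add: norm_eq_1)
  have zy: "z \<bullet> y = 0" unfolding y_def by (simp add: inner_diff_right l_def zz)
  have yMz: "y \<bullet> (M *v z) = y \<bullet> y"
  proof -
    have "M *v z = y + l *\<^sub>R z" by (simp add: y_def)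
    then show ?thesis using zy by (simp add: inner_add_right inner_commute)
  qed
  \<comment> \<open>Comparison of \<open>z + t y\<close> with the maximum: the linear term
    \<open>2 t |y|^2\<close> can be dominated by a multiple of \<open>t^2\<close> for all small
    \<open>t > 0\<close> only if \<open>y = 0\<close>.\<close>
  have quad: "2 * t * (y \<bullet> y) \<le> t\<^sup>2 * (l * (y \<bullet> y) - y \<bullet> (M *v y))" for t
  proof -
    have "(z + t *\<^sub>R y) \<bullet> (M *v (z + t *\<^sub>R y)) \<le> l * (norm (z + t *\<^sub>R y))\<^sup>2"
      by (intro le Wadd Wsc z yW)
    moreover have "(z + t *\<^sub>R y) \<bullet> (M *v (z + t *\<^sub>R y)) = l + 2 * t * (y \<bullet> y) + t\<^sup>2 * (y \<bullet> (M *v y))"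
      using yMz symd[of z y] by (simp add: matrix_vector_right_distrib matrix_vector_mult_scaleR inner_add_left inner_add_right
          l_def[symmetric] power2_eq_square algebra_simps)
    moreover have "(norm (z + t *\<^sub>R y))\<^sup>2 = 1 + t\<^sup>2 * (y \<bullet> y)"
      unfolding power2_norm_eq_inner
      using zy zz by (simp add: inner_add_left inner_add_right inner_commute power2_eq_square)
    ultimately show ?thesis by (simp add: algebra_simps)
  qed
  have "y \<bullet> y = 0"
  proof (rule ccontr)
    assume "y \<bullet> y \<noteq> 0"
    then have p: "y \<bullet> y > 0" by simp
    define K where "K = \<bar>l * (y \<bullet> y) - y \<bullet> (M *v y)\<bar> + 1"
    have K: "K > 0" "l * (y \<bullet> y) - y \<bullet> (M *v y) \<le> K" by (auto simp: K_def)
    define t where "t = (y \<bullet> y) / K"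
    have t: "t > 0" using p K by (simp add: t_def)
    have "2 * t * (y \<bullet> y) \<le> t\<^sup>2 * K"
      using quad[of t] K(2) by (meson mult_left_mono order_trans zero_le_power2)
    also have "\<dots> = t * (y \<bullet> y)" using K by (simp add: t_def power2_eq_square)
    finally show False using t p by simp
  qed
  then have "M *v z = l *\<^sub>R z" by (simp add: y_def)
  moreover have "z \<notin> B"
    using z(1) zz by (force simp: W_def)
  moreover have "pairwise orthogonal (insert z B)"
    using B(3) z(1) by (auto simp: pairwise_insert W_def orthogonal_def inner_commute)
  ultimately show ?case
    using B z by (intro exI[of _ "insert z B"]) auto
qed

lemma symmetric_diagonalization:
  fixes M :: "real^'n^'n"
  assumes "transpose M = M"
  obtains Q l where "orthogonal_matrix Q" "transpose Q ** M ** Q = diag l"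
proof -
  obtain B where B: "finite B" "card B = CARD('n)" "pairwise orthogonal B"
      "\<And>b. b \<in> B \<Longrightarrow> norm b = 1" "\<And>b. b \<in> B \<Longrightarrow> \<exists>l. M *v b = l *\<^sub>R b"
    using symmetric_eigenvectors[OF assms order_refl] by blast
  obtain f :: "'n \<Rightarrow> real^'n" where f: "bij_betw f UNIV B"
    using finite_same_card_bij[of "UNIV::'n set" B] B by auto
  have fB: "f i \<in> B" for i using f by (auto simp: bij_betw_def)
  obtain l where l: "\<And>i. M *v f i = l i *\<^sub>R f i" using B(5)[OF fB] by metis
  define Q :: "real^'n^'n" where "Q = (\<chi> i j. f j $ i)"
  have ff: "f i \<bullet> f j = (if i = j then 1 else 0)" for i j
  proof (cases "i = j")
    case True
    then show ?thesis using B(4)[OF fB] by (simp add: norm_eq_1)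
  next
    case False
    then have "f i \<noteq> f j" using f by (auto simp: bij_betw_def inj_on_def)
    then show ?thesis using B(3) fB False by (auto simp: pairwise_def orthogonal_def)
  qed
  have "transpose Q ** Q = mat 1"
    using ff by (simp add: vec_eq_iff matrix_matrix_mult_def transpose_def Q_def mat_def inner_vec_def)
  then have 1: "orthogonal_matrix Q" by (simp add: orthogonal_matrix)
  have MQ: "(M ** Q) $ i $ j = l j * f j $ i" for i j
  proof -
    have "(M ** Q) $ i $ j = (M *v f j) $ i"
      by (simp add: matrix_matrix_mult_def matrix_vector_mult_def Q_def)
    then show ?thesis by (simp add: l)
  qed
  have "transpose Q ** M ** Q = diag l"
  proof -
    have "(transpose Q ** (M ** Q)) $ i $ j = diag l $ i $ j" for i j
    proof -
      have "(transpose Q ** (M ** Q)) $ i $ j = (\<Sum>k\<in>UNIV. f i $ k * (l j * f j $ k))"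
        unfolding matrix_matrix_mult_def[of "transpose Q"] by (simp add: MQ) (simp add: transpose_def Q_def)
      also have "\<dots> = l j * (f i \<bullet> f j)" by (simp add: inner_vec_def sum_distrib_left mult_ac)
      finally show ?thesis by (simp add: ff diag_def)
    qed
    then show ?thesis by (simp add: vec_eq_iff matrix_mul_assoc)
  qed
  then show ?thesis using 1 that by blast
qed

section \<open>The Garding cone\<close>

text \<open>Symmetry is built in, so that membership alone permits diagonalization.\<close>

definition garding_cone :: "nat \<Rightarrow> real^'n^'n \<Rightarrow> bool" where
  "garding_cone k M \<longleftrightarrow> transpose M = M \<and> (\<forall>j\<in>{1..k}. sigma j M > 0)"

text \<open>The Loewner order, in the form that the minimum tests deliver one vector at a
  time.\<close>

definition quad_le :: "real^'n^'n \<Rightarrow> real^'n^'n \<Rightarrow> bool" where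
  "quad_le A B \<longleftrightarrow> (\<forall>x. x \<bullet> (A *v x) \<le> x \<bullet> (B *v x))"

lemma transpose_plus: "transpose (A + B) = transpose A + transpose B"
  by (simp add: transpose_def vec_eq_iff)

lemma transpose_minus: "transpose (A - B) = transpose A - transpose B"
  by (simp add: transpose_def vec_eq_iff)

lemma transpose_scaleR: "transpose (c *\<^sub>R A) = c *\<^sub>R transpose A"
  by (simp add: transpose_def vec_eq_iff)

lemma transpose_outer: "transpose (outer x) = outer x"
  by (simp add: transpose_def outer_def vec_eq_iff mult.commute)

lemma transpose_conj:
  fixes M Q :: "real^'n^'n"
  assumes "transpose M = M"
  shows "transpose (transpose Q ** M ** Q) = transpose Q ** M ** Q"
  by (simp add: matrix_transpose_mul assms matrix_mul_assoc)

lemma outer_mult_vec: "outer x *v y = (x \<bullet> y) *\<^sub>R x"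
  by (simp add: outer_def matrix_vector_mult_def vec_eq_iff inner_vec_def sum_distrib_left mult_ac)

lemma outer_0: "outer 0 = 0"
  by (simp add: outer_def vec_eq_iff)

lemma conj_quad:
  fixes P Q :: "real^'n^'n"
  shows "x \<bullet> ((transpose Q ** P ** Q) *v y) = (Q *v x) \<bullet> (P *v (Q *v y))"
proof -
  have "(transpose Q ** P ** Q) *v y = (P *v (Q *v y)) v* Q"
    by (simp add: matrix_vector_mul_assoc[symmetric])
  then show ?thesis by (metis dot_lmul_matrix inner_commute)
qed

text \<open>In eigenvector coordinates the increment is a sum of squares \<open>(z $ i)^2\<close>
  weighted by the values of \<open>esym\<close> with the \<open>i\<close>-th eigenvalue removed,
  which are positive by \<open>esym_remove_pos\<close>.\<close>

lemma sigma_rank1_less: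
  fixes M :: "real^'n^'n"
  assumes "garding_cone k M" "x \<noteq> 0" "1 \<le> j" "j \<le> k"
  shows "sigma j M < sigma j (M + outer x)"
proof -
  obtain Q l where Q: "orthogonal_matrix Q" and D: "transpose Q ** M ** Q = diag l"
    using symmetric_diagonalization assms(1) by (metis garding_cone_def)
  obtain s where s: "j = Suc s" using assms(3) by (cases j) auto
  define z where "z = transpose Q *v x"
  have z0: "z \<noteq> 0"
  proof
    assume "z = 0"
    then have "Q *v (transpose Q *v x) = 0" by (simp add: z_def del: transpose_matrix_vector)
    then have "(Q ** transpose Q) *v x = 0" by (simp only: matrix_vector_mul_assoc)
    then show False using Q assms(2) by (simp add: orthogonal_matrix_def)
  qed
  have sg: "sigma i M = esym UNIV i l" for i
    by (metis D sigma_on_diag Q sigma_orthogonal_conj)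
  have "sigma j (M + outer x) = sigma j (diag l + outer z)"
    using sigma_orthogonal_conj[OF Q, of j "M + outer x"] by (simp only: conj_add conj_outer D z_def)
  also have "\<dots> = sigma j (diag l) + (\<Sum>i\<in>UNIV. (z $ i)\<^sup>2 * esym (UNIV - {i}) s l)"
    unfolding s by (rule sigma_rank1_diag)
  also have "sigma j (diag l) = sigma j M" by (simp add: sg sigma_on_diag)
  finally have eq: "sigma j (M + outer x) = sigma j M + (\<Sum>i\<in>UNIV. (z $ i)\<^sup>2 * esym (UNIV - {i}) s l)" .
  have pos: "esym (UNIV - {i}) s l > 0" for i
  proof (rule esym_remove_pos)
    fix a assume "1 \<le> a" "a \<le> Suc s"
    then show "esym UNIV a l > 0" using assms(1,4) s by (simp add: garding_cone_def sg)
  qed auto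
  obtain i where i: "z $ i \<noteq> 0" using z0 by (auto simp: vec_eq_iff)
  have "(\<Sum>i\<in>UNIV. (z $ i)\<^sup>2 * esym (UNIV - {i}) s l) > 0"
    by (rule sum_pos2[of _ i]) (use pos i in \<open>auto intro!: mult_nonneg_nonneg less_imp_le[OF pos]\<close>)
  then show ?thesis using eq by simp
qed

lemma garding_cone_rank1:
  assumes "garding_cone k M" "0 \<le> t"
  shows "garding_cone k (M + t *\<^sub>R outer x) \<and> (\<forall>j\<in>{1..k}. sigma j M \<le> sigma j (M + t *\<^sub>R outer x))"
proof -
  have "sigma j M \<le> sigma j (M + outer x)" if "j \<in> {1..k}" for j
    using sigma_rank1_less[OF assms(1), of x j] that by (cases "x = 0") (auto simp: outer_0)
  then have *: "sigma j M \<le> sigma j (M + t *\<^sub>R outer x)" if "j \<in> {1..k}" for j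
    using that assms(2) by (simp add: sigma_rank1[of _ _ t])
  moreover have "transpose (M + t *\<^sub>R outer x) = M + t *\<^sub>R outer x"
    using assms by (simp add: garding_cone_def transpose_plus transpose_scaleR transpose_outer)
  ultimately show ?thesis using assms(1) by (force simp: garding_cone_def)
qed

text \<open>The left side is the slope of \<open>sigma (Suc j)\<close> in the rank-one direction of
  \<open>axis e 1\<close>.\<close>

lemma sigma_tang_pos:
  fixes M :: "real^'n^'n"
  assumes "garding_cone (Suc k) M" "j \<le> k"
  shows "sigma j (tang e M) > 0"
proof -
  have "sigma (Suc j) M < sigma (Suc j) (M + outer (axis e 1))"
    by (rule sigma_rank1_less[OF assms(1)]) (use assms(2) in auto)
  also have "\<dots> = sigma (Suc j) M + sigma_on (UNIV - {e}) j M"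
    using sigma_axis[of j M 1 e] by simp
  finally show ?thesis by (simp add: sigma_on_tang)
qed

lemma transpose_tang: "transpose M = M \<Longrightarrow> transpose (tang e M) = tang e M"
  by (auto simp: transpose_def tang_def vec_eq_iff)

lemma garding_cone_tang: "garding_cone (Suc k) M \<Longrightarrow> garding_cone k (tang e M)"
  using sigma_tang_pos[of k M] transpose_tang[of M] unfolding garding_cone_def[of k] by (simp add: garding_cone_def)

text \<open>Diagonalizing \<open>B - A\<close> writes it as a sum of nonnegative rank-one terms.
  They are added one at a time, each step staying in the cone by
  \<open>garding_cone_rank1\<close>.\<close>

lemma garding_cone_mono:
  fixes A B :: "real^'n^'n"
  assumes A: "garding_cone k A" and B: "transpose B = B" and le: "quad_le A B"
  shows "garding_cone k B \<and> (\<forall>j\<in>{1..k}. sigma j A \<le> sigma j B)"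
proof -
  define P where "P = B - A"
  have "transpose P = P" using A B by (simp add: P_def transpose_minus garding_cone_def)
  then obtain Q l where Q: "orthogonal_matrix Q" and D: "transpose Q ** P ** Q = diag l"
    using symmetric_diagonalization by metis
  have l0: "l i \<ge> 0" for i
  proof -
    have "l i = axis i 1 \<bullet> (diag l *v axis i 1)"
      by (simp add: inner_axis' matrix_vector_mult_basis column_def diag_def)
    also have "\<dots> = (Q *v axis i 1) \<bullet> (P *v (Q *v axis i 1))"
      unfolding D[symmetric]
      by (rule conj_quad)
    also have "\<dots> \<ge> 0"
      using le unfolding quad_le_def P_def by (simp add: matrix_vector_mult_diff_rdistrib inner_diff_right)
    finally show ?thesis .
  qed
  define A' where "A' = transpose Q ** A ** Q"
  have A': "garding_cone k A'" "\<And>j. sigma j A' = sigma j A"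
    using A by (auto simp: garding_cone_def A'_def transpose_conj sigma_orthogonal_conj[OF Q])
  have ind: "garding_cone k (A' + (\<Sum>i\<in>F. l i *\<^sub>R outer (axis i 1))) \<and>
     (\<forall>j\<in>{1..k}. sigma j A' \<le> sigma j (A' + (\<Sum>i\<in>F. l i *\<^sub>R outer (axis i 1))))" if "finite F" for F
    using that
  proof (induction F)
    case empty
    then show ?case using A' by simp
  next
    case (insert i F)
    then show ?case
      using garding_cone_rank1[of k "A' + (\<Sum>i\<in>F. l i *\<^sub>R outer (axis i 1))" "l i" "axis i 1", OF _ l0]
      by (fastforce simp: add_ac)
  qed
  have "(\<Sum>i\<in>UNIV. l i *\<^sub>R outer (axis i 1)) = diag l"
  proof -
    have "(\<Sum>i\<in>UNIV. l i *\<^sub>R outer (axis i 1)) $ a $ b = diag l $ a $ b" for a b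
    proof -
      have "(\<Sum>i\<in>UNIV. l i *\<^sub>R outer (axis i 1)) $ a $ b = (\<Sum>i\<in>UNIV. if i = a then (if a = b then l a else 0) else 0)"
        unfolding sum_component by (intro sum.cong refl) (auto simp: outer_def axis_def)
      then show ?thesis by (simp add: diag_def)
    qed
    then show ?thesis by (simp add: vec_eq_iff)
  qed
  then have "A' + (\<Sum>i\<in>UNIV. l i *\<^sub>R outer (axis i 1)) = transpose Q ** A ** Q + transpose Q ** P ** Q"
    by (simp add: A'_def D)
  also have "\<dots> = transpose Q ** (A + P) ** Q" by (rule conj_add[symmetric])
  finally have "A' + (\<Sum>i\<in>UNIV. l i *\<^sub>R outer (axis i 1)) = transpose Q ** B ** Q"
    by (simp add: P_def)
  with ind[of UNIV] have "\<forall>j\<in>{1..k}. sigma j A \<le> sigma j B"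
    by (simp add: A' sigma_orthogonal_conj[OF Q])
  then show ?thesis using A B by (force simp: garding_cone_def)
qed

lemma continuous_on_sigma_on [continuous_intros]:
  fixes f :: "'a::topological_space \<Rightarrow> real^'n^'n"
  assumes "continuous_on S f"
  shows "continuous_on S (\<lambda>x. sigma_on I s (f x))"
  unfolding sigma_on_def by (intro continuous_intros assms)

lemma outer_scaleR: "outer (c *\<^sub>R x) = c\<^sup>2 *\<^sub>R outer x"
  by (simp add: outer_def vec_eq_iff power2_eq_square)

lemma continuous_on_outer [continuous_intros]:
  fixes f :: "'a::topological_space \<Rightarrow> real^'n"
  assumes "continuous_on S f"
  shows "continuous_on S (\<lambda>x. outer (f x))"
  unfolding outer_def by (intro continuous_intros assms)

lemma garding_cone_plus_mat1:
  assumes "garding_cone k A" "0 \<le> c"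
  shows "garding_cone k (A + c *\<^sub>R mat 1)"
proof -
  have "quad_le A (A + c *\<^sub>R mat 1)"
    using assms(2) by (simp add: quad_le_def matrix_vector_mult_add_rdistrib inner_add_right flip: scaleR_matrix_vector_assoc)
  then show ?thesis using garding_cone_mono[OF assms(1)] assms(1)
    by (simp add: transpose_plus transpose_scaleR garding_cone_def)
qed

text \<open>Uniform ellipticity on a compact set: \<open>th\<close> is the least gain from a unit
  rank-one term and \<open>T\<close> bounds the derivative in the direction of the identity, so an
  excess \<open>c\<close> in all directions loses against a deficit \<open>N * |x|^2\<close> along a
  single \<open>x\<close>.\<close>

lemma elliptic_compact1:
  fixes K :: "(real^'n^'n) set"
  assumes K: "compact K" "\<And>A. A \<in> K \<Longrightarrow> garding_cone k A" and j: "1 \<le> j" "j \<le> k"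
  shows "\<exists>L>0. \<forall>A\<in>K. \<forall>M c N x. garding_cone k M \<longrightarrow> 0 < c \<longrightarrow> c \<le> 1 \<longrightarrow> 0 \<le> N \<longrightarrow> L * c \<le> N * (norm x)\<^sup>2 \<longrightarrow>
     quad_le (M + N *\<^sub>R outer x) (A + c *\<^sub>R mat 1) \<longrightarrow> sigma j M < sigma j A"
proof (cases "K = {}")
  case True
  then show ?thesis by (intro exI[of _ 1]) auto
next
  case False
  define S where "S = K \<times> {0..1::real} \<times> sphere (0::real^'n) 1"
  have cS: "compact S" unfolding S_def by (intro compact_Times K) auto
  have "axis undefined 1 \<in> sphere (0::real^'n) 1" by simp
  then have S0: "S \<noteq> {}" using False by (auto simp: S_def)
  define f where "f = (\<lambda>(A, c, x::real^'n). sigma j (A + c *\<^sub>R mat 1 + outer x) - sigma j (A + c *\<^sub>R mat 1))"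
  have "continuous_on S f" unfolding f_def case_prod_beta by (intro continuous_intros)
  then obtain y where y: "y \<in> S" "\<And>z. z \<in> S \<Longrightarrow> f y \<le> f z"
    using continuous_attains_inf[OF cS S0] by blast
  have fpos: "f z > 0" if "z \<in> S" for z
  proof -
    obtain A c x where z: "z = (A, c, x)" by (cases z) auto
    then have "garding_cone k (A + c *\<^sub>R mat 1)" "x \<noteq> 0" using that K(2) by (auto simp: S_def intro!: garding_cone_plus_mat1)
    from sigma_rank1_less[OF this j] show ?thesis by (simp add: f_def z)
  qed
  define th where "th = f y"
  have th: "th > 0" "\<And>A c x. A \<in> K \<Longrightarrow> 0 \<le> c \<Longrightarrow> c \<le> 1 \<Longrightarrow> norm x = 1 \<Longrightarrow>
      th \<le> sigma j (A + c *\<^sub>R mat 1 + outer x) - sigma j (A + c *\<^sub>R mat 1)"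
    using fpos y by (fastforce simp: th_def S_def f_def)+
  obtain s where s: "j = Suc s" using j by (cases j) auto
  define g where "g = (\<lambda>(A::real^'n^'n, c::real). (real (card (UNIV::'n set)) - real s) * sigma s (A + c *\<^sub>R mat 1))"
  have cg: "compact (K \<times> {0..1::real})" by (intro compact_Times K) auto
  have "continuous_on (K \<times> {0..1}) g" unfolding g_def case_prod_beta by (intro continuous_intros)
  then have "bounded (g ` (K \<times> {0..1}))" using cg compact_continuous_image compact_imp_bounded by blast
  then obtain T where T: "T > 0" "\<And>A c. A \<in> K \<Longrightarrow> 0 \<le> c \<Longrightarrow> c \<le> 1 \<Longrightarrow> \<bar>g (A, c)\<bar> \<le> T"
    unfolding bounded_pos by force
  have up: "sigma j (A + c *\<^sub>R mat 1) \<le> sigma j A + T * c" if ac: "A \<in> K" "0 < c" "c \<le> 1" for A c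
  proof -
    obtain z where z: "0 < z" "z < c" "sigma j (A + c *\<^sub>R mat 1) - sigma j (A + 0 *\<^sub>R mat 1) = (c - 0) * g (A, z)"
      using MVT2[of 0 c "\<lambda>t. sigma j (A + t *\<^sub>R mat 1)" "\<lambda>t. g (A, t)"] ac(2)
      unfolding s g_def by (auto intro!: deriv_sigma_on_mat1)
    have "c * g (A, z) \<le> c * T" using T(2)[of A z] ac z by (intro mult_left_mono) auto
    then show ?thesis using z(3) by (simp add: mult.commute)
  qed
  show ?thesis
  \<comment> \<open>\<open>T / th\<close> balances the gain \<open>T * c\<close> against the loss
    \<open>th * N * |x|^2\<close>; the extra 1 makes the result strict.\<close>
  proof (intro exI[of _ "T / th + 1"] conjI ballI allI impI)
    show "T / th + 1 > 0" using T th by (simp add: add_pos_pos)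
    fix A M c N x
    assume a: "A \<in> K" "garding_cone k M" "0 < c" "c \<le> 1" "0 \<le> N" "(T / th + 1) * c \<le> N * (norm x)\<^sup>2"
      "quad_le (M + N *\<^sub>R outer x) (A + c *\<^sub>R mat 1)"
    have lc: "(T / th + 1) * c > 0" using T th a by (simp add: add_pos_pos)
    then have x0: "x \<noteq> 0" using a(6) by auto
    let ?B = "A + c *\<^sub>R mat 1 + (- N) *\<^sub>R outer x"
    \<comment> \<open>Of the two matrices only \<open>M\<close> is known to lie in the cone, so
      monotonicity starts from \<open>M\<close>; the value at \<open>?B\<close> is then computed by
      affinity in the rank-one direction.\<close>
    have "quad_le M ?B"
      using a(7) unfolding quad_le_def
      by (simp add: matrix_vector_mult_add_rdistrib matrix_vector_mult_diff_rdistrib inner_add_right inner_diff_right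
          flip: scaleR_matrix_vector_assoc)
        (smt (verit) inner_minus_right scaleR_minus_left)
    moreover have "transpose ?B = ?B"
      using K(2)[OF a(1)] by (simp add: garding_cone_def transpose_minus transpose_plus transpose_scaleR transpose_outer)
    ultimately have "sigma j M \<le> sigma j ?B" using garding_cone_mono[OF a(2)] j by (meson atLeastAtMost_iff)
    also have "?B = A + c *\<^sub>R mat 1 + (- N * (norm x)\<^sup>2) *\<^sub>R outer (x /\<^sub>R norm x)"
      using x0 by (simp add: outer_scaleR power_inverse field_simps)
    also have "sigma j \<dots> = sigma j (A + c *\<^sub>R mat 1) + (- N * (norm x)\<^sup>2) *
        (sigma j (A + c *\<^sub>R mat 1 + outer (x /\<^sub>R norm x)) - sigma j (A + c *\<^sub>R mat 1))"
      by (rule sigma_rank1)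
    also have "\<dots> \<le> sigma j A + T * c - N * (norm x)\<^sup>2 * th"
    proof -
      have "N * (norm x)\<^sup>2 * th \<le> N * (norm x)\<^sup>2 * (sigma j (A + c *\<^sub>R mat 1 + outer (x /\<^sub>R norm x)) - sigma j (A + c *\<^sub>R mat 1))"
        by (intro mult_left_mono th) (use a x0 in auto)
      then show ?thesis using up[OF a(1,3,4)] by simp
    qed
    also have "\<dots> \<le> sigma j A + T * c - (T / th + 1) * c * th"
      using mult_right_mono[OF a(6), of th] th(1) by simp
    also have "\<dots> = sigma j A - c * th" using th(1) by (simp add: field_simps)
    also have "\<dots> < sigma j A" using a th(1) by simp
    finally show "sigma j M < sigma j A" .
  qed
qed

lemma elliptic_compact:
  fixes K :: "(real^'n^'n) set"
  assumes K: "compact K" "\<And>A. A \<in> K \<Longrightarrow> garding_cone k A"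
  obtains L where "L > 0" "\<And>A M c N x j. A \<in> K \<Longrightarrow> garding_cone k M \<Longrightarrow> 0 < c \<Longrightarrow> c \<le> 1 \<Longrightarrow> 0 \<le> N \<Longrightarrow>
     L * c \<le> N * (norm x)\<^sup>2 \<Longrightarrow> quad_le (M + N *\<^sub>R outer x) (A + c *\<^sub>R mat 1) \<Longrightarrow> 1 \<le> j \<Longrightarrow> j \<le> k \<Longrightarrow>
     sigma j M < sigma j A"
proof -
  have "\<forall>j\<in>{1..k}. \<exists>L>0. \<forall>A\<in>K. \<forall>M c N x. garding_cone k M \<longrightarrow> 0 < c \<longrightarrow> c \<le> 1 \<longrightarrow> 0 \<le> N \<longrightarrow> L * c \<le> N * (norm x)\<^sup>2 \<longrightarrow>
     quad_le (M + N *\<^sub>R outer x) (A + c *\<^sub>R mat 1) \<longrightarrow> sigma j M < sigma j A"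
    using elliptic_compact1[OF K] by simp
  from bchoice[OF this] obtain f where f0: "\<And>j. j \<in> {1..k} \<Longrightarrow> f j > 0"
    and f: "\<And>j A M c N x. j \<in> {1..k} \<Longrightarrow> A \<in> K \<Longrightarrow> garding_cone k M \<Longrightarrow> 0 < c \<Longrightarrow> c \<le> 1 \<Longrightarrow> 0 \<le> N \<Longrightarrow>
     f j * c \<le> N * (norm x)\<^sup>2 \<Longrightarrow> quad_le (M + N *\<^sub>R outer x) (A + c *\<^sub>R mat 1) \<Longrightarrow> sigma j M < sigma j A"
    by blast
  define L where "L = 1 + (\<Sum>j\<in>{1..k}. f j)"
  have L: "f j \<le> L" if "j \<in> {1..k}" for j
    using member_le_sum[of j "{1..k}" f] that f0 by (fastforce simp: L_def)
  have "L > 0" unfolding L_def using f0 by (smt (verit) sum_nonneg)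
  moreover have "sigma j M < sigma j A" if "A \<in> K" "garding_cone k M" "0 < c" "c \<le> 1" "0 \<le> N"
     "L * c \<le> N * (norm x)\<^sup>2" "quad_le (M + N *\<^sub>R outer x) (A + c *\<^sub>R mat 1)" "1 \<le> j" "j \<le> k" for A M c N x j
    using that L[of j] by (intro f[of j A M c N x]) (auto intro: order_trans[OF mult_right_mono])
  ultimately show ?thesis using that by blast
qed

section \<open>The boundary operator and second derivatives\<close>

text \<open>The leading term of \<open>Bk\<close> is absorbed as \<open>s = 0\<close>, and
  \<open>h\<close> and \<open>M\<close> are independent arguments, so that the operator can be
  followed along paths in \<open>h\<close>.\<close>

definition boundary_op :: "'n \<Rightarrow> nat \<Rightarrow> real \<Rightarrow> real^'n^'n \<Rightarrow> real" where
  "boundary_op e k h M = (\<Sum>s<k. fact (CARD('n) - 1 - s) / (fact (CARD('n) - k) * real (odd_dfact (k - s)))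
     * sigma_on (UNIV - {e}) s M * h ^ (2 * k - 2 * s - 1))"

lemma odd_dfact_Suc: "odd_dfact (Suc m) = odd_dfact m * (2 * m + 1)"
  by (simp add: odd_dfact_def)

lemma odd_dfact_pos: "odd_dfact m > 0"
  by (induction m) (auto simp: odd_dfact_Suc, simp add: odd_dfact_def)

text \<open>The coefficients of the boundary operator are exactly those for which all terms
  except the last one cancel in this derivative.\<close>

lemma deriv_Bop:
  fixes M :: "real^'n^'n"
  assumes k: "1 \<le> k" "k \<le> CARD('n)"
  shows "((\<lambda>h. boundary_op e k h (M - (h\<^sup>2 / 2) *\<^sub>R mat 1)) has_real_derivative
     sigma_on (UNIV - {e}) (k - 1) (M - (h\<^sup>2 / 2) *\<^sub>R mat 1)) (at h)"
proof -
  obtain q where q: "k = Suc q" using k by (cases k) auto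
  let ?n = "CARD('n)" and ?I = "UNIV - {e}"
  let ?N = "\<lambda>h. M - (h\<^sup>2 / 2) *\<^sub>R mat 1"
  define c where "c s = fact (?n - 1 - s) / (fact (?n - k) * real (odd_dfact (k - s)))" for s
  \<comment> \<open>\<open>F\<close> collects the derivatives of the powers of \<open>h\<close>, and
    \<open>G\<close> those of the symmetric functions; \<open>G (Suc r)\<close> will cancel
    \<open>F r\<close>.\<close>
  define F where "F s = c s * sigma_on ?I s (?N h) * (real (2 * k - 2 * s - 1) * h ^ (2 * k - 2 * s - 2))" for s
  define G where "G s = (case s of 0 \<Rightarrow> 0 | Suc r \<Rightarrow> - c s * (real ?n - 1 - real r) * h * sigma_on ?I r (?N h) * h ^ (2 * k - 2 * s - 1))" for s
  have cI: "real (card ?I) = real ?n - 1"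
    by (simp add: card_Diff_singleton of_nat_diff Suc_leI)
  have dN: "((\<lambda>h. sigma_on ?I (Suc r) (?N h)) has_real_derivative - h * ((real ?n - 1 - real r) * sigma_on ?I r (?N h))) (at h)" for r
  proof -
    have "((\<lambda>h. sigma_on ?I (Suc r) (M + (- (h\<^sup>2 / 2)) *\<^sub>R mat 1)) has_real_derivative
       (real (card ?I) - real r) * sigma_on ?I r (M + (- (h\<^sup>2 / 2)) *\<^sub>R mat 1) * (- h)) (at h)"
      by (rule DERIV_chain2[OF deriv_sigma_on_mat1]) (auto intro!: derivative_eq_intros)
    then show ?thesis by (simp add: cI mult_ac)
  qed
  have dpow: "((\<lambda>h. h ^ m) has_real_derivative (real m * h ^ (m - 1))) (at h)" for m
    using DERIV_pow[of m h UNIV] by simp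
  have trm: "((\<lambda>h. c s * sigma_on ?I s (?N h) * h ^ (2 * k - 2 * s - 1)) has_real_derivative F s + G s) (at h)" for s
  proof (cases s)
    case 0
    have "((\<lambda>h. c s * h ^ (2 * k - 2 * s - 1)) has_real_derivative F s + G s) (at h)"
      unfolding F_def G_def 0 using DERIV_cmult[OF dpow[of "2 * k - 1"], of "c 0"]
      by (simp add: sigma_on_0 mult_ac numeral_2_eq_2)
    then show ?thesis unfolding 0 sigma_on_0 by simp
  next
    case (Suc r)
    have "((\<lambda>h. c s * (sigma_on ?I (Suc r) (?N h) * h ^ (2 * k - 2 * s - 1))) has_real_derivative
      c s * (sigma_on ?I (Suc r) (?N h) * (real (2 * k - 2 * s - 1) * h ^ (2 * k - 2 * s - 1 - 1)) +
        - h * ((real ?n - 1 - real r) * sigma_on ?I r (?N h)) * h ^ (2 * k - 2 * s - 1))) (at h)"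
      by (rule DERIV_cmult[OF DERIV_mult'[OF dN dpow]])
    moreover have "c s * (sigma_on ?I (Suc r) (?N h) * (real (2 * k - 2 * s - 1) * h ^ (2 * k - 2 * s - 1 - 1)) +
        - h * ((real ?n - 1 - real r) * sigma_on ?I r (?N h)) * h ^ (2 * k - 2 * s - 1)) = F s + G s"
      unfolding F_def G_def Suc by (simp add: algebra_simps numeral_2_eq_2)
    ultimately show ?thesis by (simp add: Suc mult.assoc)
  qed
  have GF: "G (Suc r) = - F r" if "r < q" for r
  proof -
    have "r < ?n - 1" using that q k by simp
    then have f: "fact (?n - 1 - r) = (real ?n - 1 - real r) * fact (?n - 1 - Suc r)"
      by (subst fact_reduce) (auto simp: of_nat_diff Suc_diff_Suc)
    have o: "odd_dfact (k - r) = odd_dfact (k - Suc r) * (2 * k - 2 * r - 1)"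
      using that q odd_dfact_Suc[of "k - Suc r"] by (simp add: Suc_diff_le algebra_simps)
    define X where "X = real (2 * k - 2 * r - 1)"
    have m: "X > 0" using that q by (simp add: X_def)
    have oR: "real (odd_dfact (k - r)) = real (odd_dfact (k - Suc r)) * X"
      unfolding o X_def by (rule of_nat_mult)
    have e1: "c (Suc r) * (real ?n - 1 - real r) = c r * X"
      unfolding c_def f oR using m odd_dfact_pos[of "k - Suc r"] by (simp add: mult.commute)
    have e2: "h * h ^ (2 * k - 2 * Suc r - 1) = h ^ (2 * k - 2 * r - 2)"
    proof -
      have "Suc (2 * k - 2 * Suc r - 1) = 2 * k - 2 * r - 2" using that q by simp
      then show ?thesis by (metis power_Suc)
    qed
    have "G (Suc r) = - ((c (Suc r) * (real ?n - 1 - real r)) * sigma_on ?I r (?N h) * (h * h ^ (2 * k - 2 * Suc r - 1)))"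
      unfolding G_def by simp
    also have "\<dots> = - (c r * X * sigma_on ?I r (?N h) * h ^ (2 * k - 2 * r - 2))"
      unfolding e1 e2 by (rule refl)
    also have "\<dots> = - F r" unfolding F_def X_def by simp
    finally show ?thesis .
  qed
  have "(\<Sum>s\<le>p. F s + G s) = F p" if "p \<le> q" for p
    using that
  proof (induction p)
    case 0
    then show ?case by (simp add: G_def)
  next
    case (Suc p)
    then show ?case using GF[of p] by simp
  qed
  then have S: "(\<Sum>s<k. F s + G s) = F q" unfolding q lessThan_Suc_atMost by simp
  have Fq: "F q = sigma_on ?I (k - 1) (?N h)"
    unfolding F_def c_def q by (simp add: odd_dfact_def)
  have "((\<lambda>h. \<Sum>s<k. c s * sigma_on ?I s (?N h) * h ^ (2 * k - 2 * s - 1)) has_real_derivative (\<Sum>s<k. F s + G s)) (at h)"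
    by (intro DERIV_sum trm)
  then show ?thesis unfolding S Fq by (simp add: boundary_op_def c_def)
qed

lemma boundary_op_mono_sigma:
  assumes "0 \<le> h" "\<And>s. 1 \<le> s \<Longrightarrow> s < k \<Longrightarrow> sigma_on (UNIV - {e}) s M \<le> sigma_on (UNIV - {e}) s N"
  shows "boundary_op e k h M \<le> boundary_op e k h N"
  unfolding boundary_op_def
proof (intro sum_mono mult_right_mono mult_left_mono)
  fix s assume "s \<in> {..<k}"
  then show "sigma_on (UNIV - {e}) s M \<le> sigma_on (UNIV - {e}) s N"
    using assms(2)[of s] by (cases "s = 0") (auto simp: sigma_on_0)
qed (use assms in auto)

text \<open>All powers of \<open>h\<close> are odd and all coefficients are nonnegative in the cone,
  so \<open>h <= 0\<close> makes every term nonpositive.\<close>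

lemma boundary_op_pos_imp:
  assumes "garding_cone k M" "boundary_op e k h M > 0"
  shows "h > 0"
proof (rule ccontr)
  assume "\<not> h > 0"
  then have h: "- h \<ge> 0" by simp
  have "boundary_op e k h M \<le> 0"
    unfolding boundary_op_def
  proof (intro sum_nonpos mult_nonneg_nonpos mult_nonneg_nonneg)
    fix s assume s: "s \<in> {..<k}"
    then obtain r where r: "k = Suc r" "s \<le> r" by (cases k) auto
    then show "0 \<le> sigma_on (UNIV - {e}) s M"
      using sigma_tang_pos[of r M s e] assms(1) by (simp add: sigma_on_tang)
    have "odd (2 * k - 2 * s - 1)" using r by auto
    then have "h ^ (2 * k - 2 * s - 1) = - ((- h) ^ (2 * k - 2 * s - 1))" by simp
    then show "h ^ (2 * k - 2 * s - 1) \<le> 0" using h by (metis neg_le_0_iff_le zero_le_power)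
  qed auto
  then show False using assms by simp
qed

text \<open>When tangential gradients agree, passing from \<open>h1\<close> to \<open>h2\<close>
  changes the term \<open>|Dv|^2 / 2\<close> of the Schouten tensor by exactly
  \<open>(h1^2 - h2^2) / 2\<close>. Along the path \<open>M - h^2 / 2\<close> times the identity,
  which ends at \<open>A1\<close>, the derivative of the operator is the positive
  \<open>sigma (k - 1)\<close> of the tangential block.\<close>

lemma boundary_op_less:
  fixes A1 A2 :: "real^'n^'n"
  assumes k: "1 \<le> k" "k \<le> CARD('n)" and A1: "garding_cone k A1" and h: "0 < h2" "h2 < h1"
    and le: "\<And>s. 1 \<le> s \<Longrightarrow> s < k \<Longrightarrow> sigma s (tang e A2) \<le> sigma s (tang e (A1 + ((h1\<^sup>2 - h2\<^sup>2) / 2) *\<^sub>R mat 1))"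
  shows "boundary_op e k h2 A2 < boundary_op e k h1 A1"
proof -
  define M where "M = A1 + (h1\<^sup>2 / 2) *\<^sub>R mat 1"
  have M: "M - (h\<^sup>2 / 2) *\<^sub>R mat 1 = A1 + ((h1\<^sup>2 - h\<^sup>2) / 2) *\<^sub>R mat 1" for h
    by (simp add: M_def diff_divide_distrib scaleR_diff_left)
  have "boundary_op e k h2 A2 \<le> boundary_op e k h2 (M - (h2\<^sup>2 / 2) *\<^sub>R mat 1)"
    unfolding M by (rule boundary_op_mono_sigma) (use h le in \<open>auto simp: sigma_on_tang\<close>)
  also have "\<dots> < boundary_op e k h1 (M - (h1\<^sup>2 / 2) *\<^sub>R mat 1)"
  proof (rule DERIV_pos_imp_increasing[OF h(2)])
    fix t assume t: "h2 \<le> t" "t \<le> h1"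
    have "t\<^sup>2 \<le> h1\<^sup>2" using t h by (intro power_mono) auto
    then have "garding_cone k (M - (t\<^sup>2 / 2) *\<^sub>R mat 1)" unfolding M by (intro garding_cone_plus_mat1 A1) simp
    then have "sigma (k - 1) (tang e (M - (t\<^sup>2 / 2) *\<^sub>R mat 1)) > 0"
      using k by (intro sigma_tang_pos[of "k - 1"]) auto
    then show "\<exists>y. ((\<lambda>h. boundary_op e k h (M - (h\<^sup>2 / 2) *\<^sub>R mat 1)) has_real_derivative y) (at t) \<and> 0 < y"
      using deriv_Bop[OF k, of e M t] by (auto simp: sigma_on_tang)
  qed
  also have "M - (h1\<^sup>2 / 2) *\<^sub>R mat 1 = A1" by (simp add: M_def)
  finally show ?thesis .
qed

section \<open>Derivative tests along segments and symmetry of the Hessian\<close>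

lemma C2_line:
  assumes C: "C2_with S f Df D2f" and S: "\<And>t. t \<in> T \<Longrightarrow> y + t *\<^sub>R x \<in> S" and t: "t \<in> T"
  shows "((\<lambda>t. f (y + t *\<^sub>R x)) has_real_derivative Df (y + t *\<^sub>R x) \<bullet> x) (at t within T)"
    and "((\<lambda>t. Df (y + t *\<^sub>R x) \<bullet> z) has_real_derivative (D2f (y + t *\<^sub>R x) *v x) \<bullet> z) (at t within T)"
proof -
  have l: "((\<lambda>t. y + t *\<^sub>R x) has_derivative (\<lambda>h. h *\<^sub>R x)) (at t within T)"
    by (auto intro!: derivative_eq_intros)
  have sub: "(\<lambda>t. y + t *\<^sub>R x) ` T \<subseteq> S" using S by auto
  have "((\<lambda>t. f (y + t *\<^sub>R x)) has_derivative (\<lambda>h. Df (y + t *\<^sub>R x) \<bullet> (h *\<^sub>R x))) (at t within T)"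
    by (rule has_derivative_in_compose2[OF _ sub t l]) (use C in \<open>auto simp: C2_with_def\<close>)
  then show "((\<lambda>t. f (y + t *\<^sub>R x)) has_real_derivative Df (y + t *\<^sub>R x) \<bullet> x) (at t within T)"
    by (rule has_derivative_imp_has_field_derivative) simp
  have "((\<lambda>t. Df (y + t *\<^sub>R x)) has_derivative (\<lambda>h. D2f (y + t *\<^sub>R x) *v (h *\<^sub>R x))) (at t within T)"
    by (rule has_derivative_in_compose2[OF _ sub t l]) (use C in \<open>auto simp: C2_with_def\<close>)
  from has_derivative_inner_left[OF this, of z]
  show "((\<lambda>t. Df (y + t *\<^sub>R x) \<bullet> z) has_real_derivative (D2f (y + t *\<^sub>R x) *v x) \<bullet> z) (at t within T)"
    by (rule has_derivative_imp_has_field_derivative) (simp add: matrix_vector_mult_scaleR)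
qed

text \<open>The test takes place on one segment inside \<open>S\<close>, so it applies at boundary
  points in tangential directions.\<close>

lemma C2_min_two_sided:
  assumes C: "C2_with S f Df D2f" and d: "d > 0"
    and S: "\<And>t. \<bar>t\<bar> < d \<Longrightarrow> y + t *\<^sub>R x \<in> S"
    and min: "\<And>t. \<bar>t\<bar> < d \<Longrightarrow> f y \<le> f (y + t *\<^sub>R x)"
  shows "Df y \<bullet> x = 0" "x \<bullet> (D2f y *v x) \<ge> 0"
proof -
  let ?T = "{-d<..<d}"
  have ST: "y + t *\<^sub>R x \<in> S" if "t \<in> ?T" for t using S that by auto
  have at: "at t within ?T = at t" if "\<bar>t\<bar> < d" for t
    using that by (intro at_within_open) auto
  have g1: "((\<lambda>t. f (y + t *\<^sub>R x)) has_real_derivative Df (y + t *\<^sub>R x) \<bullet> x) (at t)" if "\<bar>t\<bar> < d" for t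
  proof -
    have "t \<in> ?T" using that by auto
    from C2_line(1)[OF C ST this] show ?thesis using at[OF that] by simp
  qed
  have g2: "((\<lambda>t. Df (y + t *\<^sub>R x) \<bullet> x) has_real_derivative (D2f y *v x) \<bullet> x) (at 0)"
  proof -
    have "0 \<in> ?T" using d by auto
    from C2_line(2)[OF C ST this, of x] show ?thesis using at[of 0] d by simp
  qed
  have z: "Df (y + 0 *\<^sub>R x) \<bullet> x = 0"
    by (rule DERIV_local_min[OF g1[of 0] d]) (use d min in auto)
  then show "Df y \<bullet> x = 0" by simp
  show "x \<bullet> (D2f y *v x) \<ge> 0"
  proof (rule ccontr)
    assume "\<not> ?thesis"
    then have "(D2f y *v x) \<bullet> x < 0" by (simp add: inner_commute)
    from DERIV_neg_dec_right[OF g2 this] obtain d' where d': "d' > 0"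
      "\<And>h. 0 < h \<Longrightarrow> h < d' \<Longrightarrow> Df (y + h *\<^sub>R x) \<bullet> x < 0" using z by auto
    define h where "h = min d d' / 2"
    have h: "0 < h" "h < d" "h < d'" using d d' by (auto simp: h_def)
    have "\<exists>w>0. w < h \<and> f (y + h *\<^sub>R x) - f (y + 0 *\<^sub>R x) = (h - 0) * (Df (y + w *\<^sub>R x) \<bullet> x)"
      by (rule MVT2) (use g1 h in auto)
    then obtain w where "0 < w" "w < h" "f (y + h *\<^sub>R x) - f (y + 0 *\<^sub>R x) = (h - 0) * (Df (y + w *\<^sub>R x) \<bullet> x)"
      by blast
    moreover have "h * (Df (y + w *\<^sub>R x) \<bullet> x) < 0"
      using d'(2)[of w] h \<open>0 < w\<close> \<open>w < h\<close> by (simp add: mult_pos_neg)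
    ultimately show False using min[of h] h by simp
  qed
qed

lemma C2_min_one_sided:
  assumes C: "C2_with S f Df D2f" and d: "d > 0"
    and S: "\<And>t. 0 \<le> t \<Longrightarrow> t < d \<Longrightarrow> y + t *\<^sub>R x \<in> S"
    and min: "\<And>t. 0 \<le> t \<Longrightarrow> t < d \<Longrightarrow> f y \<le> f (y + t *\<^sub>R x)"
  shows "Df y \<bullet> x \<ge> 0"
proof (rule ccontr)
  assume "\<not> ?thesis"
  then have n: "Df (y + 0 *\<^sub>R x) \<bullet> x < 0" by simp
  have "((\<lambda>t. f (y + t *\<^sub>R x)) has_real_derivative Df (y + 0 *\<^sub>R x) \<bullet> x) (at 0 within {0..<d})"
    by (rule C2_line(1)[OF C]) (use S d in auto)
  from has_real_derivative_neg_dec_right[OF this n] obtain d' where d': "d' > 0"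
    "\<And>h. 0 < h \<Longrightarrow> h \<in> {0..<d} \<Longrightarrow> h < d' \<Longrightarrow> f (y + h *\<^sub>R x) < f y" by auto
  define h where "h = min d d' / 2"
  have h: "0 < h" "h < d" "h < d'" using d d' by (auto simp: h_def)
  then show False using d'(2)[of h] min[of h] by auto
qed

text \<open>The mean value theorem in direction \<open>a\<close> reduces the second difference to a
  difference of two gradients, and both are expanded to first order at \<open>x\<close>. The error
  bound treats \<open>a\<close> and \<open>b\<close> differently.\<close>

lemma second_difference:
  fixes f :: "real^'n \<Rightarrow> real"
  assumes C: "C2_with S f Df D2f" and x: "x \<in> interior S" and ep: "ep > 0"
  shows "\<exists>d>0. \<forall>t. 0 < t \<and> t < d \<longrightarrow>
    \<bar>f (x + t *\<^sub>R (a + b)) - f (x + t *\<^sub>R a) - f (x + t *\<^sub>R b) + f x - t\<^sup>2 * (a \<bullet> (D2f x *v b))\<bar>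
     \<le> ep * (t\<^sup>2 * (norm a * (2 * norm a + norm b)))"
proof -
  obtain r where r: "r > 0" "ball x r \<subseteq> S" using x by (meson mem_interior)
  have xS: "x \<in> S" using x interior_subset by blast
  have "(Df has_derivative (\<lambda>h. D2f x *v h)) (at x)"
    using C xS at_within_interior[OF x] by (auto simp: C2_with_def)
  from this[unfolded has_derivative_at_alt] ep
  obtain d where d: "d > 0" "\<And>y. norm (y - x) < d \<Longrightarrow> norm (Df y - Df x - D2f x *v (y - x)) \<le> ep * norm (y - x)"
    by blast
  define m where "m = norm a + norm b + 1"
  have m: "m > 0" by (simp add: m_def add_nonneg_pos)
  show ?thesis
  proof (intro exI[of _ "min d r / m"] conjI allI impI)
    show "min d r / m > 0" using d r m by simp
    fix t assume "0 < t \<and> t < min d r / m"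
    then have t: "0 < t" "t * m < d" "t * m < r" using m by (auto simp: field_simps)
    have nrm: "norm (u *\<^sub>R (t *\<^sub>R a) + w *\<^sub>R (t *\<^sub>R b)) \<le> t * (norm a + norm b * w)" if "0 \<le> u" "u \<le> 1" "0 \<le> w" for u w
    proof -
      have "norm (u *\<^sub>R (t *\<^sub>R a) + w *\<^sub>R (t *\<^sub>R b)) \<le> u * (t * norm a) + w * (t * norm b)"
        using norm_triangle_ineq[of "u *\<^sub>R (t *\<^sub>R a)" "w *\<^sub>R (t *\<^sub>R b)"] that t by simp
      also have "u * (t * norm a) \<le> 1 * (t * norm a)" using that t by (intro mult_right_mono) auto
      finally show ?thesis by (simp add: algebra_simps)
    qed
    have nm: "norm (u *\<^sub>R (t *\<^sub>R a) + w *\<^sub>R (t *\<^sub>R b)) < t * m" if "0 \<le> u" "u \<le> 1" "0 \<le> w" "w \<le> 1" for u w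
    proof -
      have "t * (norm a + norm b * w) \<le> t * (norm a + norm b * 1)"
        using that t by (intro mult_left_mono add_left_mono) auto
      also have "\<dots> < t * m" using t by (simp add: m_def)
      finally show ?thesis using nrm[of u w] that by simp
    qed
    define G where "G u = f (x + t *\<^sub>R b + u *\<^sub>R (t *\<^sub>R a)) - f (x + u *\<^sub>R (t *\<^sub>R a))" for u
    define G' where "G' u = Df (x + t *\<^sub>R b + u *\<^sub>R (t *\<^sub>R a)) \<bullet> (t *\<^sub>R a) - Df (x + u *\<^sub>R (t *\<^sub>R a)) \<bullet> (t *\<^sub>R a)" for u
    have inS: "x + t *\<^sub>R b + u *\<^sub>R (t *\<^sub>R a) \<in> S" "x + u *\<^sub>R (t *\<^sub>R a) \<in> S" if "u \<in> {0..1}" for u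
    proof -
      have "x + t *\<^sub>R b + u *\<^sub>R (t *\<^sub>R a) = x + (u *\<^sub>R (t *\<^sub>R a) + 1 *\<^sub>R (t *\<^sub>R b))" by simp
      moreover have "x + (u *\<^sub>R (t *\<^sub>R a) + 1 *\<^sub>R (t *\<^sub>R b)) \<in> ball x r"
        unfolding mem_ball dist_norm norm_minus_commute[of x] add_diff_cancel_left'
        using nm[of u 1] that t by auto
      ultimately have "x + t *\<^sub>R b + u *\<^sub>R (t *\<^sub>R a) \<in> ball x r" by (simp only:)
      moreover have "x + u *\<^sub>R (t *\<^sub>R a) \<in> ball x r"
        unfolding mem_ball dist_norm norm_minus_commute[of x] add_diff_cancel_left'
        using nm[of u 0, unfolded scaleR_zero_left add_0_right] that t(3)
        by (meson atLeastAtMost_iff less_trans order_refl zero_le_one)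
      ultimately show "x + t *\<^sub>R b + u *\<^sub>R (t *\<^sub>R a) \<in> S" "x + u *\<^sub>R (t *\<^sub>R a) \<in> S" using r by auto
    qed
    have "(G has_derivative (\<lambda>h. G' u * h)) (at u within {0..1})" if "u \<in> {0..1}" for u
      unfolding G_def G'_def
      using DERIV_diff[OF C2_line(1)[OF C inS(1) that] C2_line(1)[OF C inS(2) that]]
      by (simp add: has_field_derivative_def)
    then obtain u where u: "u \<in> {0..1}" "G 1 - G 0 = G' u"
      using mvt_very_simple[of 0 1 G "\<lambda>u h. G' u * h"] by auto
    let ?h1 = "u *\<^sub>R (t *\<^sub>R a) + 1 *\<^sub>R (t *\<^sub>R b)" and ?h2 = "u *\<^sub>R (t *\<^sub>R a)"
    have u01: "0 \<le> u" "u \<le> 1" using u by auto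
    have est: "norm (Df (x + w) - Df x - D2f x *v w) \<le> ep * B" if "norm w < t * m" "norm w \<le> B" for w B
    proof -
      have "norm (Df (x + w) - Df x - D2f x *v (x + w - x)) \<le> ep * norm (x + w - x)"
        by (rule d(2)) (use that t in simp)
      also have "\<dots> \<le> ep * B" using that ep by simp
      finally show ?thesis by simp
    qed
    have y1: "norm (Df (x + ?h1) - Df x - D2f x *v ?h1) \<le> ep * (t * (norm a + norm b))"
      by (rule est) (use nm[OF u01, of 1] nrm[OF u01, of 1] in auto)
    have y2: "norm (Df (x + ?h2) - Df x - D2f x *v ?h2) \<le> ep * (t * norm a)"
      by (rule est) (use nm[OF u01, of 0, unfolded scaleR_zero_left add_0_right]
          nrm[OF u01, of 0, unfolded scaleR_zero_left add_0_right] in \<open>simp_all only: order_refl zero_le_one mult_zero_right add_0_right simp_thms\<close>)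
    have "G' u - t\<^sup>2 * (a \<bullet> (D2f x *v b))
      = ((Df (x + ?h1) - Df x - D2f x *v ?h1) - (Df (x + ?h2) - Df x - D2f x *v ?h2)) \<bullet> (t *\<^sub>R a)"
      unfolding G'_def
      by (simp add: matrix_vector_right_distrib matrix_vector_mult_scaleR inner_diff_left inner_add_left
          power2_eq_square inner_commute add_ac algebra_simps)
    also have "\<bar>\<dots>\<bar> \<le> norm ((Df (x + ?h1) - Df x - D2f x *v ?h1) - (Df (x + ?h2) - Df x - D2f x *v ?h2)) * norm (t *\<^sub>R a)"
      by (rule Cauchy_Schwarz_ineq2)
    also have "\<dots> \<le> (ep * (t * (norm a + norm b)) + ep * (t * norm a)) * norm (t *\<^sub>R a)"
      by (intro mult_right_mono order_trans[OF norm_triangle_ineq4] add_mono y1 y2) auto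
    also have "\<dots> = ep * (t\<^sup>2 * (norm a * (2 * norm a + norm b)))"
      using t by (simp add: power2_eq_square algebra_simps)
    finally have "\<bar>G 1 - G 0 - t\<^sup>2 * (a \<bullet> (D2f x *v b))\<bar> \<le> ep * (t\<^sup>2 * (norm a * (2 * norm a + norm b)))"
      by (simp add: u)
    then show "\<bar>f (x + t *\<^sub>R (a + b)) - f (x + t *\<^sub>R a) - f (x + t *\<^sub>R b) + f x - t\<^sup>2 * (a \<bullet> (D2f x *v b))\<bar>
     \<le> ep * (t\<^sup>2 * (norm a * (2 * norm a + norm b)))"
      by (simp add: G_def scaleR_add_right add_ac)
  qed
qed

text \<open>\<open>C2_with\<close> does not ask for a symmetric \<open>D2f\<close>. The second
  difference is symmetric in \<open>a\<close> and \<open>b\<close>, while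
  \<open>second_difference\<close> gives it two leading terms, which must therefore agree.\<close>

lemma C2_symmetric_interior:
  fixes f :: "real^'n \<Rightarrow> real"
  assumes C: "C2_with S f Df D2f" and x: "x \<in> interior S"
  shows "transpose (D2f x) = D2f x"
proof -
  have *: "a \<bullet> (D2f x *v b) = b \<bullet> (D2f x *v a)" for a b
  proof (rule ccontr)
    assume ne: "a \<bullet> (D2f x *v b) \<noteq> b \<bullet> (D2f x *v a)"
    define D where "D = \<bar>a \<bullet> (D2f x *v b) - b \<bullet> (D2f x *v a)\<bar>"
    define m where "m = norm a * (2 * norm a + norm b) + norm b * (2 * norm b + norm a) + 1"
    have m: "m > 0" unfolding m_def by (intro add_nonneg_pos add_nonneg_nonneg mult_nonneg_nonneg) auto
    have D: "D > 0" using ne by (simp add: D_def)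
    define ep where "ep = D / m / 2"
    have ep: "ep > 0" using D m by (simp add: ep_def)
    obtain d1 where d1: "d1 > 0" "\<And>t. 0 < t \<Longrightarrow> t < d1 \<Longrightarrow>
      \<bar>f (x + t *\<^sub>R (a + b)) - f (x + t *\<^sub>R a) - f (x + t *\<^sub>R b) + f x - t\<^sup>2 * (a \<bullet> (D2f x *v b))\<bar>
       \<le> ep * (t\<^sup>2 * (norm a * (2 * norm a + norm b)))"
      using second_difference[OF C x ep, of a b] by blast
    obtain d2 where d2: "d2 > 0" "\<And>t. 0 < t \<Longrightarrow> t < d2 \<Longrightarrow>
      \<bar>f (x + t *\<^sub>R (b + a)) - f (x + t *\<^sub>R b) - f (x + t *\<^sub>R a) + f x - t\<^sup>2 * (b \<bullet> (D2f x *v a))\<bar>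
       \<le> ep * (t\<^sup>2 * (norm b * (2 * norm b + norm a)))"
      using second_difference[OF C x ep, of b a] by blast
    define t where "t = min d1 d2 / 2"
    have t: "0 < t" "t < d1" "t < d2" using d1 d2 by (auto simp: t_def)
    have "\<bar>t\<^sup>2 * (a \<bullet> (D2f x *v b)) - t\<^sup>2 * (b \<bullet> (D2f x *v a))\<bar>
      \<le> ep * (t\<^sup>2 * (norm a * (2 * norm a + norm b))) + ep * (t\<^sup>2 * (norm b * (2 * norm b + norm a)))"
      using d1(2)[OF t(1,2)] d2(2)[OF t(1,3)] by (simp add: add.commute[of b a])
    also have "\<dots> \<le> ep * t\<^sup>2 * m"
      using ep t by (simp add: m_def algebra_simps)
    also have "\<dots> = t\<^sup>2 * (D / 2)" using m by (simp add: ep_def)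
    also have "\<bar>t\<^sup>2 * (a \<bullet> (D2f x *v b)) - t\<^sup>2 * (b \<bullet> (D2f x *v a))\<bar> = t\<^sup>2 * D"
      unfolding D_def right_diff_distrib[symmetric] by (simp add: abs_mult)
    finally show False using t D by simp
  qed
  have "D2f x $ i $ j = D2f x $ j $ i" for i j
    using *[of "axis i 1" "axis j 1"] by (simp add: inner_axis' matrix_vector_mult_basis column_def)
  then show ?thesis by (simp add: transpose_def vec_eq_iff)
qed

lemma half_space_interior:
  fixes x :: "real^'n"
  assumes "x $ e > 0"
  shows "x \<in> interior (closed_half_space e)"
proof -
  note assms
  moreover have "open {x :: real^'n. x $ e > 0}"
    by (rule open_Collect_less) (intro continuous_intros)+
  moreover have "{x :: real^'n. x $ e > 0} \<subseteq> closed_half_space e" by (auto simp: closed_half_space_def)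
  ultimately show ?thesis by (meson interiorI mem_Collect_eq)
qed

text \<open>Boundary points are limits of interior points, and \<open>D2f\<close> is
  continuous.\<close>

lemma C2_symmetric_half_space:
  assumes C: "C2_with (closed_half_space e) f Df D2f" and x: "x \<in> closed_half_space e"
  shows "transpose (D2f x) = D2f x"
proof -
  define y where "y n = x + inverse (real (Suc n)) *\<^sub>R axis e 1" for n
  have yn: "y n $ e > 0" for n using x by (simp add: y_def closed_half_space_def add_nonneg_pos)
  have yl: "y \<longlonglongrightarrow> x"
    unfolding y_def by (rule tendsto_eq_intros LIMSEQ_inverse_real_of_nat refl | simp)+
  have "(\<lambda>n. D2f (y n)) \<longlonglongrightarrow> D2f x"
    using C yl x yn unfolding C2_with_def continuous_on_sequentially comp_def
    by (auto simp: closed_half_space_def less_imp_le)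
  then have l: "(\<lambda>n. D2f (y n) $ i $ j) \<longlonglongrightarrow> D2f x $ i $ j" for i j
    by (intro tendsto_intros)
  have "D2f (y n) $ i $ j = D2f (y n) $ j $ i" for n i j
    using C2_symmetric_interior[OF C half_space_interior[OF yn]] by (simp add: transpose_def vec_eq_iff)
  then have "D2f x $ i $ j = D2f x $ j $ i" for i j
    using l[of i j] l[of j i] LIMSEQ_unique by fastforce
  then show ?thesis by (simp add: transpose_def vec_eq_iff)
qed

section \<open>Hopf lemma\<close>

text \<open>The Schouten tensor of \<open>v^-2 |dx|^2\<close>, that is, with \<open>v = u^(-2/(n-2))\<close>; the mean curvature is then
  the normal derivative of \<open>v\<close>.\<close>

definition schouten_v :: "real \<Rightarrow> real^'n \<Rightarrow> real^'n^'n \<Rightarrow> real^'n^'n" where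
  "schouten_v v g H = v *\<^sub>R H - ((norm g)\<^sup>2 / 2) *\<^sub>R mat 1"

lemma schouten_v_quad: "x \<bullet> (schouten_v v g H *v x) = v * (x \<bullet> (H *v x)) - (norm g)\<^sup>2 / 2 * (norm x)\<^sup>2"
  by (simp add: schouten_v_def matrix_vector_mult_diff_rdistrib inner_diff_right power2_norm_eq_inner
      flip: scaleR_matrix_vector_assoc)

text \<open>Stated relative to a set, because an inverted solution lives on the closed half-space
  without the centre of inversion.\<close>

definition solution_on :: "'n \<Rightarrow> nat \<Rightarrow> real \<Rightarrow> (real^'n) set \<Rightarrow> (real^'n \<Rightarrow> real) \<Rightarrow> (real^'n \<Rightarrow> real^'n)
    \<Rightarrow> (real^'n \<Rightarrow> real^'n^'n) \<Rightarrow> bool" where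
  "solution_on e k c0 S v Dv D2v \<longleftrightarrow> C2_with S v Dv D2v \<and>
    (\<forall>y\<in>S. v y > 0 \<and> garding_cone k (schouten_v (v y) (Dv y) (D2v y)) \<and>
       sigma k (schouten_v (v y) (Dv y) (D2v y)) = 2 ^ k * real (CARD('n) choose k) \<and>
       (y $ e = 0 \<longrightarrow> boundary_op e k (Dv y $ e) (schouten_v (v y) (Dv y) (D2v y)) = c0))"

lemma C2_with_subset: "C2_with S f Df D2f \<Longrightarrow> T \<subseteq> S \<Longrightarrow> C2_with T f Df D2f"
  unfolding C2_with_def by (meson continuous_on_subset has_derivative_subset subsetD)

lemma solution_on_subset: "solution_on e k c0 S v Dv D2v \<Longrightarrow> T \<subseteq> S \<Longrightarrow> solution_on e k c0 T v Dv D2v"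
  unfolding solution_on_def by (meson C2_with_subset subsetD)

lemma C2_with_diff:
  assumes "C2_with S f Df D2f" "C2_with S g Dg D2g"
  shows "C2_with S (\<lambda>x. f x - c * g x) (\<lambda>x. Df x - c *\<^sub>R Dg x) (\<lambda>x. D2f x - c *\<^sub>R D2g x)"
  using assms unfolding C2_with_def
  by (auto intro!: derivative_eq_intros continuous_intros
      simp: inner_diff_left matrix_vector_mult_diff_rdistrib simp flip: scaleR_matrix_vector_assoc)

lemma C2_with_continuous:
  assumes "C2_with S f Df D2f"
  shows "continuous_on S f" "continuous_on S Df" "continuous_on S D2f"
  using assms unfolding C2_with_def by (auto intro: has_derivative_continuous_on)

section \<open>Tangential projection and barrier estimates\<close>

definition tproj :: "'n \<Rightarrow> real^'n \<Rightarrow> real^'n" where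
  "tproj e x = (\<chi> i. if i = e then 0 else x $ i)"

lemma tang_quad: "x \<bullet> (tang e A *v x) = tproj e x \<bullet> (A *v tproj e x)"
  by (auto simp: inner_vec_def matrix_vector_mult_def tang_def tproj_def sum_distrib_left intro!: sum.cong)

lemma norm_tproj_sq: "(norm (tproj e x))\<^sup>2 = (norm x)\<^sup>2 - (x $ e)\<^sup>2"
proof -
  have "tproj e x \<bullet> tproj e x = (\<Sum>i\<in>UNIV. x $ i * x $ i - (if i = e then (x $ e)\<^sup>2 else 0))"
    by (auto simp: inner_vec_def tproj_def power2_eq_square intro!: sum.cong)
  also have "\<dots> = x \<bullet> x - (x $ e)\<^sup>2" by (simp add: sum_subtractf inner_vec_def)
  finally show ?thesis by (simp add: power2_norm_eq_inner)
qed

lemma tproj_nth: "tproj e x $ e = 0" by (simp add: tproj_def)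

lemma inner_tproj: "x $ e = 0 \<Longrightarrow> x \<bullet> tproj e y = x \<bullet> y"
  by (auto simp: inner_vec_def tproj_def intro!: sum.cong)

lemma tproj_diff_scaleR: "tproj e (x - c *\<^sub>R y) = tproj e x - c *\<^sub>R tproj e y"
  by (auto simp: tproj_def vec_eq_iff)

lemma norm_tproj_le: "norm (tproj e x) \<le> norm x"
  using norm_tproj_sq[of e x] by (metis diff_le_self norm_ge_zero power2_le_imp_le zero_le_power2 diff_ge_0_iff_ge le_add_diff_inverse2 le_add_same_cancel1)

lemma quad_bound:
  fixes M :: "'a::metric_space \<Rightarrow> real^'n^'n"
  assumes "compact D" "continuous_on D M"
  shows "\<exists>C\<ge>0. \<forall>y\<in>D. \<forall>x. \<bar>x \<bullet> (M y *v x)\<bar> \<le> C * (norm x)\<^sup>2"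
proof -
  have "continuous_on (D \<times> sphere 0 1) (\<lambda>z. snd z \<bullet> (M (fst z) *v snd z))"
    unfolding matrix_vector_mult_def
    by (intro continuous_intros continuous_on_compose2[OF assms(2)]) auto
  moreover have "compact (D \<times> sphere (0::real^'n) 1)" using assms by (intro compact_Times) auto
  ultimately have "bounded ((\<lambda>z. snd z \<bullet> (M (fst z) *v snd z)) ` (D \<times> sphere 0 1))"
    by (intro compact_imp_bounded compact_continuous_image)
  then obtain C where C: "C > 0" "\<And>y x. y \<in> D \<Longrightarrow> norm x = 1 \<Longrightarrow> \<bar>x \<bullet> (M y *v x)\<bar> \<le> C"
    unfolding bounded_pos by force
  have "\<bar>x \<bullet> (M y *v x)\<bar> \<le> C * (norm x)\<^sup>2" if "y \<in> D" for y x
  proof (cases "x = 0")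
    case False
    then have "\<bar>(x /\<^sub>R norm x) \<bullet> (M y *v (x /\<^sub>R norm x))\<bar> \<le> C" by (intro C that) simp
    then show ?thesis using False
      by (simp add: matrix_vector_mult_scaleR abs_mult power2_eq_square field_simps)
  qed simp
  then show ?thesis using C by (intro exI[of _ C]) auto
qed

text \<open>The barrier of Hopf's lemma; the factor \<open>1 + y $ e\<close> makes its normal derivative
  strictly positive on the boundary hyperplane when \<open>p\<close> lies there.\<close>

definition barrier :: "'n \<Rightarrow> real^'n \<Rightarrow> real \<Rightarrow> real \<Rightarrow> real^'n \<Rightarrow> real" where
  "barrier e p R a y = (exp (- a * (norm (y - p))\<^sup>2) - exp (- a * R\<^sup>2)) * (1 + y $ e)"

definition Dbarrier :: "'n \<Rightarrow> real^'n \<Rightarrow> real \<Rightarrow> real \<Rightarrow> real^'n \<Rightarrow> real^'n" where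
  "Dbarrier e p R a y = (- 2 * a * exp (- a * (norm (y - p))\<^sup>2) * (1 + y $ e)) *\<^sub>R (y - p)
     + (exp (- a * (norm (y - p))\<^sup>2) - exp (- a * R\<^sup>2)) *\<^sub>R axis e 1"

text \<open>The combination of three outer products is, by polarization, the symmetrized product of
  \<open>y - p\<close> and \<open>axis e 1\<close>.\<close>

definition D2barrier :: "'n \<Rightarrow> real^'n \<Rightarrow> real \<Rightarrow> real \<Rightarrow> real^'n \<Rightarrow> real^'n^'n" where
  "D2barrier e p R a y = exp (- a * (norm (y - p))\<^sup>2) *\<^sub>R
     ((4 * a\<^sup>2 * (1 + y $ e)) *\<^sub>R outer (y - p) - (2 * a * (1 + y $ e)) *\<^sub>R mat 1
      - (2 * a) *\<^sub>R (outer (y - p + axis e 1) - outer (y - p) - outer (axis e 1)))"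

lemma D2barrier_mult: "D2barrier e p R a y *v h = exp (- a * (norm (y - p))\<^sup>2) *\<^sub>R
   ((4 * a\<^sup>2 * (1 + y $ e) * ((y - p) \<bullet> h)) *\<^sub>R (y - p) - (2 * a * (1 + y $ e)) *\<^sub>R h
     - (2 * a * h $ e) *\<^sub>R (y - p) - (2 * a * ((y - p) \<bullet> h)) *\<^sub>R axis e 1)"
  unfolding D2barrier_def
  by (simp add: matrix_vector_mult_diff_rdistrib outer_mult_vec inner_add_left inner_axis'
      algebra_simps flip: scaleR_matrix_vector_assoc)

lemma D2barrier_quad: "x \<bullet> (D2barrier e p R a y *v x) = exp (- a * (norm (y - p))\<^sup>2) *
   (4 * a\<^sup>2 * (1 + y $ e) * ((y - p) \<bullet> x)\<^sup>2 - 2 * a * (1 + y $ e) * (norm x)\<^sup>2 - 4 * a * ((y - p) \<bullet> x) * x $ e)"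
  unfolding D2barrier_mult power2_norm_eq_inner[of x]
  by (simp add: inner_diff_right inner_axis power2_eq_square inner_commute algebra_simps)

lemma C2_barrier: "C2_with (S :: (real^'n) set) (barrier e p R a) (Dbarrier e p R a) (D2barrier e p R a)"
proof -
  have dn: "((\<lambda>y. (norm (y - p))\<^sup>2) has_derivative (\<lambda>h. 2 * ((y - p) \<bullet> h))) (at y within S)" for y
    unfolding power2_norm_eq_inner by (auto intro!: derivative_eq_intros simp: inner_commute)
  have dE: "((\<lambda>y. exp (- a * (norm (y - p))\<^sup>2)) has_derivative (\<lambda>h. exp (- a * (norm (y - p))\<^sup>2) * (- a * (2 * ((y - p) \<bullet> h))))) (at y within S)" for y
    by (rule has_derivative_eq_rhs, rule has_derivative_exp, rule has_derivative_mult_right, rule dn)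
       (simp add: fun_eq_iff)
  have de: "((\<lambda>y. y $ e) has_derivative (\<lambda>h. h $ e)) (at y within S)" for y :: "real^'n"
    by (rule bounded_linear.has_derivative[OF bounded_linear_vec_nth]) (rule has_derivative_ident)
  have 1: "(barrier e p R a has_derivative (\<lambda>h. Dbarrier e p R a y \<bullet> h)) (at y within S)" for y
    unfolding barrier_def
    by (rule derivative_eq_intros dE de refl)+
       (simp add: Dbarrier_def inner_add_left inner_axis' algebra_simps fun_eq_iff)
  have 2: "(Dbarrier e p R a has_derivative (\<lambda>h. D2barrier e p R a y *v h)) (at y within S)" for y
    unfolding Dbarrier_def D2barrier_mult
    by (rule derivative_eq_intros dE de refl)+
       (simp add: algebra_simps fun_eq_iff power2_eq_square)
  have 3: "continuous_on S (D2barrier e p R a)"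
    unfolding D2barrier_def by (intro continuous_intros)
  show ?thesis unfolding C2_with_def using 1 2 3 by blast
qed

text \<open>Here \<open>q1\<close>, \<open>q2\<close>, \<open>qb\<close> are Hessian forms at one
  vector of squared norm \<open>X\<close>, \<open>r\<close> is its product with
  \<open>y - p\<close>, and \<open>m\<close> bounds \<open>v2\<close> from below. The term of order
  \<open>a^2\<close> in \<open>qb\<close> is kept. All other terms are at most of order
  \<open>a\<close>, because the changes \<open>s\<close> and \<open>ep * gb\<close> of value and
  gradient carry the same factor \<open>ep * E\<close>.\<close>

lemma barrier_quad_le:
  fixes g1 g2 gb :: "real^'n"
  assumes q: "q2 \<le> q1 - ep * qb" and v: "v2 = v1 - s" "0 \<le> s" "m \<le> v2" "0 \<le> m" "v1 \<le> C"
    and g: "norm g1 \<le> C" and q1: "\<bar>q1\<bar> \<le> C * X" and X: "0 \<le> X"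
    and ep: "0 < ep" and E: "0 \<le> E" and s: "s \<le> ep * E * C0" and C0: "1 + ye \<le> C0" "0 \<le> ye"
    and a: "1 \<le> a" and r: "r\<^sup>2 \<le> R\<^sup>2 * X" "0 \<le> R" "xe\<^sup>2 \<le> X"
    and qb: "qb = E * (4 * a\<^sup>2 * (1 + ye) * r\<^sup>2 - 2 * a * (1 + ye) * X - 4 * a * r * xe)"
    and gb: "norm gb \<le> E * (2 * a * R * C0 + 1)"
    and g2: "g2 = g1 - ep *\<^sub>R gb"
  shows "v2 * q2 - (norm g2)\<^sup>2 / 2 * X + 4 * ep * a\<^sup>2 * E * m * r\<^sup>2
    \<le> v1 * q1 - (norm g1)\<^sup>2 / 2 * X + ep * E * a * (C * (C0 + (2 * C0 + 4 * R) + (2 * R * C0 + 1))) * X"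
proof -
  have v2: "0 \<le> v2" "v2 \<le> C" using v by auto
  have C: "0 \<le> C" using g norm_ge_zero order_trans by blast
  have C0': "1 \<le> C0" using C0 by simp
  have "v2 * q2 \<le> v2 * (q1 - ep * qb)" using q v2 by (intro mult_left_mono) auto
  also have "\<dots> = v1 * q1 - s * q1 - ep * (v2 * qb)" by (simp add: v algebra_simps)
  finally have 1: "v2 * q2 \<le> v1 * q1 - s * q1 - ep * (v2 * qb)" .
  have "- (s * q1) \<le> s * \<bar>q1\<bar>" using v by (metis abs_ge_minus_self minus_mult_right mult_left_mono)
  also have "\<dots> \<le> (ep * E * C0) * (C * X)" by (intro mult_mono s q1) (use v ep E C0' in auto)
  finally have 2: "- (s * q1) \<le> ep * E * C0 * (C * X)" .
  have rx: "\<bar>r * xe\<bar> \<le> R * X"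
  proof (rule power2_le_imp_le)
    have "(r * xe)\<^sup>2 \<le> R\<^sup>2 * X * X" unfolding power_mult_distrib by (intro mult_mono r) (use X in auto)
    then show "\<bar>r * xe\<bar>\<^sup>2 \<le> (R * X)\<^sup>2" by (simp add: power_mult_distrib power2_eq_square mult_ac)
  qed (use r X in simp)
  have 3: "- (v2 * qb) \<le> E * (- (4 * a\<^sup>2 * m * r\<^sup>2) + C * a * (2 * C0 + 4 * R) * X)"
  proof -
    have "- (v2 * qb) = E * (- (4 * a\<^sup>2 * r\<^sup>2) * (v2 * (1 + ye)) + v2 * (2 * a * (1 + ye) * X + 4 * a * (r * xe)))"
      unfolding qb by (simp add: algebra_simps)
    also have "\<dots> \<le> E * (- (4 * a\<^sup>2 * r\<^sup>2) * m + C * (2 * a * C0 * X + 4 * a * (R * X)))"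
    proof (intro mult_left_mono[OF _ E] add_mono)
      have "m * 1 \<le> v2 * (1 + ye)" using v C0 by (intro mult_mono) auto
      then show "- (4 * a\<^sup>2 * r\<^sup>2) * (v2 * (1 + ye)) \<le> - (4 * a\<^sup>2 * r\<^sup>2) * m"
        by (intro mult_left_mono_neg) auto
      have "2 * a * (1 + ye) * X + 4 * a * (r * xe) \<le> 2 * a * C0 * X + 4 * a * (R * X)"
        using C0 a X rx by (intro add_mono mult_right_mono mult_left_mono) auto
      moreover have "0 \<le> 2 * a * C0 * X + 4 * a * (R * X)" using a C0' X r by (intro add_nonneg_nonneg mult_nonneg_nonneg) auto
      ultimately show "v2 * (2 * a * (1 + ye) * X + 4 * a * (r * xe)) \<le> C * (2 * a * C0 * X + 4 * a * (R * X))"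
        using v2 C by (meson mult_left_mono mult_right_mono order_trans)
    qed
    finally show ?thesis by (simp add: algebra_simps)
  qed
  have 4: "- ((norm g2)\<^sup>2 / 2 * X) \<le> - ((norm g1)\<^sup>2 / 2 * X) + ep * (E * (C * (2 * a * R * C0 + 1))) * X"
  proof -
    have "(norm g2)\<^sup>2 = (norm g1)\<^sup>2 - 2 * ep * (g1 \<bullet> gb) + ep\<^sup>2 * (norm gb)\<^sup>2"
      unfolding g2 power2_norm_eq_inner by (simp add: inner_diff_left inner_diff_right inner_commute power2_eq_square algebra_simps)
    then have "- (norm g2)\<^sup>2 \<le> - (norm g1)\<^sup>2 + 2 * ep * (g1 \<bullet> gb)" by simp
    also have "g1 \<bullet> gb \<le> norm g1 * norm gb" by (rule norm_cauchy_schwarz)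
    also have "\<dots> \<le> C * (E * (2 * a * R * C0 + 1))" by (intro mult_mono g gb C) auto
    finally have "- (norm g2)\<^sup>2 \<le> - (norm g1)\<^sup>2 + 2 * ep * (C * (E * (2 * a * R * C0 + 1)))" using ep by simp
    then have "- (norm g2)\<^sup>2 / 2 * X \<le> (- (norm g1)\<^sup>2 + 2 * ep * (C * (E * (2 * a * R * C0 + 1)))) / 2 * X"
      using X by (intro mult_right_mono divide_right_mono) auto
    then show ?thesis by (simp add: algebra_simps)
  qed
  have 5: "ep * (- (v2 * qb)) \<le> ep * (E * (- (4 * a\<^sup>2 * m * r\<^sup>2) + C * a * (2 * C0 + 4 * R) * X))"
    using 3 ep by (intro mult_left_mono) auto
  have 6: "ep * E * C0 * (C * X) + ep * (E * (C * a * (2 * C0 + 4 * R) * X)) + ep * (E * (C * (2 * a * R * C0 + 1))) * X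
     \<le> ep * E * a * (C * (C0 + (2 * C0 + 4 * R) + (2 * R * C0 + 1))) * X"
  proof -
    have "C0 + a * (2 * C0 + 4 * R) + (2 * a * R * C0 + 1) \<le> a * (C0 + (2 * C0 + 4 * R) + (2 * R * C0 + 1))"
      using a C0' mult_right_mono[of 1 a "C0 + 1"] by (simp add: algebra_simps)
    then have "(ep * E * C * X) * (C0 + a * (2 * C0 + 4 * R) + (2 * a * R * C0 + 1))
       \<le> (ep * E * C * X) * (a * (C0 + (2 * C0 + 4 * R) + (2 * R * C0 + 1)))"
      by (intro mult_left_mono) (use ep E C X in auto)
    then show ?thesis by (simp add: algebra_simps)
  qed
  show ?thesis using 1 2 4 5 6 by (simp add: algebra_simps)
qed

text \<open>On the half annulus \<open>D\<close> the difference stays above \<open>ep\<close> times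
  the barrier. A negative minimum off the hyperplane contradicts the equality of
  \<open>sigma k\<close>; one on the hyperplane contradicts the equality of the boundary operators.
  The ball is either centred on the hyperplane, which covers the corners, or does not cross it; in
  the second case no point of the open annulus lies on the hyperplane.\<close>

lemma hopf_lemma:
  fixes p y0 :: "real^'n"
  assumes k: "1 \<le> k" "k \<le> CARD('n)" and c0: "c0 > 0"
    and s1: "solution_on e k c0 S v1 Dv1 D2v1" and s2: "solution_on e k c0 S v2 Dv2 D2v2"
    and R: "R > 0" and sub: "cball p R \<inter> closed_half_space e \<subseteq> S"
    and p: "p $ e = 0 \<or> p $ e \<ge> R"
    and ge: "\<And>y. y \<in> cball p R \<Longrightarrow> y \<in> closed_half_space e \<Longrightarrow> v2 y \<le> v1 y"
    and gt: "\<And>y. norm (y - p) = R / 2 \<Longrightarrow> y \<in> closed_half_space e \<Longrightarrow> v2 y < v1 y"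
    and y0: "y0 \<in> closed_half_space e" "norm (y0 - p) = R" "v1 y0 = v2 y0"
  shows "(Dv1 y0 - Dv2 y0) \<bullet> (p - y0) > 0"
proof -
  let ?H = "closed_half_space e"
  let ?A1 = "\<lambda>y. schouten_v (v1 y) (Dv1 y) (D2v1 y)" and ?A2 = "\<lambda>y. schouten_v (v2 y) (Dv2 y) (D2v2 y)"
  define D where "D = {y \<in> ?H. R / 2 \<le> norm (y - p) \<and> norm (y - p) \<le> R}"
  have clH: "closed ?H" unfolding closed_half_space_def by (intro closed_Collect_le continuous_intros)
  have D_eq: "D = ?H \<inter> cball p R \<inter> {y. R / 2 \<le> norm (y - p)}"
    by (auto simp: D_def dist_norm norm_minus_commute)
  have cD: "compact D" unfolding D_eq
    by (intro compact_Int_closed closed_Int_compact clH compact_cball closed_Collect_le continuous_intros)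
  have DS: "D \<subseteq> S" using sub D_eq by auto
  have y0D: "y0 \<in> D" using y0 R by (simp add: D_def)
  have pH: "p $ e \<ge> 0" using p R by auto
  have C1: "C2_with S v1 Dv1 D2v1" and C2: "C2_with S v2 Dv2 D2v2"
    using s1 s2 by (auto simp: solution_on_def)
  note cont1 = C2_with_continuous[OF C2_with_subset[OF C1 DS]]
  note cont2 = C2_with_continuous[OF C2_with_subset[OF C2 DS]]
  obtain ym where ym: "ym \<in> D" "\<And>y. y \<in> D \<Longrightarrow> v1 ym \<le> v1 y"
    using continuous_attains_inf[OF cD _ cont1(1)] y0D by blast
  define m0 where "m0 = v1 ym"
  have m0: "m0 > 0" "\<And>y. y \<in> D \<Longrightarrow> m0 \<le> v1 y" using s1 ym DS by (auto simp: m0_def solution_on_def)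
  obtain B1 where B1: "\<And>y. y \<in> D \<Longrightarrow> \<bar>v1 y\<bar> \<le> B1"
    using compact_imp_bounded[OF compact_continuous_image[OF cont1(1) cD]] unfolding bounded_iff by auto
  obtain B2 where B2: "\<And>y. y \<in> D \<Longrightarrow> norm (Dv1 y) \<le> B2"
    using compact_imp_bounded[OF compact_continuous_image[OF cont1(2) cD]] unfolding bounded_iff by auto
  obtain B3 where B3: "B3 \<ge> 0" "\<And>y x. y \<in> D \<Longrightarrow> \<bar>x \<bullet> (D2v1 y *v x)\<bar> \<le> B3 * (norm x)\<^sup>2"
    using quad_bound[OF cD cont1(3)] by blast
  define C where "C = \<bar>B1\<bar> + \<bar>B2\<bar> + B3"
  have C: "C \<ge> 0" "\<And>y. y \<in> D \<Longrightarrow> v1 y \<le> C" "\<And>y. y \<in> D \<Longrightarrow> norm (Dv1 y) \<le> C"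
    "\<And>y x. y \<in> D \<Longrightarrow> \<bar>x \<bullet> (D2v1 y *v x)\<bar> \<le> C * (norm x)\<^sup>2"
  proof -
    show "C \<ge> 0" using B3 by (simp add: C_def)
    show "v1 y \<le> C" if "y \<in> D" for y using B1[OF that] B3(1) by (simp add: C_def)
    show "norm (Dv1 y) \<le> C" if "y \<in> D" for y using B2[OF that] B3(1) by (simp add: C_def)
    show "\<bar>x \<bullet> (D2v1 y *v x)\<bar> \<le> C * (norm x)\<^sup>2" if "y \<in> D" for y x
    proof -
      have "B3 * (norm x)\<^sup>2 \<le> C * (norm x)\<^sup>2" by (intro mult_right_mono) (auto simp: C_def)
      then show ?thesis using B3(2)[OF that, of x] by simp
    qed
  qed
  define C0 where "C0 = 1 + \<bar>p $ e\<bar> + R"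
  have C0: "C0 \<ge> 1" "0 \<le> y $ e" "1 + y $ e \<le> C0" if "y \<in> D" for y
    using that R component_le_norm_cart[of "y - p" e] by (auto simp: C0_def D_def closed_half_space_def)
  define C' where "C' = C * (C0 + (2 * C0 + 4 * R) + (2 * R * C0 + 1)) + 1"
  have C0p: "C0 \<ge> 1" using C0 y0D by blast
  have C': "C' > 0" unfolding C'_def using C C0p R by (intro add_nonneg_pos mult_nonneg_nonneg add_nonneg_nonneg) auto
  have cA1: "continuous_on D ?A1" unfolding schouten_v_def by (intro continuous_intros cont1) auto
  have GA1: "garding_cone k (?A1 y)" if "y \<in> D" for y using s1 that DS by (auto simp: solution_on_def)
  obtain L1 where L1: "L1 > 0" "\<And>y M c N x. y \<in> D \<Longrightarrow> garding_cone k M \<Longrightarrow> 0 < c \<Longrightarrow> c \<le> 1 \<Longrightarrow> 0 \<le> N \<Longrightarrow>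
     L1 * c \<le> N * (norm x)\<^sup>2 \<Longrightarrow> quad_le (M + N *\<^sub>R outer x) (?A1 y + c *\<^sub>R mat 1) \<Longrightarrow> sigma k M < sigma k (?A1 y)"
  proof (rule elliptic_compact[of "?A1 ` D" k])
    show "compact (?A1 ` D)" by (rule compact_continuous_image[OF cA1 cD])
    show "garding_cone k A" if "A \<in> ?A1 ` D" for A using that GA1 by auto
    fix L assume "L > 0" and "\<And>A M c N x j. A \<in> ?A1 ` D \<Longrightarrow> garding_cone k M \<Longrightarrow> 0 < c \<Longrightarrow> c \<le> 1 \<Longrightarrow> 0 \<le> N \<Longrightarrow>
     L * c \<le> N * (norm x)\<^sup>2 \<Longrightarrow> quad_le (M + N *\<^sub>R outer x) (A + c *\<^sub>R mat 1) \<Longrightarrow> 1 \<le> j \<Longrightarrow> j \<le> k \<Longrightarrow>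
     sigma j M < sigma j A"
    then show thesis using k(1) by (intro that[of L]) auto
  qed
  \<comment> \<open>Bounds the shift \<open>(h1^2 - h2^2) / 2\<close> that arises at boundary
    minima, so the shifted tangential blocks also range over a compact set.\<close>
  define T where "T = C\<^sup>2 / 2"
  define tA where "tA = (\<lambda>z::(real^'n) \<times> real. tang e (?A1 (fst z) + snd z *\<^sub>R mat 1))"
  have GtA: "garding_cone (k - 1) (tA (y, t))" if "y \<in> D" "0 \<le> t" for y t
    unfolding tA_def fst_conv snd_conv
    by (rule garding_cone_tang) (use that k garding_cone_plus_mat1[OF GA1[OF that(1)] that(2)] in simp)
  obtain L2 where L2: "L2 > 0" "\<And>y t M c N x j. y \<in> D \<Longrightarrow> 0 \<le> t \<Longrightarrow> t \<le> T \<Longrightarrow> garding_cone (k - 1) M \<Longrightarrow> 0 < c \<Longrightarrow> c \<le> 1 \<Longrightarrow> 0 \<le> N \<Longrightarrow>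
     L2 * c \<le> N * (norm x)\<^sup>2 \<Longrightarrow> quad_le (M + N *\<^sub>R outer x) (tA (y, t) + c *\<^sub>R mat 1) \<Longrightarrow> 1 \<le> j \<Longrightarrow> j < k \<Longrightarrow> sigma j M < sigma j (tA (y, t))"
  proof (rule elliptic_compact[of "tA ` (D \<times> {0..T})" "k - 1"])
    have "continuous_on (D \<times> {0..T}) (\<lambda>z. ?A1 (fst z) + snd z *\<^sub>R mat 1)"
      by (intro continuous_intros continuous_on_compose2[OF cA1]) auto
    then have ent: "continuous_on (D \<times> {0..T}) (\<lambda>z. (?A1 (fst z) + snd z *\<^sub>R mat 1) $ i $ j)" for i j
      by (intro continuous_on_component)
    have "continuous_on (D \<times> {0..T}) (\<lambda>z. if i = e \<or> j = e then 0 else (?A1 (fst z) + snd z *\<^sub>R mat 1) $ i $ j)" for i j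
      by (cases "i = e \<or> j = e") (simp_all only: if_True if_False continuous_on_const ent)
    then have "continuous_on (D \<times> {0..T}) tA"
      unfolding tA_def tang_def by (intro continuous_on_vec_lambda)
    then show "compact (tA ` (D \<times> {0..T}))"
      by (intro compact_continuous_image compact_Times cD) auto
    show "garding_cone (k - 1) A" if "A \<in> tA ` (D \<times> {0..T})" for A using that GtA by auto
    fix L assume "L > 0" and "\<And>A M c N x j. A \<in> tA ` (D \<times> {0..T}) \<Longrightarrow> garding_cone (k - 1) M \<Longrightarrow> 0 < c \<Longrightarrow> c \<le> 1 \<Longrightarrow> 0 \<le> N \<Longrightarrow>
     L * c \<le> N * (norm x)\<^sup>2 \<Longrightarrow> quad_le (M + N *\<^sub>R outer x) (A + c *\<^sub>R mat 1) \<Longrightarrow> 1 \<le> j \<Longrightarrow> j \<le> k - 1 \<Longrightarrow>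
     sigma j M < sigma j A"
    then show thesis by (intro that[of L]) auto
  qed
  define L where "L = max L1 L2"
  \<comment> \<open>Chosen so that, at distance at least \<open>R / 2\<close> from \<open>p\<close>,
    the rank-one gain of order \<open>a^2\<close> exceeds \<open>L\<close> times the error of order
    \<open>a\<close>.\<close>
  define a where "a = max 1 (2 * L * C' / (m0 * R\<^sup>2))"
  have a: "a \<ge> 1" "2 * L * C' \<le> a * (m0 * R\<^sup>2)"
    using m0 R by (auto simp: a_def pos_divide_le_eq[symmetric] simp del: pos_divide_le_eq)
  define E where "E y = exp (- a * (norm (y - p))\<^sup>2)" for y
  define ER where "ER = exp (- a * R\<^sup>2)"
  have E01: "0 < E y" "E y \<le> 1" for y using a by (auto simp: E_def)
  have barrier_le: "barrier e p R a y \<le> E y * (1 + y $ e)" if "y \<in> D" for y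
    using C0(2)[OF that] by (auto simp: barrier_def E_def intro!: mult_right_mono)
  have barrier_le2: "barrier e p R a y \<le> E y * C0" if "y \<in> D" for y
    using barrier_le[OF that] mult_left_mono[OF C0(3)[OF that] less_imp_le[OF E01(1)[of y]]] by linarith
  have barrier_le3: "barrier e p R a y \<le> C0" if "y \<in> D" for y
  proof -
    have "E y * C0 \<le> 1 * C0" using E01[of y] C0p by (intro mult_right_mono) auto
    then show ?thesis using barrier_le2[OF that] by simp
  qed
  obtain w0 where w0: "w0 > 0" "\<And>y. y \<in> D \<Longrightarrow> norm (y - p) = R / 2 \<Longrightarrow> w0 \<le> v1 y - v2 y"
  proof (cases "{y \<in> D. norm (y - p) = R / 2} = {}")
    case True
    then show ?thesis using that[of 1] by auto
  next
    case False
    have "compact (D \<inter> {y. norm (y - p) = R / 2})"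
      by (intro compact_Int_closed cD closed_Collect_eq continuous_intros)
    moreover have "D \<inter> {y. norm (y - p) = R / 2} \<noteq> {}" using False by auto
    moreover have "continuous_on (D \<inter> {y. norm (y - p) = R / 2}) (\<lambda>y. v1 y - v2 y)"
      by (intro continuous_intros continuous_on_subset[OF cont1(1)] continuous_on_subset[OF cont2(1)]) auto
    ultimately obtain z where "z \<in> D \<inter> {y. norm (y - p) = R / 2}"
      "\<forall>y\<in>D \<inter> {y. norm (y - p) = R / 2}. v1 z - v2 z \<le> v1 y - v2 y"
      using continuous_attains_inf by blast
    then show ?thesis using gt[of z] by (intro that[of "v1 z - v2 z"]) (auto simp: D_def)
  qed
  \<comment> \<open>The three bounds keep \<open>v2 >= m0 / 2\<close> at a negative minimum, exclude
    a minimum on the inner sphere, and give \<open>c <= 1\<close> as \<open>elliptic_compact\<close>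
    requires.\<close>
  define ep where "ep = min (m0 / (2 * C0)) (min (w0 / C0) (1 / (a * C')))"
  have aC': "a * C' > 0" using a C' by simp
  have ep: "ep > 0" using m0 C0p w0 aC' by (simp add: ep_def)
  have ep1: "ep * C0 \<le> m0 / 2"
  proof -
    have "ep * C0 \<le> m0 / (2 * C0) * C0" using C0p by (intro mult_right_mono) (auto simp: ep_def)
    then show ?thesis using C0p by simp
  qed
  have ep2: "ep * C0 \<le> w0"
  proof -
    have "ep * C0 \<le> w0 / C0 * C0" using C0p by (intro mult_right_mono) (auto simp: ep_def)
    then show ?thesis using C0p by simp
  qed
  have ep3: "ep * (a * C') \<le> 1"
  proof -
    have "ep * (a * C') \<le> 1 / (a * C') * (a * C')" using aC' by (intro mult_right_mono) (auto simp: ep_def)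
    then show ?thesis using aC' by (simp split: if_splits)
  qed
  define ph where "ph y = v1 y - 1 * v2 y - ep * barrier e p R a y" for y
  define Dph where "Dph y = Dv1 y - 1 *\<^sub>R Dv2 y - ep *\<^sub>R Dbarrier e p R a y" for y
  define D2ph where "D2ph y = D2v1 y - 1 *\<^sub>R D2v2 y - ep *\<^sub>R D2barrier e p R a y" for y
  have Cph: "C2_with D ph Dph D2ph"
    unfolding ph_def Dph_def D2ph_def
    by (intro C2_with_diff C2_barrier C2_with_subset[OF C1 DS] C2_with_subset[OF C2 DS])
  have ph0: "ph y \<ge> 0" if "y \<in> D" for y
  proof (rule ccontr)
    assume "\<not> ph y \<ge> 0"
    obtain z where z: "z \<in> D" "\<And>y. y \<in> D \<Longrightarrow> ph z \<le> ph y"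
      using continuous_attains_inf[OF cD _ C2_with_continuous(1)[OF Cph]] y0D by blast
    then have zneg: "ph z < 0" using \<open>\<not> ph y \<ge> 0\<close> that by force
    have zH: "z \<in> ?H" using z by (simp add: D_def)
    have w: "v2 z \<le> v1 z" by (rule ge) (use z in \<open>auto simp: D_eq\<close>)
    have zo: "norm (z - p) < R"
    proof (rule ccontr)
      assume "\<not> ?thesis"
      then have "norm (z - p) = R" using z by (simp add: D_def)
      then have "barrier e p R a z = 0" by (simp add: barrier_def)
      then show False using zneg w by (simp add: ph_def)
    qed
    have zi: "R / 2 < norm (z - p)"
    proof (rule ccontr)
      assume "\<not> ?thesis"
      then have "norm (z - p) = R / 2" using z by (simp add: D_def)
      then have "w0 \<le> v1 z - v2 z" using w0(2) z by blast
      moreover have "ep * barrier e p R a z \<le> ep * C0" using barrier_le3[OF z(1)] ep by simp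
      ultimately show False using zneg ep2 by (simp add: ph_def)
    qed
    have "open {y. R / 2 < norm (y - p) \<and> norm (y - p) < R}"
      by (intro open_Collect_conj open_Collect_less continuous_intros)
    then obtain d where d: "d > 0" "\<And>y. dist z y < d \<Longrightarrow> R / 2 < norm (y - p) \<and> norm (y - p) < R"
      using zo zi unfolding open_contains_ball by (force simp: subset_iff)
    have nearD: "z + t *\<^sub>R x \<in> D" if "\<bar>t\<bar> < d / (norm x + 1)" "z + t *\<^sub>R x \<in> ?H" for t x
    proof -
      have "\<bar>t\<bar> * (norm x + 1) < d" using that(1) by (simp add: pos_less_divide_eq add_nonneg_pos)
      then have "\<bar>t\<bar> * norm x < d" by (simp add: distrib_left)
      then have "dist z (z + t *\<^sub>R x) < d" by (simp add: dist_norm)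
      from d(2)[OF this] show ?thesis using that(2) by (simp add: D_def)
    qed
    have dx: "d / (norm x + 1) > 0" for x :: "real^'n" using d by (simp add: add_nonneg_pos)
    define s where "s = v1 z - v2 z"
    have s: "0 \<le> s" "s \<le> ep * barrier e p R a z" using w zneg by (auto simp: s_def ph_def)
    have sE: "s \<le> ep * E z * C0" using s(2) barrier_le2[OF z(1)] ep by (smt (verit) mult.assoc mult_left_mono)
    have v2z: "m0 / 2 \<le> v2 z"
    proof -
      have "ep * barrier e p R a z \<le> ep * C0" using barrier_le3[OF z(1)] ep by simp
      then show ?thesis using s m0(2)[OF z(1)] ep1 by (simp add: s_def)
    qed
    have Ebd: "E z - ER \<le> E z" "E z - ER > 0"
    proof -
      have "(norm (z - p))\<^sup>2 < R\<^sup>2" using zo by (intro power_strict_mono) auto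
      then show "E z - ER > 0" using a by (simp add: E_def ER_def)
    qed (simp add: ER_def)
    have Db: "Dbarrier e p R a z = (- 2 * a * E z * (1 + z $ e)) *\<^sub>R (z - p) + (E z - ER) *\<^sub>R axis e 1"
      by (simp add: Dbarrier_def E_def ER_def)
    have nDb: "norm (Dbarrier e p R a z) \<le> E z * (2 * a * R * C0 + 1)"
    proof -
      have "norm (Dbarrier e p R a z) \<le> 2 * a * E z * (1 + z $ e) * norm (z - p) + (E z - ER)"
        unfolding Db using a E01(1)[of z] C0(2)[OF z(1)] Ebd
        by (intro order_trans[OF norm_triangle_ineq]) (simp add: abs_mult)
      also have "\<dots> \<le> 2 * a * E z * C0 * R + E z"
        using a E01(1)[of z] C0[OF z(1)] zo Ebd C0p by (intro add_mono mult_mono) auto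
      finally show ?thesis by (simp add: algebra_simps)
    qed
    define N where "N = 4 * ep * a\<^sup>2 * E z * (m0 / 2)"
    define c where "c = ep * E z * a * C'"
    have N0: "N \<ge> 0" using ep E01(1)[of z] m0 by (simp add: N_def)
    have c: "0 < c" "c \<le> 1"
    proof -
      show "0 < c" using ep E01(1)[of z] a C' by (simp add: c_def)
      have "c = E z * (ep * (a * C'))" by (simp add: c_def)
      also have "\<dots> \<le> 1 * 1" using E01[of z] ep3 ep aC' by (intro mult_mono) auto
      finally show "c \<le> 1" by simp
    qed
    have NL: "L' * c \<le> N * (norm (z - p))\<^sup>2" if "L' \<le> L" for L'
    proof -
      have "L' * c \<le> L * c" using that c by simp
      also have "L * c = (ep * E z * a) * (L * C')" by (simp add: c_def)
      also have "\<dots> \<le> (ep * E z * a) * (a * (m0 * R\<^sup>2) / 2)"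
        using a(2) ep E01(1)[of z] a(1) by (intro mult_left_mono) auto
      also have "\<dots> = N * (R / 2)\<^sup>2" by (simp add: N_def power2_eq_square)
      also have "\<dots> \<le> N * (norm (z - p))\<^sup>2" using zi R N0 by (intro mult_left_mono power_mono) auto
      finally show ?thesis .
    qed
    have est: "v2 z * (x \<bullet> (D2v2 z *v x)) - (norm g2)\<^sup>2 / 2 * (norm x)\<^sup>2 + N * ((z - p) \<bullet> x)\<^sup>2
       \<le> v1 z * (x \<bullet> (D2v1 z *v x)) - (norm g1)\<^sup>2 / 2 * (norm x)\<^sup>2 + c * (norm x)\<^sup>2"
      if psd: "0 \<le> x \<bullet> (D2ph z *v x)" and g: "norm g1 \<le> C" "norm gb \<le> E z * (2 * a * R * C0 + 1)" "g2 = g1 - ep *\<^sub>R gb" for x g1 g2 gb :: "real^'n"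
    proof -
      have q: "x \<bullet> (D2v2 z *v x) \<le> x \<bullet> (D2v1 z *v x) - ep * (x \<bullet> (D2barrier e p R a z *v x))"
        using psd by (simp add: D2ph_def matrix_vector_mult_diff_rdistrib inner_diff_right flip: scaleR_matrix_vector_assoc)
      have rx: "((z - p) \<bullet> x)\<^sup>2 \<le> R\<^sup>2 * (norm x)\<^sup>2"
      proof -
        have "\<bar>(z - p) \<bullet> x\<bar> \<le> norm (z - p) * norm x" by (rule Cauchy_Schwarz_ineq2)
        also have "\<dots> \<le> R * norm x" using zo by (intro mult_right_mono) auto
        finally have "\<bar>(z - p) \<bullet> x\<bar>\<^sup>2 \<le> (R * norm x)\<^sup>2" by (intro power_mono) auto
        then show ?thesis by (simp add: power_mult_distrib)
      qed
      have xe: "(x $ e)\<^sup>2 \<le> (norm x)\<^sup>2"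
        using power_mono[OF component_le_norm_cart[of x e], of 2] by simp
      have "v2 z * (x \<bullet> (D2v2 z *v x)) - (norm g2)\<^sup>2 / 2 * (norm x)\<^sup>2 + 4 * ep * a\<^sup>2 * E z * (m0 / 2) * ((z - p) \<bullet> x)\<^sup>2
         \<le> v1 z * (x \<bullet> (D2v1 z *v x)) - (norm g1)\<^sup>2 / 2 * (norm x)\<^sup>2
          + ep * E z * a * (C * (C0 + (2 * C0 + 4 * R) + (2 * R * C0 + 1))) * (norm x)\<^sup>2"
      proof (rule barrier_quad_le[where s = s and qb = "x \<bullet> (D2barrier e p R a z *v x)" and ye = "z $ e" and xe = "x $ e" and gb = gb])
        show "x \<bullet> (D2barrier e p R a z *v x) = E z * (4 * a\<^sup>2 * (1 + z $ e) * ((z - p) \<bullet> x)\<^sup>2 -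
            2 * a * (1 + z $ e) * (norm x)\<^sup>2 - 4 * a * ((z - p) \<bullet> x) * x $ e)"
          unfolding D2barrier_quad E_def ..
      qed (use q s v2z C(2,4)[OF z(1)] g ep sE C0[OF z(1)] a(1) rx xe m0 R E01[of z] in \<open>auto simp: s_def\<close>)
      also have "\<dots> \<le> v1 z * (x \<bullet> (D2v1 z *v x)) - (norm g1)\<^sup>2 / 2 * (norm x)\<^sup>2 + c * (norm x)\<^sup>2"
        unfolding c_def C'_def using ep E01(1)[of z] a(1)
        by (intro add_left_mono mult_right_mono mult_left_mono) auto
      finally show ?thesis by (simp add: N_def)
    qed
    have zS: "z \<in> S" using z DS by auto
    have G2: "garding_cone k (?A2 z)" and sg: "sigma k (?A2 z) = sigma k (?A1 z)"
      using s1 s2 zS by (auto simp: solution_on_def)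
    show False
    proof (cases "z $ e > 0")
      case True
      have two: "Dph z \<bullet> x = 0 \<and> x \<bullet> (D2ph z *v x) \<ge> 0" for x
      proof -
        define d1 where "d1 = min (d / (norm x + 1)) (z $ e / (norm x + 1))"
        have "d1 > 0" using dx True by (simp add: d1_def add_nonneg_pos)
        moreover have inD: "z + t *\<^sub>R x \<in> D" if t: "\<bar>t\<bar> < d1" for t
        proof (rule nearD)
          show "\<bar>t\<bar> < d / (norm x + 1)" using t by (simp add: d1_def)
          have "\<bar>t\<bar> * (norm x + 1) < z $ e" using t by (simp add: d1_def pos_less_divide_eq add_nonneg_pos)
          then have "\<bar>t\<bar> * norm x < z $ e" by (simp add: distrib_left)
          moreover have "\<bar>t * x $ e\<bar> \<le> \<bar>t\<bar> * norm x"
            using component_le_norm_cart[of x e] by (simp add: abs_mult mult_left_mono)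
          ultimately show "z + t *\<^sub>R x \<in> ?H" by (simp add: closed_half_space_def)
        qed
        ultimately show ?thesis using C2_min_two_sided[OF Cph, of d1 z x] z(2) by blast
      qed
      have "Dph z = 0" using two[of "Dph z"] by simp
      then have g2: "Dv2 z = Dv1 z - ep *\<^sub>R Dbarrier e p R a z" by (simp add: Dph_def algebra_simps)
      have "quad_le (?A2 z + N *\<^sub>R outer (z - p)) (?A1 z + c *\<^sub>R mat 1)"
        unfolding quad_le_def
      proof
        fix x
        show "x \<bullet> ((?A2 z + N *\<^sub>R outer (z - p)) *v x) \<le> x \<bullet> ((?A1 z + c *\<^sub>R mat 1) *v x)"
          using est[of x "Dv1 z" "Dbarrier e p R a z" "Dv2 z", OF _ C(3)[OF z(1)] nDb g2] two[of x]
          by (simp add: matrix_vector_mult_add_rdistrib inner_add_right schouten_v_quad outer_mult_vec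
              power2_norm_eq_inner[symmetric] power2_eq_square[of "_ \<bullet> _"] inner_commute
              flip: scaleR_matrix_vector_assoc)
      qed
      from L1(2)[OF z(1) G2 c N0 NL this] show False using sg by (simp add: L_def)
    next
      case False
      then have z0: "z $ e = 0" using zH by (simp add: closed_half_space_def)
      have p0: "p $ e = 0"
      proof (rule ccontr)
        assume "p $ e \<noteq> 0"
        then have "p $ e \<ge> R" using p by simp
        then have "R \<le> \<bar>(z - p) $ e\<bar>" using z0 R by simp
        also have "\<dots> \<le> norm (z - p)" by (rule component_le_norm_cart)
        finally show False using zo by simp
      qed
      have two: "Dph z \<bullet> x = 0 \<and> x \<bullet> (D2ph z *v x) \<ge> 0" if x: "x $ e = 0" for x
      proof -
        have inD: "z + t *\<^sub>R x \<in> D" if t: "\<bar>t\<bar> < d / (norm x + 1)" for t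
          by (rule nearD[OF t]) (use z0 x in \<open>simp add: closed_half_space_def\<close>)
        then show ?thesis using C2_min_two_sided[OF Cph dx[of x], of z x] z(2) by blast
      qed
      have "Dph z \<bullet> axis e 1 \<ge> 0"
      proof (rule C2_min_one_sided[OF Cph dx[of "axis e 1"]])
        fix t assume t: "0 \<le> t" "t < d / (norm (axis e 1 :: real^'n) + 1)"
        show inD: "z + t *\<^sub>R axis e 1 \<in> D"
          by (rule nearD) (use t z0 in \<open>auto simp: closed_half_space_def\<close>)
        show "ph z \<le> ph (z + t *\<^sub>R axis e 1)" by (rule z(2)[OF inD])
      qed
      \<comment> \<open>With \<open>z\<close> and \<open>p\<close> both on the hyperplane the normal
        derivative of the barrier is \<open>E z - ER > 0\<close>, so the one-sided test becomes a
        strict inequality between mean curvatures.\<close>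
      then have h12: "Dv2 z $ e < Dv1 z $ e"
        using Ebd(2) ep z0 p0 by (simp add: Dph_def Db inner_diff_left inner_add_left inner_axis) (smt (verit) mult_pos_pos)
      have c0A2: "boundary_op e k (Dv2 z $ e) (?A2 z) = c0" and c0A1: "boundary_op e k (Dv1 z $ e) (?A1 z) = c0"
        using s1 s2 zS z0 by (auto simp: solution_on_def)
      have h2: "Dv2 z $ e > 0" using boundary_op_pos_imp[OF G2] c0A2 c0 by metis
      let ?h1 = "Dv1 z $ e" and ?h2 = "Dv2 z $ e"
      define t where "t = (?h1\<^sup>2 - ?h2\<^sup>2) / 2"
      have t0: "0 \<le> t" using h12 h2 by (simp add: t_def power_mono)
      have tT: "t \<le> T"
      proof -
        have "?h1\<^sup>2 \<le> C\<^sup>2" using h12 h2 component_le_norm_cart[of "Dv1 z" e] C(3)[OF z(1)] by (intro power_mono) auto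
        moreover have "0 \<le> ?h2\<^sup>2" by simp
        ultimately show ?thesis unfolding t_def T_def by argo
      qed
      have gT: "tproj e (Dv2 z) = tproj e (Dv1 z) - ep *\<^sub>R tproj e (Dbarrier e p R a z)"
      proof -
        have "tproj e (Dph z) \<bullet> tproj e (Dph z) = Dph z \<bullet> tproj e (Dph z)"
          using inner_tproj[of "tproj e (Dph z)" e "Dph z"] by (simp add: tproj_nth inner_commute)
        also have "\<dots> = 0" using two[of "tproj e (Dph z)"] by (simp add: tproj_nth)
        finally have "tproj e (Dv1 z - 1 *\<^sub>R Dv2 z - ep *\<^sub>R Dbarrier e p R a z) = 0" by (simp add: Dph_def)
        then show ?thesis unfolding tproj_diff_scaleR by (simp add: algebra_simps)
      qed
      have zp: "(z - p) $ e = 0" using z0 p0 by simp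
      \<comment> \<open>Tangential form of the interior estimate: tangential gradients differ only
        by the barrier, and the difference of the squared normal derivatives is compensated by the
        shift \<open>t\<close>.\<close>
      have ml: "quad_le (tang e (?A2 z) + N *\<^sub>R outer (z - p)) (tA (z, t) + c *\<^sub>R mat 1)"
        unfolding quad_le_def
      proof
        fix x
        let ?x = "tproj e x"
        have "v2 z * (?x \<bullet> (D2v2 z *v ?x)) - (norm (tproj e (Dv2 z)))\<^sup>2 / 2 * (norm ?x)\<^sup>2 + N * ((z - p) \<bullet> ?x)\<^sup>2
         \<le> v1 z * (?x \<bullet> (D2v1 z *v ?x)) - (norm (tproj e (Dv1 z)))\<^sup>2 / 2 * (norm ?x)\<^sup>2 + c * (norm ?x)\<^sup>2"
          by (rule est[OF _ order_trans[OF norm_tproj_le C(3)[OF z(1)]] order_trans[OF norm_tproj_le nDb] gT])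
             (use two[of ?x] in \<open>simp add: tproj_nth\<close>)
        also have "c * (norm ?x)\<^sup>2 \<le> c * (norm x)\<^sup>2" using c norm_tproj_le[of e x] by (intro mult_left_mono power_mono) auto
        finally have "v2 z * (?x \<bullet> (D2v2 z *v ?x)) - (norm (Dv2 z))\<^sup>2 / 2 * (norm ?x)\<^sup>2 + N * ((z - p) \<bullet> x)\<^sup>2
         \<le> v1 z * (?x \<bullet> (D2v1 z *v ?x)) - (norm (Dv1 z))\<^sup>2 / 2 * (norm ?x)\<^sup>2 + t * (norm ?x)\<^sup>2 + c * (norm x)\<^sup>2"
          unfolding norm_tproj_sq[of e "Dv1 z"] norm_tproj_sq[of e "Dv2 z"] inner_tproj[OF zp] t_def
          by (simp add: algebra_simps diff_divide_distrib add_divide_distrib)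
        then show "x \<bullet> ((tang e (?A2 z) + N *\<^sub>R outer (z - p)) *v x) \<le> x \<bullet> ((tA (z, t) + c *\<^sub>R mat 1) *v x)"
          unfolding tA_def fst_conv snd_conv
          by (simp add: matrix_vector_mult_add_rdistrib inner_add_right tang_quad schouten_v_quad outer_mult_vec
              power2_norm_eq_inner[symmetric] power2_eq_square[of "_ \<bullet> _"] inner_commute
              flip: scaleR_matrix_vector_assoc)
      qed
      have "boundary_op e k ?h2 (?A2 z) < boundary_op e k ?h1 (?A1 z)"
      proof (rule boundary_op_less[OF k GA1[OF z(1)] h2 h12])
        fix j assume j: "1 \<le> j" "j < k"
        have "garding_cone (k - 1) (tang e (?A2 z))" by (rule garding_cone_tang) (use G2 k in simp)
        from L2(2)[OF z(1) t0 tT this c N0 NL ml j]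
        show "sigma j (tang e (?A2 z)) \<le> sigma j (tang e (?A1 z + ((?h1\<^sup>2 - ?h2\<^sup>2) / 2) *\<^sub>R mat 1))"
          by (simp add: L_def tA_def t_def)
      qed
      then show False using c0A1 c0A2 by simp
    qed
  qed
  \<comment> \<open>\<open>ph\<close> vanishes at \<open>y0\<close> and is nonnegative on the
    annulus, so the segment from \<open>y0\<close> towards \<open>p\<close> gives the sign of its
    derivative there.\<close>
  have "Dph y0 \<bullet> (p - y0) \<ge> 0"
  proof (rule C2_min_one_sided[OF Cph])
    show "(1/2::real) > 0" by simp
    fix t :: real assume t: "0 \<le> t" "t < 1/2"
    have "y0 + t *\<^sub>R (p - y0) - p = (1 - t) *\<^sub>R (y0 - p)" by (simp add: algebra_simps)
    then have "norm (y0 + t *\<^sub>R (p - y0) - p) = (1 - t) * R" using t y0(2) by simp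
    moreover have "R / 2 \<le> (1 - t) * R" "(1 - t) * R \<le> R"
      using t R mult_right_mono[of "1/2" "1 - t" R] by (auto simp: algebra_simps)
    moreover have "y0 + t *\<^sub>R (p - y0) \<in> ?H"
    proof -
      have "(y0 + t *\<^sub>R (p - y0)) $ e = (1 - t) * y0 $ e + t * p $ e" by (simp add: algebra_simps)
      also have "\<dots> \<ge> 0" using t y0(1) pH by (intro add_nonneg_nonneg mult_nonneg_nonneg) (auto simp: closed_half_space_def)
      finally show ?thesis by (simp add: closed_half_space_def)
    qed
    ultimately show inD: "y0 + t *\<^sub>R (p - y0) \<in> D" by (simp add: D_def)
    have "ph y0 = 0" using y0 by (simp add: ph_def barrier_def)
    then show "ph y0 \<le> ph (y0 + t *\<^sub>R (p - y0))" using ph0[OF inD] by simp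
  qed
  then have "(Dv1 y0 - Dv2 y0) \<bullet> (p - y0) \<ge> ep * (Dbarrier e p R a y0 \<bullet> (p - y0))"
    by (simp add: Dph_def inner_diff_left)
  moreover have "Dbarrier e p R a y0 \<bullet> (p - y0) = 2 * a * exp (- a * R\<^sup>2) * (1 + y0 $ e) * R\<^sup>2"
  proof -
    have "(y0 - p) \<bullet> (p - y0) = - R\<^sup>2"
      unfolding y0(2)[symmetric] power2_norm_eq_inner by (simp add: inner_diff_left inner_diff_right)
    then show ?thesis by (simp add: Dbarrier_def y0(2) inner_add_left)
  qed
  moreover have "2 * a * exp (- a * R\<^sup>2) * (1 + y0 $ e) * R\<^sup>2 > 0"
    using a R C0(2)[OF y0D] by (intro mult_pos_pos) auto
  ultimately show ?thesis using ep by (smt (verit) mult_pos_pos)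
qed

section \<open>Strong maximum principle and inversions\<close>

lemma closed_half_space_closed: "closed (closed_half_space e)"
  unfolding closed_half_space_def by (intro closed_Collect_le continuous_intros)

text \<open>The contact set is relatively closed; it is open because a noncontact point close to it
  would have a nearest contact point \<open>z\<close>, where the Hopf lemma gives a nonzero gradient
  of the difference while the interior minimum gives zero.\<close>

lemma interior_strong_max:
  fixes G :: "(real^'n) set"
  assumes k: "1 \<le> k" "k \<le> CARD('n)" and c0: "c0 > 0"
    and s1: "solution_on e k c0 S v1 Dv1 D2v1" and s2: "solution_on e k c0 S v2 Dv2 D2v2"
    and G: "open G" "connected G" "G \<subseteq> S" "\<And>y. y \<in> G \<Longrightarrow> y $ e > 0"
    and ge: "\<And>y. y \<in> G \<Longrightarrow> v2 y \<le> v1 y"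
    and z: "z \<in> G" "v1 z = v2 z" and y: "y \<in> G"
  shows "v1 y = v2 y"
proof -
  define Z where "Z = {y \<in> G. v1 y = v2 y}"
  have C1: "C2_with G v1 Dv1 D2v1" and C2: "C2_with G v2 Dv2 D2v2"
    using s1 s2 G(3) C2_with_subset by (auto simp: solution_on_def)
  have cont: "continuous_on G (\<lambda>y. v1 y - v2 y)"
    by (intro continuous_intros C2_with_continuous[OF C1] C2_with_continuous[OF C2])
  have Zpre: "Z = G \<inter> (\<lambda>y. v1 y - v2 y) -` {0}" by (auto simp: Z_def)
  have "closedin (top_of_set G) Z"
    unfolding Zpre by (rule continuous_closedin_preimage[OF cont]) simp
  moreover have "open Z"
    unfolding open_contains_ball
  proof
    fix y0 assume y0: "y0 \<in> Z"
    then obtain r0 where r0: "r0 > 0" "ball y0 r0 \<subseteq> G" using G(1) by (auto simp: Z_def open_contains_ball)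
    define r where "r = r0 / 4"
    have r: "r > 0" "cball y0 (2 * r) \<subseteq> G"
      using r0 by (auto simp: r_def subset_iff)
    show "\<exists>r>0. ball y0 r \<subseteq> Z"
    proof (intro exI[of _ r] conjI r subsetI)
      fix q assume q: "q \<in> ball y0 r"
      have qG: "q \<in> G" using q r by (auto simp: subset_iff)
      show "q \<in> Z"
      proof (rule ccontr)
        assume "q \<notin> Z"
        \<comment> \<open>Cutting with the closed ball of radius \<open>2 * r\<close> makes the
          contact set closed. The nearest point is at distance less than \<open>r\<close>, so the
          touching ball stays inside.\<close>
        define K where "K = cball y0 (2 * r) \<inter> (\<lambda>y. v1 y - v2 y) -` {0}"
        have KZ: "K \<subseteq> Z" using r by (auto simp: K_def Z_def)
        have "closed K" unfolding K_def
          by (rule continuous_closed_preimage[OF continuous_on_subset[OF cont r(2)]]) auto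
        moreover have "y0 \<in> K" using y0 r by (auto simp: K_def Z_def)
        ultimately obtain z where z: "z \<in> K" "\<And>y. y \<in> K \<Longrightarrow> dist q z \<le> dist q y"
          using distance_attains_inf[of K q] by auto
        define R where "R = dist q z"
        have R: "R > 0" using z KZ \<open>q \<notin> Z\<close> by (auto simp: R_def)
        have Rr: "R < r" using z(2)[OF \<open>y0 \<in> K\<close>] q by (simp add: R_def dist_commute)
        have cb: "cball q R \<subseteq> cball y0 (2 * r)"
        proof
          fix w assume "w \<in> cball q R"
          then show "w \<in> cball y0 (2 * r)" using Rr q dist_triangle[of y0 w q] by auto
        qed
        then have cbG: "cball q R \<subseteq> G" using r by auto
        have "q - R *\<^sub>R axis e 1 \<in> cball q R" using R by (simp add: dist_norm)
        then have "q $ e \<ge> R" using G(4) cbG by fastforce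
        have hz: "(Dv1 z - Dv2 z) \<bullet> (q - z) > 0"
        proof (rule hopf_lemma[OF k c0 s1 s2 R])
          show "cball q R \<inter> closed_half_space e \<subseteq> S" using cbG G(3) by auto
          show "q $ e = 0 \<or> R \<le> q $ e" using \<open>q $ e \<ge> R\<close> by simp
          show "v2 y \<le> v1 y" if "y \<in> cball q R" for y using that cbG ge by auto
          show "v2 y < v1 y" if "norm (y - q) = R / 2" for y
          proof -
            have dq: "dist q y = R / 2" using that by (simp add: dist_norm norm_minus_commute)
            then have yb: "y \<in> cball q R" using R by simp
            have "v1 y \<noteq> v2 y"
            proof
              assume "v1 y = v2 y"
              then have "y \<in> K" using yb cb by (auto simp: K_def)
              from z(2)[OF this] show False using dq R by (simp add: R_def)
            qed
            then show ?thesis using ge[of y] yb cbG by force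
          qed
          show "z \<in> closed_half_space e" using z KZ G(4) by (force simp: Z_def closed_half_space_def)
          show "norm (z - q) = R" by (simp add: R_def dist_norm norm_minus_commute)
          show "v1 z = v2 z" using z by (simp add: K_def)
        qed
        have zG: "z \<in> G" "v1 z = v2 z" using z KZ by (auto simp: Z_def)
        obtain d where d: "d > 0" "ball z d \<subseteq> G" using zG G(1) by (auto simp: open_contains_ball)
        have "(Dv1 z - 1 *\<^sub>R Dv2 z) \<bullet> (q - z) = 0"
        proof (rule C2_min_two_sided(1)[OF C2_with_diff[OF C1 C2, of 1]])
          show "d / R > 0" using d R by simp
          fix t assume "\<bar>t\<bar> < d / R"
          then have "\<bar>t\<bar> * R < d" using R by (simp add: pos_less_divide_eq)
          then have "dist z (z + t *\<^sub>R (q - z)) < d" by (simp add: dist_norm R_def)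
          then show inG: "z + t *\<^sub>R (q - z) \<in> G" using d by auto
          show "v1 z - 1 * v2 z \<le> v1 (z + t *\<^sub>R (q - z)) - 1 * v2 (z + t *\<^sub>R (q - z))"
            using ge[OF inG] zG by simp
        qed
        then show False using hz by simp
      qed
    qed
  qed
  then have "openin (top_of_set G) Z" by (auto simp: Z_def intro: open_subset)
  ultimately have "Z = {} \<or> Z = G" using G(2) unfolding connected_clopen by blast
  then show ?thesis using z y by (auto simp: Z_def)
qed

text \<open>A ball touching the hyperplane from inside at a contact point makes the normal
  derivatives strictly ordered. The tangential gradients agree and the tangential Hessians are
  ordered, so \<open>boundary_op_less\<close> separates the two boundary values, which are both
  \<open>c0\<close>.\<close>

lemma boundary_strict:
  fixes y0 :: "real^'n"
  assumes k: "1 \<le> k" "k \<le> CARD('n)" and c0: "c0 > 0"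
    and s1: "solution_on e k c0 S v1 Dv1 D2v1" and s2: "solution_on e k c0 S v2 Dv2 D2v2"
    and r: "r > 0" "cball y0 r \<inter> closed_half_space e \<subseteq> S" and y0: "y0 $ e = 0"
    and ge: "\<And>y. y \<in> cball y0 r \<Longrightarrow> y \<in> closed_half_space e \<Longrightarrow> v2 y \<le> v1 y"
    and gt: "\<And>y. y \<in> cball y0 r \<Longrightarrow> y $ e > 0 \<Longrightarrow> v2 y < v1 y"
  shows "v2 y0 < v1 y0"
proof (rule ccontr)
  assume "\<not> v2 y0 < v1 y0"
  let ?H = "closed_half_space e"
  have y0H: "y0 \<in> ?H" using y0 by (simp add: closed_half_space_def)
  have eq: "v1 y0 = v2 y0" using ge[of y0] r y0H \<open>\<not> v2 y0 < v1 y0\<close> by auto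
  define R where "R = r / 2"
  define p where "p = y0 + R *\<^sub>R axis e 1"
  have R: "R > 0" using r by (simp add: R_def)
  have cb: "cball p R \<subseteq> cball y0 r"
  proof
    fix w assume "w \<in> cball p R"
    moreover have "dist y0 p = R" using R by (simp add: p_def dist_norm)
    ultimately show "w \<in> cball y0 r" using dist_triangle[of y0 w p] by (simp add: R_def)
  qed
  have "(Dv1 y0 - Dv2 y0) \<bullet> (p - y0) > 0"
  proof (rule hopf_lemma[OF k c0 s1 s2 R])
    show "cball p R \<inter> ?H \<subseteq> S" using cb r by auto
    show "p $ e = 0 \<or> R \<le> p $ e" by (simp add: p_def y0)
    show "v2 y \<le> v1 y" if "y \<in> cball p R" "y \<in> ?H" for y using that cb ge by auto
    show "v2 y < v1 y" if y: "norm (y - p) = R / 2" for y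
    proof (rule gt)
      have "y \<in> cball p R" using y R by (simp add: dist_norm norm_minus_commute)
      then show "y \<in> cball y0 r" using cb by auto
      have "\<bar>y $ e - p $ e\<bar> \<le> R / 2"
        using component_le_norm_cart[of "y - p" e] y by (simp only: vector_minus_component)
      then have "p $ e - R / 2 \<le> y $ e" by linarith
      then show "y $ e > 0" using R by (simp add: p_def y0)
    qed
    show "norm (y0 - p) = R" using R by (simp add: p_def)
  qed (use y0H eq in auto)
  then have h12: "Dv2 y0 $ e < Dv1 y0 $ e"
    using R by (simp add: p_def inner_axis zero_less_mult_iff)
  let ?D = "cball y0 r \<inter> ?H"
  have C: "C2_with ?D (\<lambda>x. v1 x - 1 * v2 x) (\<lambda>x. Dv1 x - 1 *\<^sub>R Dv2 x) (\<lambda>x. D2v1 x - 1 *\<^sub>R D2v2 x)"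
    by (intro C2_with_diff C2_with_subset[OF _ r(2)]) (use s1 s2 in \<open>auto simp: solution_on_def\<close>)
  have two: "(Dv1 y0 - 1 *\<^sub>R Dv2 y0) \<bullet> x = 0" "x \<bullet> ((D2v1 y0 - 1 *\<^sub>R D2v2 y0) *v x) \<ge> 0" if x: "x $ e = 0" for x
  proof -
    have d: "r / (norm x + 1) > 0" using r by (simp add: add_nonneg_pos)
    have inD: "y0 + t *\<^sub>R x \<in> ?D" if t: "\<bar>t\<bar> < r / (norm x + 1)" for t
    proof -
      have "\<bar>t\<bar> * (norm x + 1) < r" using t by (simp add: pos_less_divide_eq add_nonneg_pos)
      then have "\<bar>t\<bar> * norm x \<le> r" by (simp add: distrib_left)
      then show ?thesis using x y0 by (simp add: dist_norm closed_half_space_def)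
    qed
    have mn: "v1 y0 - 1 * v2 y0 \<le> v1 (y0 + t *\<^sub>R x) - 1 * v2 (y0 + t *\<^sub>R x)" if t: "\<bar>t\<bar> < r / (norm x + 1)" for t
      using ge[of "y0 + t *\<^sub>R x"] inD[OF t] eq by simp
    show "(Dv1 y0 - 1 *\<^sub>R Dv2 y0) \<bullet> x = 0" "x \<bullet> ((D2v1 y0 - 1 *\<^sub>R D2v2 y0) *v x) \<ge> 0"
      using C2_min_two_sided[OF C d inD mn] by auto
  qed
  have y0S: "y0 \<in> S" using r y0H by auto
  let ?A1 = "schouten_v (v1 y0) (Dv1 y0) (D2v1 y0)" and ?A2 = "schouten_v (v2 y0) (Dv2 y0) (D2v2 y0)"
  let ?h1 = "Dv1 y0 $ e" and ?h2 = "Dv2 y0 $ e"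
  have G1: "garding_cone k ?A1" and G2: "garding_cone k ?A2" using s1 s2 y0S by (auto simp: solution_on_def)
  have b1: "boundary_op e k ?h1 ?A1 = c0" and b2: "boundary_op e k ?h2 ?A2 = c0" using s1 s2 y0S y0 by (auto simp: solution_on_def)
  have h2: "?h2 > 0" using boundary_op_pos_imp[OF G2] b2 c0 by metis
  define t where "t = (?h1\<^sup>2 - ?h2\<^sup>2) / 2"
  have t0: "0 \<le> t" using h12 h2 by (simp add: t_def power_mono)
  have v2p: "v2 y0 > 0" using s2 y0S by (auto simp: solution_on_def)
  let ?g = "Dv1 y0 - 1 *\<^sub>R Dv2 y0"
  have "tproj e ?g \<bullet> tproj e ?g = ?g \<bullet> tproj e ?g"
    using inner_tproj[of "tproj e ?g" e ?g] by (simp add: tproj_nth inner_commute)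
  also have "\<dots> = 0" by (rule two) (rule tproj_nth)
  finally have "tproj e ?g = 0" by simp
  then have gT: "tproj e (Dv1 y0) = tproj e (Dv2 y0)" unfolding tproj_diff_scaleR by simp
  have ml: "quad_le (tang e ?A2) (tang e (?A1 + t *\<^sub>R mat 1))"
    unfolding quad_le_def
  proof
    fix x
    let ?x = "tproj e x"
    have le: "v2 y0 * (?x \<bullet> (D2v2 y0 *v ?x)) \<le> v1 y0 * (?x \<bullet> (D2v1 y0 *v ?x))"
      unfolding eq using two(2)[OF tproj_nth, of x] v2p
      by (simp add: matrix_vector_mult_diff_rdistrib inner_diff_right)
    have "(norm (Dv1 y0))\<^sup>2 - ?h1\<^sup>2 = (norm (Dv2 y0))\<^sup>2 - ?h2\<^sup>2"
      using arg_cong[OF gT, of "\<lambda>x. (norm x)\<^sup>2"] unfolding norm_tproj_sq .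
    then have N2: "(norm (Dv2 y0))\<^sup>2 = (norm (Dv1 y0))\<^sup>2 - ?h1\<^sup>2 + ?h2\<^sup>2" by linarith
    have "- ((norm (Dv2 y0))\<^sup>2 / 2 * (norm ?x)\<^sup>2) = - ((norm (Dv1 y0))\<^sup>2 / 2 * (norm ?x)\<^sup>2) + t * (norm ?x)\<^sup>2"
      unfolding t_def N2 by (simp add: algebra_simps diff_divide_distrib add_divide_distrib)
    then show "x \<bullet> (tang e ?A2 *v x) \<le> x \<bullet> (tang e (?A1 + t *\<^sub>R mat 1) *v x)"
      using le by (simp add: tang_quad matrix_vector_mult_add_rdistrib inner_add_right schouten_v_quad power2_norm_eq_inner[symmetric]
          flip: scaleR_matrix_vector_assoc)
  qed
  have GT2: "garding_cone (k - 1) (tang e ?A2)" by (rule garding_cone_tang) (use G2 k in simp)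
  have GT1: "garding_cone (k - 1) (tang e (?A1 + t *\<^sub>R mat 1))"
    by (rule garding_cone_tang) (use garding_cone_plus_mat1[OF G1 t0] k in simp)
  have "boundary_op e k ?h2 ?A2 < boundary_op e k ?h1 ?A1"
  proof (rule boundary_op_less[OF k G1 h2 h12])
    fix j assume "1 \<le> j" "j < k"
    then show "sigma j (tang e ?A2) \<le> sigma j (tang e (?A1 + ((?h1\<^sup>2 - ?h2\<^sup>2) / 2) *\<^sub>R mat 1))"
      using garding_cone_mono[OF GT2 _ ml] GT1 unfolding garding_cone_def t_def by auto
  qed
  then show False using b1 b2 by simp
qed

section \<open>Householder reflections, inversions and conformal covariance\<close>

definition hrefl :: "real^'n \<Rightarrow> real^'n^'n" where
  "hrefl x = mat 1 - (2 / (norm x)\<^sup>2) *\<^sub>R outer x"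

lemma hrefl_mult: "hrefl x *v h = h - (2 * (x \<bullet> h) / (norm x)\<^sup>2) *\<^sub>R x"
  by (simp add: hrefl_def matrix_vector_mult_diff_rdistrib outer_mult_vec flip: scaleR_matrix_vector_assoc)

lemma transpose_hrefl: "transpose (hrefl x) = hrefl x"
  by (simp add: hrefl_def transpose_minus transpose_scaleR transpose_outer)

lemma hrefl_refl:
  assumes "x \<noteq> 0"
  shows "hrefl x ** hrefl x = mat 1"
proof -
  have "(hrefl x ** hrefl x) *v h = mat 1 *v h" for h
    using assms unfolding matrix_vector_mul_assoc[symmetric] hrefl_mult
    by (simp add: inner_diff_right power2_norm_eq_inner scaleR_diff_left[symmetric] field_simps)
  then show ?thesis by (simp add: matrix_eq)
qed

lemma orthogonal_hrefl: "x \<noteq> 0 \<Longrightarrow> orthogonal_matrix (hrefl x)"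
  by (simp add: orthogonal_matrix transpose_hrefl hrefl_refl)

lemma diag_mult_nth: "(diag l ** A) $ i $ j = l i * A $ i $ j" "(A ** diag l) $ i $ j = A $ i $ j * l j"
  by (simp_all add: matrix_matrix_mult_def diag_def if_distrib[of "\<lambda>x. x * _"] if_distrib[of "(*) _"] cong: if_cong)

text \<open>A reflection along a tangential vector commutes with the projection \<open>?D\<close>
  that cuts out the tangential block.\<close>

lemma sigma_tang_hrefl:
  assumes x: "x \<noteq> 0" "x $ e = 0"
  shows "sigma s (tang e (transpose (hrefl x) ** A ** hrefl x)) = sigma s (tang e A)"
proof -
  let ?D = "diag (\<lambda>i. if i = e then 0 else 1)"
  have tD: "tang e B = ?D ** B ** ?D" for B
    by (auto simp: vec_eq_iff diag_mult_nth tang_def)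
  have com: "?D ** hrefl x = hrefl x ** ?D"
    using x(2) by (auto simp: vec_eq_iff diag_mult_nth hrefl_def outer_def mat_def)
  have "tang e (transpose (hrefl x) ** A ** hrefl x) = (?D ** hrefl x) ** A ** (hrefl x ** ?D)"
    unfolding tD by (simp add: transpose_hrefl matrix_mul_assoc)
  also have "\<dots> = (hrefl x ** ?D) ** A ** (?D ** hrefl x)" by (simp add: com)
  also have "\<dots> = transpose (hrefl x) ** tang e A ** hrefl x"
    unfolding tD by (simp add: transpose_hrefl matrix_mul_assoc)
  finally show ?thesis by (simp only: sigma_orthogonal_conj[OF orthogonal_hrefl[OF x(1)]])
qed

lemma garding_cone_hrefl: "x \<noteq> 0 \<Longrightarrow> garding_cone k A \<Longrightarrow> garding_cone k (transpose (hrefl x) ** A ** hrefl x)"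
  by (simp add: garding_cone_def transpose_conj sigma_orthogonal_conj[OF orthogonal_hrefl])

lemma boundary_op_hrefl:
  assumes "x \<noteq> 0" "x $ e = 0"
  shows "boundary_op e k h (transpose (hrefl x) ** A ** hrefl x) = boundary_op e k h A"
  unfolding boundary_op_def sigma_on_tang sigma_tang_hrefl[OF assms] ..

text \<open>Inversion in the sphere of radius \<open>sqrt t\<close> about \<open>x\<close>, and the induced action on conformal factors.\<close>

definition inv_pt :: "real^'n \<Rightarrow> real \<Rightarrow> real^'n \<Rightarrow> real^'n" where
  "inv_pt x t y = x + (t / (norm (y - x))\<^sup>2) *\<^sub>R (y - x)"

definition inv_v :: "real^'n \<Rightarrow> real \<Rightarrow> (real^'n \<Rightarrow> real) \<Rightarrow> real^'n \<Rightarrow> real" where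
  "inv_v x t v y = (norm (y - x))\<^sup>2 / t * v (inv_pt x t y)"

definition inv_D :: "real^'n \<Rightarrow> real \<Rightarrow> (real^'n \<Rightarrow> real) \<Rightarrow> (real^'n \<Rightarrow> real^'n) \<Rightarrow> real^'n \<Rightarrow> real^'n" where
  "inv_D x t v Dv y = (2 * v (inv_pt x t y) / t) *\<^sub>R (y - x) + hrefl (y - x) *v Dv (inv_pt x t y)"

text \<open>The Hessian of \<open>inv_v\<close>: the rank-one terms produced by differentiating the
  inversion cancel, leaving a multiple of the identity and a reflected Hessian.\<close>

definition inv_D2 :: "real^'n \<Rightarrow> real \<Rightarrow> (real^'n \<Rightarrow> real) \<Rightarrow> (real^'n \<Rightarrow> real^'n) \<Rightarrow> (real^'n \<Rightarrow> real^'n^'n) \<Rightarrow> real^'n \<Rightarrow> real^'n^'n" where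
  "inv_D2 x t v Dv D2v y = (2 * v (inv_pt x t y) / t - 2 * ((y - x) \<bullet> Dv (inv_pt x t y)) / (norm (y - x))\<^sup>2) *\<^sub>R mat 1
     + (t / (norm (y - x))\<^sup>2) *\<^sub>R (transpose (hrefl (y - x)) ** D2v (inv_pt x t y) ** hrefl (y - x))"

text \<open>Conformal covariance. The reflection preserves the norm of the gradient and reverses its
  radial part, so the terms in \<open>V^2\<close> and in \<open>V\<close> times the radial
  derivative cancel in the coefficient of the identity.\<close>

lemma schouten_v_inversion:
  fixes x y :: "real^'n"
  assumes "y \<noteq> x" "t > 0"
  shows "schouten_v (inv_v x t v y) (inv_D x t v Dv y) (inv_D2 x t v Dv D2v y)
    = transpose (hrefl (y - x)) ** schouten_v (v (inv_pt x t y)) (Dv (inv_pt x t y)) (D2v (inv_pt x t y)) ** hrefl (y - x)"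
proof -
  define z where "z = y - x"
  define V where "V = v (inv_pt x t y)"
  define p where "p = Dv (inv_pt x t y)"
  define H where "H = D2v (inv_pt x t y)"
  define Q where "Q = transpose (hrefl z) ** H ** hrefl z"
  have z0: "z \<noteq> 0" using assms by (simp add: z_def)
  then have nz: "norm z > 0" by simp
  have np: "(norm (hrefl z *v p))\<^sup>2 = (norm p)\<^sup>2"
    unfolding power2_norm_eq_inner hrefl_mult using z0
    by (simp add: inner_diff_left inner_diff_right inner_commute power2_norm_eq_inner field_simps power2_eq_square)
  have zp: "z \<bullet> (hrefl z *v p) = - (z \<bullet> p)"
    unfolding hrefl_mult using z0 by (simp add: inner_diff_right power2_norm_eq_inner)
  have ng: "(norm (inv_D x t v Dv y))\<^sup>2 = 4 * V\<^sup>2 * (norm z)\<^sup>2 / t\<^sup>2 - 4 * V * (z \<bullet> p) / t + (norm p)\<^sup>2"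
  proof -
    have "(norm (inv_D x t v Dv y))\<^sup>2 = (2 * V / t)\<^sup>2 * (norm z)\<^sup>2 + 2 * (2 * V / t) * (z \<bullet> (hrefl z *v p)) + (norm (hrefl z *v p))\<^sup>2"
      unfolding inv_D_def power2_norm_eq_inner z_def[symmetric] V_def[symmetric] p_def[symmetric]
      by (simp add: inner_add_left inner_add_right inner_commute power2_eq_square algebra_simps)
    then show ?thesis unfolding zp np by (simp add: power_divide power_mult_distrib field_simps)
  qed
  have conjI: "transpose (hrefl z) ** mat 1 ** hrefl z = mat 1" using hrefl_refl[OF z0] by (simp add: transpose_hrefl)
  have "transpose (hrefl z) ** schouten_v V p H ** hrefl z = V *\<^sub>R Q - ((norm p)\<^sup>2 / 2) *\<^sub>R mat 1"
  proof -
    have "schouten_v V p H = V *\<^sub>R H + (- ((norm p)\<^sup>2 / 2)) *\<^sub>R mat 1" by (simp add: schouten_v_def)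
    then show ?thesis by (simp only: conj_add conj_scaleR conjI Q_def) simp
  qed
  moreover have "schouten_v (inv_v x t v y) (inv_D x t v Dv y) (inv_D2 x t v Dv D2v y) = V *\<^sub>R Q - ((norm p)\<^sup>2 / 2) *\<^sub>R mat 1"
  proof -
    have lin: "a *\<^sub>R (b *\<^sub>R X + c *\<^sub>R Y) - d *\<^sub>R X = (a * b - d) *\<^sub>R X + (a * c) *\<^sub>R Y" for a b c d and X Y :: "real^'n^'n"
      by (simp add: scaleR_add_right scaleR_diff_left)
    have "schouten_v (inv_v x t v y) (inv_D x t v Dv y) (inv_D2 x t v Dv D2v y)
      = ((norm z)\<^sup>2 / t * V * (2 * V / t - 2 * (z \<bullet> p) / (norm z)\<^sup>2) - (norm (inv_D x t v Dv y))\<^sup>2 / 2) *\<^sub>R mat 1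
       + ((norm z)\<^sup>2 / t * V * (t / (norm z)\<^sup>2)) *\<^sub>R Q"
      unfolding schouten_v_def inv_v_def inv_D2_def z_def[symmetric] V_def[symmetric] p_def[symmetric] H_def[symmetric] Q_def[symmetric]
      by (rule lin)
    also have "(norm z)\<^sup>2 / t * V * (2 * V / t - 2 * (z \<bullet> p) / (norm z)\<^sup>2) - (norm (inv_D x t v Dv y))\<^sup>2 / 2 = - ((norm p)\<^sup>2 / 2)"
      unfolding ng using nz assms(2) by (simp add: field_simps power2_eq_square)
    also have "(norm z)\<^sup>2 / t * V * (t / (norm z)\<^sup>2) = V" using nz assms(2) by simp
    finally show ?thesis by simp
  qed
  ultimately show ?thesis by (simp add: V_def p_def H_def z_def)
qed

lemma inv_pt_half_space:
  assumes "x $ e = 0" "t > 0" "y \<in> closed_half_space e"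
  shows "inv_pt x t y \<in> closed_half_space e"
  using assms by (simp add: inv_pt_def closed_half_space_def)

lemma C2_inversion:
  fixes x :: "real^'n"
  assumes C: "C2_with (closed_half_space e) v Dv D2v" and x: "x $ e = 0" and t: "t > 0"
  shows "C2_with (closed_half_space e - {x}) (inv_v x t v) (inv_D x t v Dv) (inv_D2 x t v Dv D2v)"
proof -
  let ?H = "closed_half_space e"
  let ?S = "?H - {x}"
  have im: "inv_pt x t ` ?S \<subseteq> ?H" using inv_pt_half_space[OF x t] by auto
  have dn: "((\<lambda>y. (norm (y - x))\<^sup>2) has_derivative (\<lambda>h. 2 * ((y - x) \<bullet> h))) (at y within ?S)" for y
    unfolding power2_norm_eq_inner by (auto intro!: derivative_eq_intros simp: inner_commute)
  have di: "((\<lambda>y. c / (norm (y - x))\<^sup>2) has_derivative (\<lambda>h. - (2 * c * ((y - x) \<bullet> h)) / ((norm (y - x))\<^sup>2)\<^sup>2)) (at y within ?S)"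
    if "y \<in> ?S" for y c
    by (rule has_derivative_eq_rhs, rule has_derivative_divide[OF has_derivative_const dn])
       (use that in \<open>auto simp: fun_eq_iff field_simps power2_eq_square\<close>)
  \<comment> \<open>The differential of an inversion is a positive multiple of the reflection
    \<open>hrefl (y - x)\<close>.\<close>
  have dI: "(inv_pt x t has_derivative (\<lambda>h. (t / (norm (y - x))\<^sup>2) *\<^sub>R (hrefl (y - x) *v h))) (at y within ?S)" if "y \<in> ?S" for y
    unfolding inv_pt_def
    by (rule derivative_eq_intros di[OF that] refl)+
       (use that in \<open>simp add: fun_eq_iff hrefl_mult scaleR_diff_right power2_eq_square mult_ac\<close>)
  have dV: "((\<lambda>y. v (inv_pt x t y)) has_derivative (\<lambda>h. Dv (inv_pt x t y) \<bullet> ((t / (norm (y - x))\<^sup>2) *\<^sub>R (hrefl (y - x) *v h)))) (at y within ?S)"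
    if "y \<in> ?S" for y
    by (rule has_derivative_in_compose2[OF _ im that dI[OF that]]) (use C in \<open>auto simp: C2_with_def\<close>)
  have dp: "((\<lambda>y. Dv (inv_pt x t y)) has_derivative (\<lambda>h. D2v (inv_pt x t y) *v ((t / (norm (y - x))\<^sup>2) *\<^sub>R (hrefl (y - x) *v h)))) (at y within ?S)"
    if "y \<in> ?S" for y
    by (rule has_derivative_in_compose2[OF _ im that dI[OF that]]) (use C in \<open>auto simp: C2_with_def\<close>)
  have 1: "(inv_v x t v has_derivative (\<lambda>h. inv_D x t v Dv y \<bullet> h)) (at y within ?S)" if y: "y \<in> ?S" for y
  proof -
    define z where "z = y - x"
    define m where "m = (norm z)\<^sup>2"
    have m: "m \<noteq> 0" using y by (simp add: z_def m_def)
    have id: "inv_v x t v = (\<lambda>y. (1 / t * (norm (y - x))\<^sup>2) * v (inv_pt x t y))"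
      by (simp add: inv_v_def fun_eq_iff)
    show ?thesis unfolding id
    proof (rule has_derivative_eq_rhs[OF has_derivative_mult[OF has_derivative_mult_right[OF dn] dV[OF y]]], rule ext)
      fix h
      show "1 / t * (norm (y - x))\<^sup>2 * (Dv (inv_pt x t y) \<bullet> ((t / (norm (y - x))\<^sup>2) *\<^sub>R (hrefl (y - x) *v h)))
        + 1 / t * (2 * ((y - x) \<bullet> h)) * v (inv_pt x t y) = inv_D x t v Dv y \<bullet> h"
        unfolding inv_D_def hrefl_mult z_def[symmetric] m_def[symmetric] using m t
        by (simp add: inner_add_left inner_add_right inner_diff_left inner_diff_right inner_commute field_simps)
    qed
  qed
  have 2: "(inv_D x t v Dv has_derivative (\<lambda>h. inv_D2 x t v Dv D2v y *v h)) (at y within ?S)" if y: "y \<in> ?S" for y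
  proof -
    define z where "z = y - x"
    define q where "q = 1 / (norm z)\<^sup>2"
    define V where "V = v (inv_pt x t y)"
    define p where "p = Dv (inv_pt x t y)"
    define W where "W h = D2v (inv_pt x t y) *v ((t / (norm (y - x))\<^sup>2) *\<^sub>R (hrefl (y - x) *v h))" for h
    have qq: "c / (norm z)\<^sup>2 = c * q" "c / ((norm z)\<^sup>2)\<^sup>2 = c * q\<^sup>2" for c
      by (simp_all add: q_def power_divide)
    have dz: "((\<lambda>y. y - x) has_derivative (\<lambda>h. h)) (at y within ?S)"
      by (auto intro!: derivative_eq_intros)
    have dp': "((\<lambda>y. Dv (inv_pt x t y)) has_derivative W) (at y within ?S)"
      using dp[OF y] by (simp add: W_def[abs_def])
    note d1 = has_derivative_scaleR[OF has_derivative_mult_right[OF dV[OF y], of "2 / t"] dz]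
    note d4 = has_derivative_scaleR[OF has_derivative_mult[OF has_derivative_inner[OF dz dp'] di[OF y, of 2]] dz]
    have id: "inv_D x t v Dv = (\<lambda>y. (2 / t * v (inv_pt x t y)) *\<^sub>R (y - x) +
        (Dv (inv_pt x t y) - (((y - x) \<bullet> Dv (inv_pt x t y)) * (2 / (norm (y - x))\<^sup>2)) *\<^sub>R (y - x)))"
      by (simp add: inv_D_def hrefl_mult fun_eq_iff mult_ac)
    show ?thesis unfolding id
    proof (rule has_derivative_eq_rhs[OF has_derivative_add[OF d1 has_derivative_diff[OF dp' d4]]], rule ext)
      fix h
      have "inv_D2 x t v Dv D2v y *v h = (2 * V / t - 2 * (z \<bullet> p) * q) *\<^sub>R h
          + (t * q) *\<^sub>R (hrefl z *v (D2v (inv_pt x t y) *v (hrefl z *v h)))"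
        unfolding inv_D2_def V_def[symmetric] p_def[symmetric] z_def[symmetric] qq transpose_hrefl
        by (simp add: matrix_vector_mult_add_rdistrib matrix_vector_mul_assoc matrix_mul_assoc flip: scaleR_matrix_vector_assoc)
      also have "(t * q) *\<^sub>R (hrefl z *v (D2v (inv_pt x t y) *v (hrefl z *v h))) = hrefl z *v W h"
        by (simp add: W_def z_def[symmetric] qq matrix_vector_mult_scaleR)
      also have "\<dots> = W h - (2 * (z \<bullet> W h) * q) *\<^sub>R z" by (simp add: hrefl_mult qq)
      finally have R: "inv_D2 x t v Dv D2v y *v h
        = (2 * V / t - 2 * (z \<bullet> p) * q) *\<^sub>R h + (W h - (2 * (z \<bullet> W h) * q) *\<^sub>R z)" .
      have c: "2 / t * (p \<bullet> ((t * q) *\<^sub>R (h - (2 * (z \<bullet> h) * q) *\<^sub>R z)))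
        = 2 * q * (h \<bullet> p) - 4 * q\<^sup>2 * (z \<bullet> h) * (z \<bullet> p)"
        using t by (simp add: inner_diff_right inner_commute power2_eq_square field_simps)
      show "(2 / t * v (inv_pt x t y)) *\<^sub>R h +
          (2 / t * (Dv (inv_pt x t y) \<bullet> ((t / (norm (y - x))\<^sup>2) *\<^sub>R (hrefl (y - x) *v h)))) *\<^sub>R (y - x) +
          (W h - ((((y - x) \<bullet> Dv (inv_pt x t y)) * (2 / (norm (y - x))\<^sup>2)) *\<^sub>R h +
            (((y - x) \<bullet> Dv (inv_pt x t y)) * (- (2 * 2 * ((y - x) \<bullet> h)) / ((norm (y - x))\<^sup>2)\<^sup>2) +
             ((y - x) \<bullet> W h + h \<bullet> Dv (inv_pt x t y)) * (2 / (norm (y - x))\<^sup>2)) *\<^sub>R (y - x))) = inv_D2 x t v Dv D2v y *v h"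
        unfolding R V_def[symmetric] p_def[symmetric] z_def[symmetric] hrefl_mult qq c
        by (simp add: scaleR_add_left scaleR_diff_left algebra_simps)
    qed
  qed
  have cI: "continuous_on ?S (inv_pt x t)"
    by (rule has_derivative_continuous_on[OF dI])
  note cc = C2_with_continuous[OF C]
  have cr: "continuous_on ?S (\<lambda>y. hrefl (y - x))"
    unfolding hrefl_def by (intro continuous_intros) auto
  have cmm: "continuous_on ?S (\<lambda>y. A y ** B y)" if "continuous_on ?S A" "continuous_on ?S B" for A B :: "real^'n \<Rightarrow> real^'n^'n"
    unfolding matrix_matrix_mult_def using that by (intro continuous_intros)
  have 3: "continuous_on ?S (inv_D2 x t v Dv D2v)"
    unfolding inv_D2_def transpose_hrefl
    by (intro continuous_intros cmm cr continuous_on_compose2[OF cc(1) cI im] continuous_on_compose2[OF cc(2) cI im] continuous_on_compose2[OF cc(3) cI im])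
       (use t in auto)
  show ?thesis unfolding C2_with_def using 1 2 3 by blast
qed

text \<open>With the centre on the hyperplane, the inversion maps the half-space to itself, and at
  boundary points its reflection is tangential, so it preserves the normal derivative and the
  symmetric functions of the tangential block.\<close>

lemma solution_on_inversion:
  fixes x :: "real^'n"
  assumes s: "solution_on e k c0 (closed_half_space e) v Dv D2v" and x: "x $ e = 0" and t: "t > 0"
  shows "solution_on e k c0 (closed_half_space e - {x}) (inv_v x t v) (inv_D x t v Dv) (inv_D2 x t v Dv D2v)"
  unfolding solution_on_def
proof (intro conjI ballI impI)
  show "C2_with (closed_half_space e - {x}) (inv_v x t v) (inv_D x t v Dv) (inv_D2 x t v Dv D2v)"
    by (rule C2_inversion[OF _ x t]) (use s in \<open>simp add: solution_on_def\<close>)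
  fix y assume y: "y \<in> closed_half_space e - {x}"
  let ?Y = "inv_pt x t y"
  have yx: "y \<noteq> x" and z0: "y - x \<noteq> 0" and yH: "?Y \<in> closed_half_space e"
    using y inv_pt_half_space[OF x t] by auto
  note sY = s[unfolded solution_on_def, THEN conjunct2, rule_format, OF yH]
  show "inv_v x t v y > 0" using sY t z0 by (simp add: inv_v_def)
  show "garding_cone k (schouten_v (inv_v x t v y) (inv_D x t v Dv y) (inv_D2 x t v Dv D2v y))"
    unfolding schouten_v_inversion[OF yx t] using sY by (intro garding_cone_hrefl z0) auto
  show "sigma k (schouten_v (inv_v x t v y) (inv_D x t v Dv y) (inv_D2 x t v Dv D2v y)) = 2 ^ k * real (CARD('n) choose k)"
    unfolding schouten_v_inversion[OF yx t] sigma_orthogonal_conj[OF orthogonal_hrefl[OF z0]] using sY by blast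
  assume ye: "y $ e = 0"
  then have ze: "(y - x) $ e = 0" using x by simp
  have "inv_D x t v Dv y $ e = Dv ?Y $ e" using ze by (simp add: inv_D_def hrefl_mult)
  moreover have "?Y $ e = 0" using ye x by (simp add: inv_pt_def)
  ultimately show "boundary_op e k (inv_D x t v Dv y $ e) (schouten_v (inv_v x t v y) (inv_D x t v Dv y) (inv_D2 x t v Dv D2v y)) = c0"
    unfolding schouten_v_inversion[OF yx t] boundary_op_hrefl[OF z0 ze] using sY by simp
qed

section \<open>Moving spheres\<close>

text \<open>\<open>asym\<close> is the first-order Taylor expansion at 0 of the conformal factor of
  the extended Kelvin transform, read at infinity; \<open>al\<close> and \<open>cc\<close> are the
  value and the gradient there, see \<open>conformal_expansion\<close>.\<close>

locale half_space_solution =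
  fixes e :: "'n::finite" and k :: nat and c0 :: real and v :: "real^'n \<Rightarrow> real"
    and Dv :: "real^'n \<Rightarrow> real^'n" and D2v :: "real^'n \<Rightarrow> real^'n^'n"
    and al :: real and cc :: "real^'n"
  assumes n2: "CARD('n) \<ge> 2" and k: "1 \<le> k" "k \<le> CARD('n)" and c0: "c0 > 0"
    and sol: "solution_on e k c0 (closed_half_space e) v Dv D2v"
    and al: "al > 0"
    and asym: "\<And>ep. ep > 0 \<Longrightarrow> \<exists>B. \<forall>y\<in>closed_half_space e. norm y \<ge> B \<longrightarrow>
       \<bar>v y - al * (norm y)\<^sup>2 - cc \<bullet> y\<bar> \<le> ep * norm y"
begin

abbreviation "H \<equiv> closed_half_space e"

lemma C2: "C2_with H v Dv D2v" and vpos: "y \<in> H \<Longrightarrow> v y > 0"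
  using sol by (auto simp: solution_on_def)

lemmas cont = C2_with_continuous[OF C2]

lemma ray_in_H: "x $ e = 0 \<Longrightarrow> th $ e \<ge> 0 \<Longrightarrow> r \<ge> 0 \<Longrightarrow> x + r *\<^sub>R th \<in> H"
  by (simp add: closed_half_space_def)

text \<open>Recentring at \<open>x\<close> changes the linear coefficient by
  \<open>2 * al * x\<close>; the constant that also appears is absorbed into the error by taking
  \<open>norm z\<close> at least \<open>2 * K / ep\<close>.\<close>

lemma asym_at:
  assumes "ep > 0"
  shows "\<exists>B>0. \<forall>z. x + z \<in> H \<longrightarrow> norm z \<ge> B \<longrightarrow>
     \<bar>v (x + z) - al * (norm z)\<^sup>2 - ((2 * al) *\<^sub>R x + cc) \<bullet> z\<bar> \<le> ep * norm z"
proof -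
  obtain B0 where B0: "\<And>y. y \<in> H \<Longrightarrow> norm y \<ge> B0 \<Longrightarrow> \<bar>v y - al * (norm y)\<^sup>2 - cc \<bullet> y\<bar> \<le> ep / 4 * norm y"
    using asym[of "ep / 4"] assms by auto
  define K where "K = \<bar>al * (norm x)\<^sup>2 + cc \<bullet> x\<bar>"
  define B where "B = norm x + \<bar>B0\<bar> + 2 * K / ep + 1"
  have B: "B > 0" "norm x \<le> B" "B0 + norm x \<le> B" "2 * K / ep \<le> B"
  proof -
    have "0 \<le> 2 * K / ep" using assms by (simp add: K_def)
    then show "B > 0" "norm x \<le> B" "B0 + norm x \<le> B" "2 * K / ep \<le> B"
      unfolding B_def using norm_ge_zero[of x] by linarith+
  qed
  show ?thesis
  proof (intro exI[of _ B] conjI allI impI B(1))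
    fix z assume z: "x + z \<in> H" "B \<le> norm z"
    have n: "norm z - norm x \<le> norm (x + z)" "norm (x + z) \<le> norm x + norm z"
      using norm_triangle_ineq[of x z] norm_diff_ineq[of z x] by (auto simp: add.commute)
    have "\<bar>v (x + z) - al * (norm (x + z))\<^sup>2 - cc \<bullet> (x + z)\<bar> \<le> ep / 4 * norm (x + z)"
      using B0[OF z(1)] n z B by auto
    also have "\<dots> \<le> ep / 4 * (2 * norm z)" using n z B assms by (intro mult_left_mono) auto
    finally have 1: "\<bar>v (x + z) - al * (norm (x + z))\<^sup>2 - cc \<bullet> (x + z)\<bar> \<le> ep / 2 * norm z" by simp
    have 2: "al * (norm (x + z))\<^sup>2 + cc \<bullet> (x + z) = al * (norm z)\<^sup>2 + ((2 * al) *\<^sub>R x + cc) \<bullet> z + (al * (norm x)\<^sup>2 + cc \<bullet> x)"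
      unfolding power2_norm_eq_inner by (simp add: inner_add_left inner_add_right inner_commute algebra_simps)
    have "2 * K / ep \<le> norm z" using B z by simp
    then have "K \<le> ep / 2 * norm z" using assms by (simp add: field_simps)
    then show "\<bar>v (x + z) - al * (norm z)\<^sup>2 - ((2 * al) *\<^sub>R x + cc) \<bullet> z\<bar> \<le> ep * norm z"
      using 1 2 unfolding K_def by linarith
  qed
qed

lemma asym_ray:
  obtains B C where "B > 0" "C > 0"
    "\<And>th s. norm th = 1 \<Longrightarrow> x + s *\<^sub>R th \<in> H \<Longrightarrow> s \<ge> B \<Longrightarrow> \<bar>v (x + s *\<^sub>R th) - al * s\<^sup>2\<bar> \<le> C * s"
proof -
  obtain B where B: "B > 0" "\<And>z. x + z \<in> H \<Longrightarrow> norm z \<ge> B \<Longrightarrow>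
     \<bar>v (x + z) - al * (norm z)\<^sup>2 - ((2 * al) *\<^sub>R x + cc) \<bullet> z\<bar> \<le> 1 * norm z"
    using asym_at[of 1 x] by auto
  let ?b = "(2 * al) *\<^sub>R x + cc"
  show thesis
  proof (rule that[of B "norm ?b + 1"])
    fix th :: "real^'n" and s assume a: "norm th = 1" "x + s *\<^sub>R th \<in> H" "s \<ge> B"
    have s: "s > 0" using a B by simp
    have "\<bar>?b \<bullet> (s *\<^sub>R th)\<bar> \<le> norm ?b * s" using Cauchy_Schwarz_ineq2[of ?b "s *\<^sub>R th"] a s by simp
    moreover have "\<bar>v (x + s *\<^sub>R th) - al * (norm (s *\<^sub>R th))\<^sup>2 - ?b \<bullet> (s *\<^sub>R th)\<bar> \<le> 1 * norm (s *\<^sub>R th)"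
      by (rule B(2)) (use a s in auto)
    ultimately show "\<bar>v (x + s *\<^sub>R th) - al * s\<^sup>2\<bar> \<le> (norm ?b + 1) * s"
      using a s by (simp add: distrib_right)
  qed (use B in \<open>auto simp: add_nonneg_pos\<close>)
qed

lemma deriv_ray_quot:
  assumes "x $ e = 0" "th $ e \<ge> 0" "r > 0"
  shows "((\<lambda>r. v (x + r *\<^sub>R th) / r) has_real_derivative
     (r * (Dv (x + r *\<^sub>R th) \<bullet> th) - v (x + r *\<^sub>R th)) / r\<^sup>2) (at r)"
proof -
  have "((\<lambda>r. v (x + r *\<^sub>R th)) has_real_derivative Dv (x + r *\<^sub>R th) \<bullet> th) (at r within {0<..})"
    by (rule C2_line(1)[OF C2]) (use assms ray_in_H in auto)
  then have "((\<lambda>r. v (x + r *\<^sub>R th)) has_real_derivative Dv (x + r *\<^sub>R th) \<bullet> th) (at r)"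
    using assms(3) by (simp add: at_within_open[of r "{0<..}"])
  from DERIV_divide[OF this DERIV_ident] assms(3) show ?thesis
    by (simp add: power2_eq_square mult.commute)
qed

text \<open>The moving sphere inequality, for all radii below \<open>sqrt t\<close> at once: on each ray from \<open>x\<close> it compares
  \<open>v (x + r th) / r\<close> at two points exchanged by an inversion.\<close>

definition reflect_le :: "real^'n \<Rightarrow> real \<Rightarrow> bool" where
  "reflect_le x t \<longleftrightarrow> (\<forall>th r s. norm th = 1 \<longrightarrow> th $ e \<ge> 0 \<longrightarrow> 0 < r \<longrightarrow> r \<le> s \<longrightarrow> r * s < t \<longrightarrow>
     r * v (x + s *\<^sub>R th) \<le> s * v (x + r *\<^sub>R th))"

text \<open>Near \<open>x\<close> the quotient \<open>v / r\<close> decreases along rays, since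
  \<open>v\<close> is bounded below and its gradient is bounded. A distant \<open>s\<close> is
  handled by \<open>v <= C3 * s^2\<close> and the smallness of \<open>r * s\<close>.\<close>

lemma reflect_le_start:
  assumes x: "x $ e = 0"
  shows "\<exists>t>0. reflect_le x t"
proof -
  obtain B C where BC: "B > 0" "C > 0"
    "\<And>th s. norm th = 1 \<Longrightarrow> x + s *\<^sub>R th \<in> H \<Longrightarrow> s \<ge> B \<Longrightarrow> \<bar>v (x + s *\<^sub>R th) - al * s\<^sup>2\<bar> \<le> C * s"
    using asym_ray by blast
  define R where "R = B + 1"
  let ?K = "cball x R \<inter> H"
  have cK: "compact ?K" by (intro compact_Int_closed compact_cball closed_half_space_closed)
  have "x \<in> ?K" using x BC by (simp add: R_def closed_half_space_def)
  then have K0: "?K \<noteq> {}" by blast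
  note cKv = continuous_on_subset[OF cont(1), of ?K, simplified] continuous_on_subset[OF cont(2), of ?K, simplified]
  obtain y1 where "y1 \<in> ?K" "\<And>y. y \<in> ?K \<Longrightarrow> v y1 \<le> v y"
    using continuous_attains_inf[OF cK K0 cKv(1)] by blast
  then obtain m where m: "m > 0" "\<And>y. y \<in> ?K \<Longrightarrow> m \<le> v y" using vpos by blast
  obtain M where M: "M > 0" "\<And>y. y \<in> ?K \<Longrightarrow> norm (Dv y) \<le> M"
    using compact_imp_bounded[OF compact_continuous_image[OF cKv(2) cK]] unfolding bounded_pos by auto
  obtain M1 where M1: "M1 > 0" "\<And>y. y \<in> ?K \<Longrightarrow> \<bar>v y\<bar> \<le> M1"
    using compact_imp_bounded[OF compact_continuous_image[OF cKv(1) cK]] unfolding bounded_pos by auto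
  have inK: "x + r *\<^sub>R th \<in> ?K" if "norm th = 1" "th $ e \<ge> 0" "0 \<le> r" "r \<le> R" for th r
    using that ray_in_H[OF x] by (simp add: dist_norm)
  \<comment> \<open>For radii up to \<open>m / M\<close> the numerator \<open>r * Dv - v\<close> of
    the derivative of \<open>v / r\<close> is nonpositive.\<close>
  define r0 where "r0 = min 1 (m / M)"
  have r0: "r0 > 0" "r0 \<le> 1" "r0 * M \<le> m" using m M by (auto simp: r0_def min_def field_simps)
  have R1: "r0 \<le> R" "1 \<le> R" using r0 BC by (auto simp: R_def)
  have dec: "v (x + s *\<^sub>R th) / s \<le> v (x + r *\<^sub>R th) / r" if th: "norm th = 1" "th $ e \<ge> 0" and r: "0 < r" "r \<le> s" "s \<le> r0" for th r s
  proof (rule DERIV_nonpos_imp_nonincreasing[OF r(2)])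
    fix u assume u: "r \<le> u" "u \<le> s"
    have inu: "x + u *\<^sub>R th \<in> ?K" by (rule inK) (use th r u R1 in auto)
    have "Dv (x + u *\<^sub>R th) \<bullet> th \<le> norm (Dv (x + u *\<^sub>R th)) * norm th" by (rule norm_cauchy_schwarz)
    also have "\<dots> \<le> M" using M(2)[OF inu] th by simp
    finally have "u * (Dv (x + u *\<^sub>R th) \<bullet> th) \<le> u * M" using u r by (intro mult_left_mono) auto
    also have "\<dots> \<le> r0 * M" using u r M(1) by (intro mult_right_mono) auto
    also have "\<dots> \<le> v (x + u *\<^sub>R th)" using r0(3) m(2)[OF inu] by linarith
    finally have "(u * (Dv (x + u *\<^sub>R th) \<bullet> th) - v (x + u *\<^sub>R th)) / u\<^sup>2 \<le> 0" by (simp add: divide_nonpos_nonneg)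
    then show "\<exists>y. ((\<lambda>r. v (x + r *\<^sub>R th) / r) has_real_derivative y) (at u) \<and> y \<le> 0"
      using deriv_ray_quot[OF x th(2), of u] u r by auto
  qed
  \<comment> \<open>The first two summands control \<open>v / s^2\<close> for \<open>s >= B\<close>,
    the last one on the compact range from \<open>r0\<close> to \<open>B\<close>.\<close>
  define C3 where "C3 = al + C / r0 + M1 / r0\<^sup>2"
  have C3: "C3 > 0" using al BC M1 r0 by (simp add: C3_def add_pos_pos)
  have up: "v (x + s *\<^sub>R th) \<le> C3 * s\<^sup>2" if th: "norm th = 1" "th $ e \<ge> 0" and s: "r0 \<le> s" for th s
  proof (cases "s \<ge> B")
    case True
    have s0: "s > 0" using s r0 by simp
    have "v (x + s *\<^sub>R th) \<le> al * s\<^sup>2 + C * s"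
      using BC(3)[OF th(1) ray_in_H[OF x th(2)] True] s0 by simp
    also have "C * s \<le> C / r0 * s\<^sup>2"
      using s s0 r0 BC by (simp add: field_simps power2_eq_square)
    also have "al * s\<^sup>2 + C / r0 * s\<^sup>2 \<le> C3 * s\<^sup>2" using M1 by (simp add: C3_def distrib_right)
    finally show ?thesis by simp
  next
    case False
    have "v (x + s *\<^sub>R th) \<le> M1" using M1(2)[OF inK[OF th, of s]] False s r0(1) by (simp add: R_def)
    also have "\<dots> \<le> M1 / r0\<^sup>2 * s\<^sup>2"
      using power_mono[OF s, of 2] r0 M1 by (simp add: field_simps)
    also have "\<dots> \<le> C3 * s\<^sup>2" using al BC r0 by (intro mult_right_mono) (auto simp: C3_def)
    finally show ?thesis .
  qed
  define t where "t = min r0 (m / C3)"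
  have t: "t > 0" "t \<le> r0" "t * C3 \<le> m" using r0 m C3 by (auto simp: t_def min_def field_simps)
  have "reflect_le x t"
    unfolding reflect_le_def
  proof (intro allI impI)
    fix th :: "real^'n" and r s :: real assume a: "norm th = 1" "0 \<le> th $ e" "0 < r" "r \<le> s" "r * s < t"
    show "r * v (x + s *\<^sub>R th) \<le> s * v (x + r *\<^sub>R th)"
    proof (cases "s \<le> r0")
      case True
      then show ?thesis using dec[OF a(1,2,3,4) True] a by (simp add: field_simps)
    next
      case False
      have s0: "s > 0" using a by simp
      have "r * r0 \<le> r * s" using a False by simp
      then have "r * r0 \<le> 1 * r0" using a t by linarith
      then have r1: "r \<le> 1" using r0 by simp
      have "r * v (x + s *\<^sub>R th) \<le> r * (C3 * s\<^sup>2)" using up[OF a(1,2)] False a by (intro mult_left_mono) auto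
      also have "\<dots> = (r * s) * C3 * s" by (simp add: power2_eq_square)
      also have "\<dots> \<le> t * C3 * s" using a C3 s0 by (intro mult_right_mono) auto
      also have "\<dots> \<le> m * s" using t s0 by (intro mult_right_mono) auto
      also have "\<dots> \<le> v (x + r *\<^sub>R th) * s" using m(2)[OF inK[OF a(1,2)], of r] a r1 R1 s0 by (intro mult_right_mono) auto
      finally show ?thesis by (simp add: mult.commute)
    qed
  qed
  then show ?thesis using t by blast
qed

lemma v_ray_lim:
  assumes x: "x $ e = 0" and th: "\<And>n. norm (th n) = 1" "\<And>n. th n $ e \<ge> 0"
    and r: "\<And>n. r n > 0" "r \<longlonglongrightarrow> 0"
  shows "(\<lambda>n. v (x + r n *\<^sub>R th n)) \<longlonglongrightarrow> v x"
proof -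
  have "(\<lambda>n. norm (r n *\<^sub>R th n)) \<longlonglongrightarrow> 0" using r th by (simp add: tendsto_rabs_zero)
  then have "(\<lambda>n. r n *\<^sub>R th n) \<longlonglongrightarrow> 0" by (rule tendsto_norm_zero_cancel)
  then have "(\<lambda>n. x + r n *\<^sub>R th n) \<longlonglongrightarrow> x + 0" by (intro tendsto_intros)
  moreover have "x + r n *\<^sub>R th n \<in> H" for n using ray_in_H[OF x th(2)] r(1)[of n] by simp
  moreover have "x \<in> H" using x by (simp add: closed_half_space_def)
  ultimately show ?thesis using cont(1) unfolding continuous_on_sequentially comp_def by simp
qed

text \<open>The directions may vary with \<open>n\<close>, as in the contradiction sequence of
  \<open>reflect_le_max\<close>; the bound of \<open>asym_ray\<close> is uniform in the
  direction.\<close>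

lemma v_inf_lim:
  assumes x: "x $ e = 0" and th: "\<And>n. norm (th n) = 1" "\<And>n. th n $ e \<ge> 0"
    and s: "\<And>n. s n > 0" "(\<lambda>n. 1 / s n) \<longlonglongrightarrow> 0"
  shows "(\<lambda>n. v (x + s n *\<^sub>R th n) / (s n)\<^sup>2) \<longlonglongrightarrow> al"
proof -
  obtain B C where BC: "B > 0" "C > 0"
    "\<And>th s. norm th = 1 \<Longrightarrow> x + s *\<^sub>R th \<in> H \<Longrightarrow> s \<ge> B \<Longrightarrow> \<bar>v (x + s *\<^sub>R th) - al * s\<^sup>2\<bar> \<le> C * s"
    using asym_ray by blast
  have "eventually (\<lambda>n. 1 / s n < 1 / B) sequentially"
    using s(2) BC(1) by (intro order_tendstoD) auto
  then have ev: "eventually (\<lambda>n. norm (v (x + s n *\<^sub>R th n) / (s n)\<^sup>2 - al) \<le> C * (1 / s n)) sequentially"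
  proof eventually_elim
    case (elim n)
    have "s n \<ge> B" using elim s(1)[of n] BC(1) by (simp add: field_simps)
    then have "\<bar>v (x + s n *\<^sub>R th n) - al * (s n)\<^sup>2\<bar> \<le> C * s n"
      using BC(3)[OF th(1) ray_in_H[OF x th(2)]] s(1)[of n] by simp
    then have "\<bar>v (x + s n *\<^sub>R th n) - al * (s n)\<^sup>2\<bar> / (s n)\<^sup>2 \<le> C * s n / (s n)\<^sup>2"
      by (intro divide_right_mono) auto
    moreover have "\<bar>v (x + s n *\<^sub>R th n) - al * (s n)\<^sup>2\<bar> / (s n)\<^sup>2 = \<bar>v (x + s n *\<^sub>R th n) / (s n)\<^sup>2 - al\<bar>"
    proof -
      have "v (x + s n *\<^sub>R th n) / (s n)\<^sup>2 - al = (v (x + s n *\<^sub>R th n) - al * (s n)\<^sup>2) / (s n)\<^sup>2"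
        using s(1)[of n] by (simp add: diff_divide_distrib)
      then show ?thesis by (simp add: abs_divide)
    qed
    ultimately show ?case using s(1)[of n] by (simp add: power2_eq_square)
  qed
  have "(\<lambda>n. v (x + s n *\<^sub>R th n) / (s n)\<^sup>2 - al) \<longlonglongrightarrow> 0"
    by (rule Lim_null_comparison[OF ev]) (use tendsto_mult_right_zero[OF s(2), of C] in simp)
  then show ?thesis by (simp add: LIM_zero_iff)
qed

text \<open>With \<open>r * s = t'\<close>, the inequality reads
  \<open>t' * v (x + s th) / s^2 <= v (x + r th)\<close>; its two sides tend to
  \<open>t' * al\<close> and \<open>v x\<close> as \<open>r\<close> tends to 0.\<close>

lemma reflect_le_imp_bound:
  assumes x: "x $ e = 0" and Q: "reflect_le x t" and t: "t > 0"
  shows "al * t \<le> v x"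
proof -
  have *: "al * t' \<le> v x" if t': "0 < t'" "t' < t" for t'
  proof -
    define r where "r n = sqrt t' / real (Suc n)" for n
    define s where "s n = t' / r n" for n
    have r: "r n > 0" for n using t' by (simp add: r_def)
    have rl: "r \<longlonglongrightarrow> 0"
      unfolding r_def using tendsto_mult_right_zero[OF LIMSEQ_inverse_real_of_nat, of "sqrt t'"] by (simp add: divide_inverse)
    have s: "s n > 0" for n using r t' by (simp add: s_def)
    have sl: "(\<lambda>n. 1 / s n) \<longlonglongrightarrow> 0"
      unfolding s_def using tendsto_mult_right_zero[OF rl, of "1/t'"] by simp
    have rs: "r n * s n = t'" for n using r[of n] by (simp add: s_def)
    have "r n \<le> s n" for n
    proof -
      have "r n \<le> sqrt t'" using t' by (simp add: r_def divide_le_eq)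
      then have "(r n)\<^sup>2 \<le> t'" using power_mono[of "r n" "sqrt t'" 2] r[of n] t' by simp
      then show ?thesis using r[of n] by (simp add: s_def power2_eq_square le_divide_eq)
    qed
    then have q: "r n * v (x + s n *\<^sub>R axis e 1) \<le> s n * v (x + r n *\<^sub>R axis e 1)" for n
      using Q[unfolded reflect_le_def, rule_format, of "axis e 1" "r n" "s n"] r rs t' by simp
    have "t' * (v (x + s n *\<^sub>R axis e 1) / (s n)\<^sup>2) \<le> v (x + r n *\<^sub>R axis e 1)" for n
      using q[of n] s[of n] unfolding rs[of n, symmetric] by (simp add: field_simps power2_eq_square)
    moreover have "(\<lambda>n. t' * (v (x + s n *\<^sub>R axis e 1) / (s n)\<^sup>2)) \<longlonglongrightarrow> t' * al"
      by (intro tendsto_intros v_inf_lim[OF x]) (use s sl in auto)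
    moreover have "(\<lambda>n. v (x + r n *\<^sub>R axis e 1)) \<longlonglongrightarrow> v x"
      by (rule v_ray_lim[OF x]) (use r rl in auto)
    ultimately have "t' * al \<le> v x" using LIMSEQ_le by blast
    then show ?thesis by (simp add: mult.commute)
  qed
  show ?thesis
  proof (rule field_le_mult_one_interval)
    fix z :: real assume "0 < z" "z < 1"
    then show "z * (al * t) \<le> v x" using *[of "z * t"] t by (simp add: mult_ac)
  qed
qed

lemma reflect_le_closed:
  assumes x: "x $ e = 0" and Q: "reflect_le x t" and th: "norm th = 1" "th $ e \<ge> 0" and r: "0 < r" "r \<le> s" "r * s \<le> t"
  shows "r * v (x + s *\<^sub>R th) \<le> s * v (x + r *\<^sub>R th)"
proof -
  \<comment> \<open>Radii increasing to \<open>r\<close> with \<open>q n * s < t\<close>. The double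
    successor keeps the factor positive already at \<open>n = 0\<close>.\<close>
  define q where "q n = r * (1 - inverse (real (Suc (Suc n))))" for n
  have lim: "q \<longlonglongrightarrow> r * (1 - 0)"
    unfolding q_def by (intro tendsto_intros LIMSEQ_Suc[OF LIMSEQ_inverse_real_of_nat])
  have q: "0 < q n" "q n < r" for n
    using r by (auto simp: q_def inverse_less_1_iff)
  have le: "q n * v (x + s *\<^sub>R th) \<le> s * v (x + q n *\<^sub>R th)" for n
  proof -
    have "q n * s < r * s" using q[of n] r by simp
    then have "q n * s < t" using r by linarith
    then show ?thesis using Q[unfolded reflect_le_def, rule_format, OF th q(1)[of n], of s] q[of n] r by simp
  qed
  have "(\<lambda>n. x + q n *\<^sub>R th) \<longlonglongrightarrow> x + r *\<^sub>R th" using lim by (intro tendsto_intros) simp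
  moreover have "x + q n *\<^sub>R th \<in> H" "x + r *\<^sub>R th \<in> H" for n using ray_in_H[OF x th(2)] q[of n] r by simp_all
  ultimately have "(\<lambda>n. v (x + q n *\<^sub>R th)) \<longlonglongrightarrow> v (x + r *\<^sub>R th)"
    using cont(1) unfolding continuous_on_sequentially comp_def by simp
  then have "(\<lambda>n. s * v (x + q n *\<^sub>R th)) \<longlonglongrightarrow> s * v (x + r *\<^sub>R th)" by (intro tendsto_intros)
  moreover have "(\<lambda>n. q n * v (x + s *\<^sub>R th)) \<longlonglongrightarrow> r * v (x + s *\<^sub>R th)"
    using lim by (intro tendsto_intros) simp
  ultimately show ?thesis using LIMSEQ_le le by blast
qed

lemma inv_v_ray:
  assumes "norm th = 1" "r > 0"
  shows "inv_v x t v (x + r *\<^sub>R th) = r\<^sup>2 / t * v (x + (t / r) *\<^sub>R th)"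
proof -
  have "t / (norm (r *\<^sub>R th))\<^sup>2 * r = t / r" using assms by (simp add: power2_eq_square)
  then show ?thesis using assms by (simp add: inv_v_def inv_pt_def)
qed

lemma polar:
  assumes "y \<noteq> x" "x $ e = 0" "y \<in> H"
  obtains th r where "norm th = 1" "th $ e \<ge> 0" "r > 0" "y = x + r *\<^sub>R th" "r = norm (y - x)"
proof (rule that)
  show "norm ((y - x) /\<^sub>R norm (y - x)) = 1" "norm (y - x) > 0" "y = x + norm (y - x) *\<^sub>R ((y - x) /\<^sub>R norm (y - x))"
    using assms(1) by auto
  show "((y - x) /\<^sub>R norm (y - x)) $ e \<ge> 0" using assms by (simp add: closed_half_space_def)
qed (rule refl)

text \<open>The choice \<open>s = t / r\<close> turns the inequality on rays into a comparison of
  \<open>v\<close> with its inversion, the form used by the maximum principles.\<close>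

lemma inv_le:
  assumes x: "x $ e = 0" and Q: "reflect_le x t" and t: "t > 0" and y: "y \<in> H" "y \<noteq> x" "norm (y - x) \<le> sqrt t"
  shows "inv_v x t v y \<le> v y"
proof -
  obtain th r where th: "norm th = 1" "th $ e \<ge> 0" "r > 0" "y = x + r *\<^sub>R th" "r = norm (y - x)"
    using polar[OF y(2) x y(1)] by blast
  have "r\<^sup>2 \<le> t" using power_mono[of r "sqrt t" 2] th(3,5) y(3) t by simp
  then have "r \<le> t / r" using th(3) by (simp add: le_divide_eq power2_eq_square)
  then have "r * v (x + (t / r) *\<^sub>R th) \<le> t / r * v (x + r *\<^sub>R th)"
    using reflect_le_closed[OF x Q th(1,2,3), of "t / r"] th(3) by simp
  then have "r\<^sup>2 / t * v (x + (t / r) *\<^sub>R th) \<le> v (x + r *\<^sub>R th)"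
    using th(3) t by (simp add: field_simps power2_eq_square)
  then show ?thesis unfolding th(4) inv_v_ray[OF th(1,3)] .
qed

end

section \<open>Strict comparison inside the sphere and the maximal radius\<close>

context half_space_solution
begin

lemma v_cont_seq:
  assumes "\<And>n. y n \<in> H" "z \<in> H" "y \<longlonglongrightarrow> z"
  shows "(\<lambda>n. v (y n)) \<longlonglongrightarrow> v z" "(\<lambda>n. Dv (y n)) \<longlonglongrightarrow> Dv z"
  using cont assms unfolding continuous_on_sequentially comp_def by auto

definition half_ball :: "real^'n \<Rightarrow> real \<Rightarrow> (real^'n) set" where
  "half_ball x t = {y. y $ e > 0 \<and> norm (y - x) < sqrt t}"

lemma half_ball_props: "open (half_ball x t)" "connected (half_ball x t)" "x $ e = 0 \<Longrightarrow> half_ball x t \<subseteq> H - {x}"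
proof -
  have eq: "half_ball x t = {y. y $ e > 0} \<inter> ball x (sqrt t)"
    by (auto simp: half_ball_def dist_norm norm_minus_commute)
  have "open {y :: real^'n. y $ e > 0}" by (rule open_Collect_less) (intro continuous_intros)+
  then show "open (half_ball x t)" unfolding eq by (intro open_Int) auto
  have "{y :: real^'n. y $ e > 0} = {y. axis e 1 \<bullet> y > 0}" by (simp add: inner_axis')
  then have "convex {y :: real^'n. y $ e > 0}" using convex_halfspace_gt[of 0 "axis e 1 :: real^'n"] by simp
  then show "connected (half_ball x t)" unfolding eq by (intro convex_connected convex_Int) auto
  show "x $ e = 0 \<Longrightarrow> half_ball x t \<subseteq> H - {x}" by (auto simp: half_ball_def closed_half_space_def)
qed

lemma sol_S: "solution_on e k c0 (H - {x}) v Dv D2v"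
  by (rule solution_on_subset[OF sol]) auto

text \<open>One contact point in the connected open half ball spreads by
  \<open>interior_strong_max\<close>.\<close>

lemma half_ball_dichotomy:
  assumes x: "x $ e = 0" and t: "t > 0" and Q: "reflect_le x t"
  shows "(\<forall>y\<in>half_ball x t. inv_v x t v y = v y) \<or> (\<forall>y\<in>half_ball x t. inv_v x t v y < v y)"
proof (cases "\<exists>z\<in>half_ball x t. v z = inv_v x t v z")
  case True
  then obtain z where z: "z \<in> half_ball x t" "v z = inv_v x t v z" by blast
  have le: "inv_v x t v y \<le> v y" if "y \<in> half_ball x t" for y
    by (rule inv_le[OF x Q t]) (use that half_ball_props(3)[OF x] in \<open>auto simp: half_ball_def closed_half_space_def\<close>)
  have "v y = inv_v x t v y" if "y \<in> half_ball x t" for y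
    by (rule interior_strong_max[OF k c0 sol_S solution_on_inversion[OF sol x t] half_ball_props(1,2) half_ball_props(3)[OF x] _ le z that])
       (auto simp: half_ball_def)
  then show ?thesis by simp
next
  case False
  have "inv_v x t v y \<le> v y" if "y \<in> half_ball x t" for y
    by (rule inv_le[OF x Q t]) (use that x in \<open>auto simp: half_ball_def closed_half_space_def\<close>)
  then show ?thesis using False by force
qed

lemma inv_less_on_boundary:
  assumes x: "x $ e = 0" and t: "t > 0" and Q: "reflect_le x t"
    and G: "\<And>y. y \<in> half_ball x t \<Longrightarrow> inv_v x t v y < v y"
    and y: "y $ e = 0" "y \<noteq> x" "norm (y - x) < sqrt t"
  shows "inv_v x t v y < v y"
proof -
  \<comment> \<open>Keeps the ball about \<open>y\<close> away from the centre \<open>x\<close> and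
    inside the sphere.\<close>
  define r where "r = min (norm (y - x)) (sqrt t - norm (y - x)) / 2"
  have r: "r > 0" "r < norm (y - x)" "norm (y - x) + r < sqrt t" using y by (auto simp: r_def min_def field_simps)
  have near: "w \<noteq> x" "norm (w - x) < sqrt t" if w: "w \<in> cball y r" for w
  proof -
    have "norm (w - y) \<le> r" using w by (simp add: dist_norm norm_minus_commute)
    moreover have "norm (w - x) \<le> norm (w - y) + norm (y - x)" using norm_triangle_ineq[of "w - y" "y - x"] by simp
    moreover have "norm (y - x) \<le> norm (w - y) + norm (w - x)"
      using norm_triangle_ineq[of "y - w" "w - x"] by (simp add: norm_minus_commute)
    ultimately show "w \<noteq> x" "norm (w - x) < sqrt t" using r by auto
  qed
  show ?thesis
  proof (rule boundary_strict[OF k c0 sol_S solution_on_inversion[OF sol x t] r(1) _ y(1)])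
    show "cball y r \<inter> H \<subseteq> H - {x}" using near(1)[of x] by auto
    show "inv_v x t v w \<le> v w" if "w \<in> cball y r" "w \<in> H" for w
      using near[OF that(1)] that by (intro inv_le[OF x Q t]) auto
    show "inv_v x t v w < v w" if "w \<in> cball y r" "w $ e > 0" for w
      using near[OF that(1)] that by (intro G) (auto simp: half_ball_def)
  qed
qed

text \<open>On the sphere \<open>v\<close> agrees with its inversion, so the Hopf lemma applies on a
  ball touching the sphere at \<open>y\<close> from inside. Since the inversion turns the radial
  derivative \<open>D\<close> into \<open>2 * v - D\<close>, its conclusion is a bound on the radial
  derivative of \<open>v\<close> itself.\<close>

lemma mirror_radial_deriv_less:
  assumes x: "x $ e = 0" and t: "t > 0" and Q: "reflect_le x t"
    and G: "\<And>y. y \<in> half_ball x t \<Longrightarrow> inv_v x t v y < v y"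
    and y: "y \<in> H" "norm (y - x) = sqrt t"
  shows "Dv y \<bullet> (y - x) < v y"
proof -
  define l where "l = sqrt t"
  have l: "l > 0" "l\<^sup>2 = t" using t by (auto simp: l_def)
  \<comment> \<open>If \<open>y\<close> is a corner, \<open>p\<close> lies on the hyperplane.
    Otherwise \<open>d <= y $ e / (l + y $ e)\<close> is exactly \<open>p $ e >= R\<close>. The
    bound \<open>1/4\<close> keeps the centre \<open>x\<close> outside the ball.\<close>
  define d where "d = (if y $ e = 0 then 1/4 else min (1/4) (y $ e / (l + y $ e)))"
  have ye: "y $ e \<ge> 0" using y by (simp add: closed_half_space_def)
  have d: "0 < d" "d \<le> 1/4" using ye l by (auto simp: d_def add_pos_nonneg min_le_iff_disj simp del: le_divide_eq_numeral1)
  define p where "p = x + (1 - d) *\<^sub>R (y - x)"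
  define R where "R = d * l"
  have R: "R > 0" using d l by (simp add: R_def)
  have px: "norm (p - x) = (1 - d) * l" using d y by (simp add: p_def l_def)
  have yp: "y - p = d *\<^sub>R (y - x)" by (simp add: p_def algebra_simps)
  have near: "w \<noteq> x" "norm (w - x) \<le> (1 - d) * l + norm (w - p)" if w: "norm (w - p) \<le> R" for w
  proof -
    show "norm (w - x) \<le> (1 - d) * l + norm (w - p)"
      using norm_triangle_ineq[of "w - p" "p - x"] px by simp
    have "(1 - d) * l \<le> norm (w - p) + norm (w - x)"
      using norm_triangle_ineq[of "p - w" "w - x"] px by (simp add: norm_minus_commute)
    moreover have "d * l < (1 - d) * l" using d l by (intro mult_strict_right_mono) auto
    ultimately show "w \<noteq> x" using w by (auto simp: R_def)
  qed
  have dl: "(1 - d) * l + R = l" by (simp add: R_def algebra_simps)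
  have hp: "(Dv y - inv_D x t v Dv y) \<bullet> (p - y) > 0"
  proof (rule hopf_lemma[OF k c0 sol_S solution_on_inversion[OF sol x t] R])
    show "cball p R \<inter> H \<subseteq> H - {x}" using near(1)[of x] by (auto simp: dist_norm norm_minus_commute)
    have pe: "p $ e = (1 - d) * y $ e" using x by (simp add: p_def algebra_simps)
    show "p $ e = 0 \<or> R \<le> p $ e"
    proof (cases "y $ e = 0")
      case False
      then have "d \<le> y $ e / (l + y $ e)" by (simp add: d_def)
      then have "d * (l + y $ e) \<le> y $ e" using ye l by (simp add: pos_le_divide_eq add_pos_nonneg)
      then show ?thesis unfolding pe R_def by (simp add: algebra_simps)
    qed (simp add: pe)
    show "inv_v x t v w \<le> v w" if w: "w \<in> cball p R" "w \<in> H" for w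
    proof (rule inv_le[OF x Q t w(2)])
      have wp: "norm (w - p) \<le> R" using w by (simp add: dist_norm norm_minus_commute)
      show "w \<noteq> x" using near(1)[OF wp] .
      show "norm (w - x) \<le> sqrt t" using near(2)[OF wp] wp dl by (simp add: l_def)
    qed
    show "inv_v x t v w < v w" if w: "norm (w - p) = R / 2" "w \<in> H" for w
    proof -
      have wp: "norm (w - p) \<le> R" using w R by simp
      have lt: "norm (w - x) < sqrt t" using near(2)[OF wp] w R dl by (simp add: l_def)
      show ?thesis
      proof (cases "w $ e = 0")
        case True
        then show ?thesis by (intro inv_less_on_boundary[OF x t Q G] near(1)[OF wp] lt)
      next
        case False
        then show ?thesis using w lt by (intro G) (auto simp: half_ball_def closed_half_space_def)
      qed
    qed
    show "norm (y - p) = R" unfolding yp R_def using d y by (simp add: l_def)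
    have n2: "(norm (y - x))\<^sup>2 = t" using y t by simp
    then have "inv_pt x t y = y" using t by (simp add: inv_pt_def)
    then show "v y = inv_v x t v y" using t by (simp add: inv_v_def n2)
  qed (rule y(1))
  have iD: "inv_D x t v Dv y \<bullet> (y - x) = 2 * v y - Dv y \<bullet> (y - x)"
  proof -
    have n2: "(norm (y - x))\<^sup>2 = t" using y t by simp
    then have "inv_pt x t y = y" using t by (simp add: inv_pt_def)
    moreover have "(y - x) \<bullet> (y - x) = t" using y t by (simp add: power2_norm_eq_inner[symmetric])
    ultimately show ?thesis using t y
      by (simp add: inv_D_def hrefl_mult inner_add_left inner_diff_left[of "Dv y"] inner_commute[of "y - x" "Dv y"])
  qed
  have py: "p - y = (- d) *\<^sub>R (y - x)" by (simp add: p_def algebra_simps)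
  have "(Dv y - inv_D x t v Dv y) \<bullet> (p - y) = (- d) * (Dv y \<bullet> (y - x) - inv_D x t v Dv y \<bullet> (y - x))"
    unfolding py inner_scaleR_right inner_diff_left ..
  then have "(- d) * (2 * (Dv y \<bullet> (y - x)) - 2 * v y) > 0" using hp unfolding iD by simp
  then have "2 * (Dv y \<bullet> (y - x)) - 2 * v y < 0" using d by (simp only: zero_less_mult_iff) linarith
  then show ?thesis by simp
qed

text \<open>The limit of \<open>reflect_le_imp_bound\<close>, now with equality along the normal
  ray.\<close>

lemma inversion_symmetric_radius:
  assumes x: "x $ e = 0" and t: "t > 0" and eq: "\<forall>y\<in>half_ball x t. inv_v x t v y = v y"
  shows "al * t = v x"
proof -
  define r where "r n = sqrt t / (real (Suc (Suc n)))" for n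
  define s where "s n = t / r n" for n
  have r: "r n > 0" "r n < sqrt t" for n using t by (auto simp: r_def divide_less_eq)
  have "(\<lambda>n. sqrt t * inverse (real (Suc (Suc n)))) \<longlonglongrightarrow> sqrt t * 0"
    by (intro tendsto_intros LIMSEQ_Suc[OF LIMSEQ_inverse_real_of_nat])
  then have rl: "r \<longlonglongrightarrow> 0" unfolding r_def by (simp add: divide_inverse)
  have s: "s n > 0" for n using r t by (simp add: s_def)
  have sl: "(\<lambda>n. 1 / s n) \<longlonglongrightarrow> 0"
    unfolding s_def using tendsto_mult_right_zero[OF rl, of "1/t"] by simp
  have e: "t * (v (x + s n *\<^sub>R axis e 1) / (s n)\<^sup>2) = v (x + r n *\<^sub>R axis e 1)" for n
  proof -
    have "x + r n *\<^sub>R axis e 1 \<in> half_ball x t" using r[of n] x by (simp add: half_ball_def)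
    then have "(r n)\<^sup>2 / t * v (x + s n *\<^sub>R axis e 1) = v (x + r n *\<^sub>R axis e 1)"
      using eq inv_v_ray[of "axis e 1" "r n" x t] r[of n] by (simp add: s_def)
    moreover have "t / (s n)\<^sup>2 = (r n)\<^sup>2 / t" using t r[of n] by (simp add: s_def power_divide power2_eq_square)
    moreover have "t * (v (x + s n *\<^sub>R axis e 1) / (s n)\<^sup>2) = t / (s n)\<^sup>2 * v (x + s n *\<^sub>R axis e 1)" by simp
    ultimately show ?thesis by (simp only:)
  qed
  have "(\<lambda>n. t * (v (x + s n *\<^sub>R axis e 1) / (s n)\<^sup>2)) \<longlonglongrightarrow> t * al"
    by (intro tendsto_intros v_inf_lim[OF x]) (use s sl in auto)
  moreover have "(\<lambda>n. v (x + r n *\<^sub>R axis e 1)) \<longlonglongrightarrow> v x"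
    by (rule v_ray_lim[OF x]) (use r rl in auto)
  ultimately show ?thesis unfolding e using LIMSEQ_unique by (metis mult.commute)
qed

text \<open>If the supremum \<open>t\<close> of admissible values had \<open>al * t < v x\<close>,
  comparison would be strict in the half ball. Pairs violating the inequality with products
  decreasing to \<open>t\<close> then have a limit, which is excluded at the centre, strictly
  inside, and on the sphere by three different strict inequalities.\<close>

lemma reflect_le_max:
  assumes x: "x $ e = 0"
  shows "reflect_le x (v x / al)"
proof -
  define T where "T = {t. t > 0 \<and> reflect_le x t}"
  obtain t1 where t1: "t1 \<in> T" using reflect_le_start[OF x] by (auto simp: T_def)
  have bdd: "bdd_above T"
    using reflect_le_imp_bound[OF x] al by (intro bdd_aboveI[of _ "v x / al"]) (auto simp: T_def field_simps)
  define t where "t = Sup T"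
  have t: "t > 0" using cSup_upper[OF t1 bdd] t1 by (auto simp: t_def T_def)
  have Qt: "reflect_le x t"
    unfolding reflect_le_def
  proof (intro allI impI)
    fix th :: "real^'n" and r s :: real assume a: "norm th = 1" "0 \<le> th $ e" "0 < r" "r \<le> s" "r * s < t"
    then obtain t' where "t' \<in> T" "r * s < t'" using less_cSupE[of "r * s" T] t1 unfolding t_def by blast
    then show "r * v (x + s *\<^sub>R th) \<le> s * v (x + r *\<^sub>R th)" using a by (auto simp: T_def reflect_le_def)
  qed
  have "al * t = v x"
  proof (rule ccontr)
    assume ne: "al * t \<noteq> v x"
    then have lt: "al * t < v x" using reflect_le_imp_bound[OF x Qt t] by simp
    have G: "inv_v x t v y < v y" if "y \<in> half_ball x t" for y
      using half_ball_dichotomy[OF x t Qt] inversion_symmetric_radius[OF x t] ne that by blast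
    have "\<exists>th r s. norm th = 1 \<and> th $ e \<ge> 0 \<and> 0 < r \<and> r \<le> s \<and> r * s < t + inverse (real (Suc n)) \<and> s * v (x + r *\<^sub>R th) < r * v (x + s *\<^sub>R th)" for n
    proof -
      have "t + inverse (real (Suc n)) \<notin> T"
        using cSup_upper[OF _ bdd, of "t + inverse (real (Suc n))"] unfolding t_def[symmetric] by (auto simp: not_le)
      moreover have "t + inverse (real (Suc n)) > 0" using t by (simp add: add_pos_pos)
      ultimately have "\<not> reflect_le x (t + inverse (real (Suc n)))" by (simp add: T_def)
      then show ?thesis unfolding reflect_le_def by (auto simp: not_le)
    qed
    then obtain th r s where th: "\<And>n. norm (th n) = 1" "\<And>n. th n $ e \<ge> 0"
      and r: "\<And>n. 0 < r n" and rs: "\<And>n. r n \<le> s n" "\<And>n. r n * s n < t + inverse (real (Suc n))"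
      and bad: "\<And>n. s n * v (x + r n *\<^sub>R th n) < r n * v (x + s n *\<^sub>R th n)"
      by metis
    have s: "s n > 0" for n using r[of n] rs(1)[of n] by simp
    have rst: "t < r n * s n" for n
      using reflect_le_closed[OF x Qt th(1,2) r rs(1), of n n] bad[of n] by (meson leI not_le)
    have rne: "r n < s n" for n using bad[of n] rs(1)[of n] by (cases "r n = s n") auto
    have rsl: "(\<lambda>n. r n * s n) \<longlonglongrightarrow> t"
    proof (rule tendsto_sandwich[OF _ _ tendsto_const])
      show "(\<lambda>n. t + inverse (real (Suc n))) \<longlonglongrightarrow> t"
        using tendsto_add[OF tendsto_const[of t] LIMSEQ_inverse_real_of_nat] by simp
      show "\<forall>\<^sub>F n in sequentially. t \<le> r n * s n" using rst by (simp add: less_imp_le)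
      show "\<forall>\<^sub>F n in sequentially. r n * s n \<le> t + inverse (real (Suc n))"
        by (rule always_eventually) (use rs(2) less_imp_le in blast)
    qed
    have r2: "(r n)\<^sup>2 < t + 1" for n
    proof -
      have "(r n)\<^sup>2 \<le> r n * s n" using rs(1)[of n] r[of n] by (simp add: power2_eq_square)
      moreover have "inverse (real (Suc n)) \<le> 1" by (simp add: inverse_le_1_iff)
      ultimately show ?thesis using rs(2)[of n] by linarith
    qed
    have rb: "r n \<in> {0..t + 2}" for n
    proof -
      have "(r n)\<^sup>2 \<le> (t + 2)\<^sup>2" using r2[of n] t by (simp add: power2_eq_square algebra_simps) (smt (verit) mult_pos_pos)
      then show ?thesis using power2_le_imp_le[of "r n" "t + 2"] t r[of n] by simp
    qed
    have "compact (sphere (0::real^'n) 1 \<times> {0..t + 2})" by (intro compact_Times) auto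
    moreover have "(th n, r n) \<in> sphere 0 1 \<times> {0..t + 2}" for n using th rb by auto
    ultimately obtain l f where l: "l \<in> sphere 0 1 \<times> {0..t + 2}" and f: "strict_mono f"
      and lim: "((\<lambda>n. (th n, r n)) \<circ> f) \<longlonglongrightarrow> l"
      unfolding compact_def by (metis (no_types, lifting))
    obtain th0 r0 where l0: "l = (th0, r0)" by (cases l)
    have thl: "(\<lambda>n. th (f n)) \<longlonglongrightarrow> th0" and rl: "(\<lambda>n. r (f n)) \<longlonglongrightarrow> r0"
      using tendsto_fst[OF lim] tendsto_snd[OF lim] by (auto simp: l0 comp_def)
    have th0: "norm th0 = 1" "th0 $ e \<ge> 0"
    proof -
      show "norm th0 = 1" using l by (simp add: l0)
      have "(\<lambda>n. th (f n) $ e) \<longlonglongrightarrow> th0 $ e" using thl by (intro tendsto_intros)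
      then show "th0 $ e \<ge> 0" by (rule LIMSEQ_le_const) (use th in auto)
    qed
    have rsl': "(\<lambda>n. r (f n) * s (f n)) \<longlonglongrightarrow> t" using LIMSEQ_subseq_LIMSEQ[OF rsl f] by (simp add: comp_def)
    have r0: "r0 \<ge> 0" using l by (simp add: l0)
    show False
    \<comment> \<open>If \<open>r\<close> tends to 0 then \<open>s\<close> tends to infinity, and
      the violations give \<open>v x <= al * t\<close> in the limit.\<close>
    proof (cases "r0 = 0")
      case True
      have sl: "(\<lambda>n. 1 / s (f n)) \<longlonglongrightarrow> 0"
      proof (rule tendsto_sandwich[OF _ _ tendsto_const])
        show "(\<lambda>n. 1 / t * r (f n)) \<longlonglongrightarrow> 0" using tendsto_mult_right_zero[OF rl[unfolded True]] .
        have "1 / s n \<le> 1 / t * r n" for n using rst[of n] s[of n] t by (simp add: field_simps)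
        then show "\<forall>\<^sub>F n in sequentially. 1 / s (f n) \<le> 1 / t * r (f n)" by simp
      qed (use s in \<open>auto intro!: always_eventually less_imp_le\<close>)
      have "(\<lambda>n. r (f n) * s (f n) * (v (x + s (f n) *\<^sub>R th (f n)) / (s (f n))\<^sup>2)) \<longlonglongrightarrow> t * al"
        by (intro tendsto_mult rsl' v_inf_lim[OF x]) (use th s sl in auto)
      moreover have "(\<lambda>n. v (x + r (f n) *\<^sub>R th (f n))) \<longlonglongrightarrow> v x"
        by (rule v_ray_lim[OF x]) (use th r rl True in auto)
      moreover have "v (x + r n *\<^sub>R th n) \<le> r n * s n * (v (x + s n *\<^sub>R th n) / (s n)\<^sup>2)" for n
        using bad[of n] s[of n] by (simp add: field_simps power2_eq_square)
      ultimately have "v x \<le> t * al" using LIMSEQ_le by blast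
      then show False using lt by (simp add: mult.commute)
    next
      case False
      then have r0p: "r0 > 0" using r0 by simp
      have "(\<lambda>n. r (f n) * s (f n) / r (f n)) \<longlonglongrightarrow> t / r0" by (intro tendsto_divide rsl' rl False)
      moreover have "r n * s n / r n = s n" for n using r[of n] by simp
      ultimately have sl: "(\<lambda>n. s (f n)) \<longlonglongrightarrow> t / r0" by simp
      have pts: "(\<lambda>n. x + r (f n) *\<^sub>R th (f n)) \<longlonglongrightarrow> x + r0 *\<^sub>R th0" "(\<lambda>n. x + s (f n) *\<^sub>R th (f n)) \<longlonglongrightarrow> x + (t / r0) *\<^sub>R th0"
        by (intro tendsto_intros rl sl thl)+
      have inH: "x + r n *\<^sub>R th n \<in> H" "x + s n *\<^sub>R th n \<in> H" for n
        using ray_in_H[OF x th(2)] r[of n] s[of n] by auto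
      have inH0: "x + r0 *\<^sub>R th0 \<in> H" "x + (t / r0) *\<^sub>R th0 \<in> H"
        using ray_in_H[OF x th0(2)] r0p t by auto
      have "(\<lambda>n. r (f n)) \<longlonglongrightarrow> r0" "(\<lambda>n. (r (f n))\<^sup>2) \<longlonglongrightarrow> r0\<^sup>2" using rl by (auto intro!: tendsto_intros)
      moreover have "(r n)\<^sup>2 \<le> r n * s n" for n using rs(1)[of n] r[of n] by (simp add: power2_eq_square)
      ultimately have r0t: "r0\<^sup>2 \<le> t" using LIMSEQ_le[OF _ rsl'] by blast
      show False
      proof (cases "r0\<^sup>2 = t")
        case False
        \<comment> \<open>The limit pair is separated by the sphere, and the reversed inequality
          contradicts strict comparison in the half ball or on its flat boundary.\<close>
        then have lt2: "r0\<^sup>2 < t" using r0t by simp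
        have "(\<lambda>n. s (f n) * v (x + r (f n) *\<^sub>R th (f n))) \<longlonglongrightarrow> t / r0 * v (x + r0 *\<^sub>R th0)"
          by (intro tendsto_intros sl v_cont_seq(1)[OF _ _ pts(1)] inH inH0)
        moreover have "(\<lambda>n. r (f n) * v (x + s (f n) *\<^sub>R th (f n))) \<longlonglongrightarrow> r0 * v (x + (t / r0) *\<^sub>R th0)"
          by (intro tendsto_intros rl v_cont_seq(1)[OF _ _ pts(2)] inH inH0)
        ultimately have ge: "t / r0 * v (x + r0 *\<^sub>R th0) \<le> r0 * v (x + (t / r0) *\<^sub>R th0)"
          using LIMSEQ_le less_imp_le[OF bad] by blast
        let ?y = "x + r0 *\<^sub>R th0"
        have yx: "?y \<noteq> x" "norm (?y - x) < sqrt t"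
          using r0p th0 lt2 by (auto simp: real_less_rsqrt)
        have "inv_v x t v ?y < v ?y"
        proof (cases "th0 $ e = 0")
          case True
          then show ?thesis using yx x by (intro inv_less_on_boundary[OF x t Qt G]) auto
        next
          case False
          then have "?y $ e > 0" using th0 r0p x by simp
          then show ?thesis using yx by (intro G) (simp add: half_ball_def)
        qed
        then have "r0\<^sup>2 / t * v (x + (t / r0) *\<^sub>R th0) < v ?y" by (simp add: inv_v_ray[OF th0(1) r0p])
        then show False using ge r0p t by (simp add: field_simps power2_eq_square)
      next
        case True
        \<comment> \<open>Both radii tend to \<open>sqrt t\<close>, where the inequality itself
          degenerates. The mean value theorem for \<open>v / r\<close> transfers the violation to
          radial derivatives, against \<open>mirror_radial_deriv_less\<close>.\<close>
        then have r0s: "r0 = sqrt t" using r0p by (metis less_imp_le real_sqrt_unique)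
        have tr: "t / r0 = r0" using True r0p by (simp add: power2_eq_square[symmetric] divide_eq_eq)
        have "\<exists>z. r n < z \<and> z < s n \<and> v (x + z *\<^sub>R th n) < z * (Dv (x + z *\<^sub>R th n) \<bullet> th n)" for n
        proof -
          have "\<exists>z>r n. z < s n \<and> v (x + s n *\<^sub>R th n) / s n - v (x + r n *\<^sub>R th n) / r n
             = (s n - r n) * ((z * (Dv (x + z *\<^sub>R th n) \<bullet> th n) - v (x + z *\<^sub>R th n)) / z\<^sup>2)"
            by (rule MVT2[OF rne[of n]]) (use deriv_ray_quot[OF x th(2)] r[of n] in auto)
          then obtain z where z: "r n < z" "z < s n" "v (x + s n *\<^sub>R th n) / s n - v (x + r n *\<^sub>R th n) / r n
             = (s n - r n) * ((z * (Dv (x + z *\<^sub>R th n) \<bullet> th n) - v (x + z *\<^sub>R th n)) / z\<^sup>2)" by blast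
          have "v (x + s n *\<^sub>R th n) / s n - v (x + r n *\<^sub>R th n) / r n > 0"
            using bad[of n] r[of n] s[of n] by (simp add: field_simps)
          then have "(z * (Dv (x + z *\<^sub>R th n) \<bullet> th n) - v (x + z *\<^sub>R th n)) / z\<^sup>2 > 0"
            unfolding z(3) by (rule zero_less_mult_pos) (use rne[of n] in simp)
          then show ?thesis using z by (auto simp: zero_less_divide_iff)
        qed
        then obtain z where z: "\<And>n. r n < z n" "\<And>n. z n < s n" "\<And>n. v (x + z n *\<^sub>R th n) < z n * (Dv (x + z n *\<^sub>R th n) \<bullet> th n)"
          by metis
        have zl: "(\<lambda>n. z (f n)) \<longlonglongrightarrow> r0"
          by (rule tendsto_sandwich[OF _ _ rl sl[unfolded tr]]) (use z in \<open>auto intro!: always_eventually less_imp_le\<close>)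
        have ptz: "(\<lambda>n. x + z (f n) *\<^sub>R th (f n)) \<longlonglongrightarrow> x + r0 *\<^sub>R th0" by (intro tendsto_intros zl thl)
        have zH: "x + z n *\<^sub>R th n \<in> H" for n using ray_in_H[OF x th(2)] z(1)[of n] r[of n] by simp
        have "(\<lambda>n. z (f n) * (Dv (x + z (f n) *\<^sub>R th (f n)) \<bullet> th (f n))) \<longlonglongrightarrow> r0 * (Dv (x + r0 *\<^sub>R th0) \<bullet> th0)"
          by (intro tendsto_intros zl thl v_cont_seq(2)[OF _ _ ptz] zH inH0)
        moreover have "(\<lambda>n. v (x + z (f n) *\<^sub>R th (f n))) \<longlonglongrightarrow> v (x + r0 *\<^sub>R th0)"
          by (intro v_cont_seq(1)[OF _ _ ptz] zH inH0)
        ultimately have "v (x + r0 *\<^sub>R th0) \<le> r0 * (Dv (x + r0 *\<^sub>R th0) \<bullet> th0)"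
          using LIMSEQ_le less_imp_le[OF z(3)] by blast
        moreover have "Dv (x + r0 *\<^sub>R th0) \<bullet> (x + r0 *\<^sub>R th0 - x) < v (x + r0 *\<^sub>R th0)"
          by (rule mirror_radial_deriv_less[OF x t Qt G inH0(1)]) (use th0 r0p r0s t in auto)
        ultimately show False by simp
      qed
    qed
  qed
  then have "t = v x / al" using al by (simp add: field_simps)
  then show ?thesis using Qt by simp
qed

end

section \<open>Consequences at the maximal radius: boundary values and exact symmetry\<close>

context half_space_solution
begin

text \<open>Insert \<open>s = t / r\<close> with \<open>t = v x / al\<close> and expand at infinity:
  up to a small multiple of \<open>r\<close>, \<open>al * t + r * (b . th) <= v (x + r th)\<close>,
  where \<open>b\<close> is the linear coefficient at infinity. The leading terms cancel since
  \<open>al * t = v x\<close>, so the terms of order \<open>r\<close> are ordered.\<close>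

lemma grad_ge:
  assumes x: "x $ e = 0" and th: "norm th = 1" "th $ e \<ge> 0"
  shows "((2 * al) *\<^sub>R x + cc) \<bullet> th \<le> Dv x \<bullet> th"
proof (rule ccontr)
  let ?b = "(2 * al) *\<^sub>R x + cc"
  assume neg: "\<not> ?b \<bullet> th \<le> Dv x \<bullet> th"
  define ep where "ep = (?b \<bullet> th - Dv x \<bullet> th) / 2"
  have ep: "ep > 0" using neg by (simp add: ep_def)
  obtain B where B: "B > 0" "\<And>z. x + z \<in> H \<Longrightarrow> norm z \<ge> B \<Longrightarrow>
     \<bar>v (x + z) - al * (norm z)\<^sup>2 - ?b \<bullet> z\<bar> \<le> ep * norm z"
    using asym_at[OF ep, of x] by auto
  have xH: "x \<in> H" using x by (simp add: closed_half_space_def)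
  define t where "t = v x / al"
  have t: "t > 0" using vpos[OF xH] al by (simp add: t_def)
  define ph where "ph r = v (x + r *\<^sub>R th) - r * (Dv x \<bullet> th + ep)" for r
  have "((\<lambda>r. v (x + r *\<^sub>R th)) has_real_derivative Dv (x + 0 *\<^sub>R th) \<bullet> th) (at 0 within {0..})"
    by (rule C2_line(1)[OF C2]) (use ray_in_H[OF x th(2)] in auto)
  then have "(ph has_real_derivative Dv (x + 0 *\<^sub>R th) \<bullet> th - (Dv x \<bullet> th + ep)) (at 0 within {0..})"
    unfolding ph_def by (auto intro!: derivative_eq_intros)
  then have "(ph has_real_derivative - ep) (at 0 within {0..})" by simp
  from has_real_derivative_neg_dec_right[OF this] ep obtain d where d: "d > 0"
    "\<And>h. 0 < h \<Longrightarrow> h < d \<Longrightarrow> ph h < ph 0" by auto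
  define r where "r = min (d / 2) (min (t / B) (sqrt t))"
  have r: "r > 0" "r < d" "r \<le> t / B" "r \<le> sqrt t"
  proof -
    show "r > 0" using d t B by (simp add: r_def)
    show "r < d" "r \<le> t / B" "r \<le> sqrt t" using d(1) unfolding r_def by linarith+
  qed
  define s where "s = t / r"
  have s: "s > 0" using t r by (simp add: s_def)
  have rs: "r * s = t" using r by (simp add: s_def)
  have sB: "s \<ge> B" using r B by (simp add: s_def field_simps)
  have "r\<^sup>2 \<le> t" using power_mono[OF r(4), of 2] r t by simp
  then have rles: "r \<le> s" using r by (simp add: s_def le_divide_eq power2_eq_square)
  have "r * v (x + s *\<^sub>R th) \<le> s * v (x + r *\<^sub>R th)"
    by (rule reflect_le_closed[OF x reflect_le_max[OF x] th r(1) rles]) (use rs t_def in simp)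
  moreover have "\<bar>v (x + s *\<^sub>R th) - al * (norm (s *\<^sub>R th))\<^sup>2 - ?b \<bullet> (s *\<^sub>R th)\<bar> \<le> ep * norm (s *\<^sub>R th)"
    by (rule B(2)) (use ray_in_H[OF x th(2)] s sB th in auto)
  then have "al * s\<^sup>2 + s * (?b \<bullet> th) - ep * s \<le> v (x + s *\<^sub>R th)" using th s by (simp add: abs_le_iff)
  then have "r * (al * s\<^sup>2 + s * (?b \<bullet> th) - ep * s) \<le> r * v (x + s *\<^sub>R th)" using r by simp
  ultimately have "s * (al * (r * s) + r * (?b \<bullet> th - ep)) \<le> s * v (x + r *\<^sub>R th)"
    by (simp add: power2_eq_square algebra_simps)
  then have "al * (r * s) + r * (?b \<bullet> th - ep) \<le> v (x + r *\<^sub>R th)" using s by simp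
  moreover have "al * (r * s) = v x" unfolding rs t_def using al by simp
  moreover have "?b \<bullet> th - ep = Dv x \<bullet> th + ep" unfolding ep_def by argo
  ultimately have "ph 0 \<le> ph r" by (simp add: ph_def)
  then show False using d(2)[OF r(1,2)] by simp
qed

text \<open>For tangential directions both signs are admissible in \<open>grad_ge\<close>.\<close>

lemma grad_tangential:
  assumes x: "x $ e = 0" and w: "w $ e = 0"
  shows "Dv x \<bullet> w = ((2 * al) *\<^sub>R x + cc) \<bullet> w"
proof (cases "w = 0")
  case False
  let ?b = "(2 * al) *\<^sub>R x + cc"
  have "?b \<bullet> (w /\<^sub>R norm w) \<le> Dv x \<bullet> (w /\<^sub>R norm w)"
    by (rule grad_ge[OF x]) (use w False in auto)
  moreover have "?b \<bullet> (- (w /\<^sub>R norm w)) \<le> Dv x \<bullet> (- (w /\<^sub>R norm w))"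
    by (rule grad_ge[OF x]) (use w False in auto)
  ultimately have "(?b - Dv x) \<bullet> (w /\<^sub>R norm w) = 0" by (auto simp: inner_diff_left)
  then show ?thesis using False by (simp add: inner_diff_left)
qed simp

lemma bdry_quadratic:
  assumes x: "x $ e = 0"
  shows "v x = al * (norm x)\<^sup>2 + cc \<bullet> x + v 0"
proof -
  define g where "g t = v (0 + t *\<^sub>R x) - al * (norm x)\<^sup>2 * t\<^sup>2 - (cc \<bullet> x) * t" for t
  have line: "((\<lambda>t. v (0 + t *\<^sub>R x)) has_real_derivative Dv (0 + t *\<^sub>R x) \<bullet> x) (at t)" for t
    by (rule C2_line(1)[OF C2, of UNIV 0 x t]) (use x in \<open>auto simp: closed_half_space_def\<close>)
  have gr: "Dv (0 + t *\<^sub>R x) \<bullet> x = 2 * al * t * (norm x)\<^sup>2 + cc \<bullet> x" for t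
    using grad_tangential[of "t *\<^sub>R x" x] x by (simp add: inner_add_left power2_norm_eq_inner)
  have "(g has_real_derivative 0) (at t)" for t
    unfolding g_def using line[of t]
    by (auto intro!: derivative_eq_intros simp: gr[simplified])
  then have "g 1 = g 0" by (intro DERIV_isconst_all) blast
  then show ?thesis by (simp add: g_def)
qed

text \<open>Completing the square on the hyperplane; the remaining constant is positive because
  \<open>v xb > 0\<close>.\<close>

lemma bdry_center:
  obtains xb d where "xb $ e = 0" "d > 0" "\<And>x. x $ e = 0 \<Longrightarrow> v x = al * ((norm (x - xb))\<^sup>2 + d\<^sup>2)"
proof -
  define xb where "xb = (- 1 / (2 * al)) *\<^sub>R tproj e cc"
  define m where "m = v 0 / al - (norm xb)\<^sup>2"
  have xb: "xb $ e = 0" by (simp add: xb_def tproj_nth)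
  have 1: "v x = al * ((norm (x - xb))\<^sup>2 + m)" if x: "x $ e = 0" for x
  proof -
    have "(norm (x - xb))\<^sup>2 = (norm x)\<^sup>2 - 2 * (x \<bullet> xb) + (norm xb)\<^sup>2"
      unfolding power2_norm_eq_inner by (simp add: inner_diff_left inner_diff_right inner_commute)
    moreover have "x \<bullet> xb = - (1 / (2 * al)) * (cc \<bullet> x)"
      using inner_tproj[OF x, of cc] by (simp add: xb_def inner_commute)
    ultimately have "al * ((norm (x - xb))\<^sup>2 + m) = al * ((norm x)\<^sup>2 + 2 * (1 / (2 * al) * (cc \<bullet> x)) + v 0 / al)"
      by (simp add: m_def)
    also have "\<dots> = al * (norm x)\<^sup>2 + cc \<bullet> x + v 0" using al by (simp add: field_simps)
    finally show ?thesis using bdry_quadratic[OF x] by simp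
  qed
  have "v xb > 0" using vpos xb by (simp add: closed_half_space_def)
  then have "m > 0" using 1[OF xb] al by (simp add: zero_less_mult_iff)
  then show ?thesis using that[of xb "sqrt m"] xb 1 by simp
qed

lemma obtain_tangential_axis: obtains i where "i \<noteq> e"
proof -
  have "\<exists>i. i \<noteq> e"
  proof (rule ccontr)
    assume "\<not> ?thesis"
    then have "(UNIV :: 'n set) = {e}" by auto
    then have "CARD('n) = card {e}" by simp
    then show False using n2 by simp
  qed
  then show ?thesis using that by blast
qed

text \<open>On a boundary ray \<open>v\<close> is \<open>al * t + s * be + al * s^2\<close>, which
  reproduces itself under \<open>s\<close> to \<open>t / s\<close>. The comparison is thus an
  equality on the boundary, which rules out the strict alternative of
  \<open>half_ball_dichotomy\<close>.\<close>

lemma inversion_symmetric: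
  assumes x: "x $ e = 0" and y: "y \<in> half_ball x (v x / al)"
  shows "inv_v x (v x / al) v y = v y"
proof (rule ccontr)
  assume ne: "\<not> ?thesis"
  define t where "t = v x / al"
  have xH: "x \<in> H" using x by (simp add: closed_half_space_def)
  have t: "t > 0" using vpos[OF xH] al by (simp add: t_def)
  have G: "inv_v x t v y < v y" if "y \<in> half_ball x t" for y
    using half_ball_dichotomy[OF x t reflect_le_max[OF x, folded t_def]] ne y that unfolding t_def by blast
  obtain i where i: "i \<noteq> e" by (rule obtain_tangential_axis)
  define th :: "real^'n" where "th = axis i 1"
  have th: "norm th = 1" "th $ e = 0" using i by (simp add: th_def, simp add: th_def axis_def)
  define r where "r = sqrt t / 2"
  have r: "r > 0" "r < sqrt t" using t by (auto simp: r_def)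
  have "inv_v x t v (x + r *\<^sub>R th) < v (x + r *\<^sub>R th)"
    by (rule inv_less_on_boundary[OF x t reflect_le_max[OF x, folded t_def] G]) (use th r x in auto)
  then have lt: "r\<^sup>2 / t * v (x + (t / r) *\<^sub>R th) < v (x + r *\<^sub>R th)"
    by (simp add: inv_v_ray[OF th(1) r(1)])
  define be where "be = ((2 * al) *\<^sub>R x + cc) \<bullet> th"
  have vq: "v (x + s *\<^sub>R th) = al * t + s * be + al * s\<^sup>2" for s
  proof -
    have n: "(norm (x + s *\<^sub>R th))\<^sup>2 = (norm x)\<^sup>2 + 2 * s * (x \<bullet> th) + s\<^sup>2"
      using th(1) unfolding power2_norm_eq_inner
      by (simp add: inner_add_left inner_add_right inner_commute norm_eq_1 power2_eq_square)
    have "v (x + s *\<^sub>R th) = al * (norm (x + s *\<^sub>R th))\<^sup>2 + cc \<bullet> (x + s *\<^sub>R th) + v 0"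
      by (rule bdry_quadratic) (use x th in simp)
    also have "\<dots> = (al * (norm x)\<^sup>2 + cc \<bullet> x + v 0) + s * be + al * s\<^sup>2"
      unfolding n be_def by (simp add: inner_add_left inner_add_right algebra_simps)
    also have "al * (norm x)\<^sup>2 + cc \<bullet> x + v 0 = al * t" using bdry_quadratic[OF x] al by (simp add: t_def)
    finally show ?thesis .
  qed
  have "r\<^sup>2 / t * (al * t + t / r * be + al * (t / r)\<^sup>2) = al * t + r * be + al * r\<^sup>2"
    using r t by (simp add: field_simps power2_eq_square)
  then show False using lt unfolding vq by simp
qed

text \<open>Exchanging \<open>r\<close> and \<open>s\<close> extends the symmetry from the inside of
  the sphere to the outside.\<close>

lemma ray_invariant:
  assumes x: "x $ e = 0" and th: "norm th = 1" "th $ e > 0" and r: "r > 0" "s > 0" "r * s = v x / al"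
  shows "r * v (x + s *\<^sub>R th) = s * v (x + r *\<^sub>R th)"
proof -
  define t where "t = v x / al"
  have *: "r * v (x + s *\<^sub>R th) = s * v (x + r *\<^sub>R th)" if r: "r > 0" "s > 0" "r * s = t" "r < s" for r s
  proof -
    have t: "t > 0" using r by (metis mult_pos_pos)
    have "r\<^sup>2 < t" using r by (simp add: power2_eq_square flip: r(3))
    then have "r < sqrt t" by (rule real_less_rsqrt)
    then have "x + r *\<^sub>R th \<in> half_ball x t" using th r x by (simp add: half_ball_def)
    then have "r\<^sup>2 / t * v (x + (t / r) *\<^sub>R th) = v (x + r *\<^sub>R th)"
      using inversion_symmetric[OF x] inv_v_ray[OF th(1) r(1), of x t] by (simp add: t_def)
    moreover have "t / r = s" using r by (simp add: field_simps)
    moreover have "r\<^sup>2 / t = r / s" using r by (simp add: power2_eq_square flip: r(3))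
    ultimately have "r / s * v (x + s *\<^sub>R th) = v (x + r *\<^sub>R th)" by simp
    then show ?thesis using r by (simp add: field_simps)
  qed
  consider "r < s" | "s < r" | "r = s" by linarith
  then show ?thesis
    by cases (use *[of r s] *[of s r] r in \<open>auto simp: t_def mult.commute\<close>)
qed

text \<open>Differentiating the reflection symmetry at a fixed point.\<close>

lemma mirror_eq:
  assumes x: "x $ e = 0" and y: "y $ e > 0" "(norm (y - x))\<^sup>2 = v x / al"
  shows "Dv y \<bullet> (y - x) = v y"
proof -
  have yH: "y \<in> H" and yx: "y \<noteq> x" using y x by (auto simp: closed_half_space_def)
  define r where "r = norm (y - x)"
  define th where "th = (y - x) /\<^sub>R r"
  have r: "r > 0" using yx by (simp add: r_def)
  have th: "norm th = 1" "th $ e > 0" using r y x by (auto simp: th_def r_def)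
  have yr: "y - x = r *\<^sub>R th" "x + r *\<^sub>R th = y" using r by (auto simp: th_def)
  have t: "r\<^sup>2 = v x / al" using y by (simp add: r_def)
  define f where "f s = v (x + s *\<^sub>R th) / s" for s
  define f' where "f' = (r * (Dv (x + r *\<^sub>R th) \<bullet> th) - v (x + r *\<^sub>R th)) / r\<^sup>2"
  have df: "(f has_real_derivative f') (at r)"
    unfolding f_def f'_def using deriv_ray_quot[OF x _ r, of th] th by simp
  have "((\<lambda>s. r\<^sup>2 / s) has_real_derivative - 1) (at r)"
    using r by (auto intro!: derivative_eq_intros simp: power2_eq_square)
  moreover have "r\<^sup>2 / r = r" by (simp add: power2_eq_square)
  ultimately have "((\<lambda>s. f (r\<^sup>2 / s)) has_real_derivative f' * (- 1)) (at r)"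
    by (intro DERIV_chain2[of f]) (simp_all add: df)
  then have 1: "((\<lambda>s. f s - f (r\<^sup>2 / s)) has_real_derivative f' - f' * (- 1)) (at r)"
    using df by (intro DERIV_diff)
  have "((\<lambda>s. 0) has_real_derivative f' - f' * (- 1)) (at r)"
  proof (rule has_field_derivative_transform_within_open[OF 1, of "{0<..}"])
    fix s :: real assume s: "s \<in> {0<..}"
    have "s * v (x + (r\<^sup>2 / s) *\<^sub>R th) = r\<^sup>2 / s * v (x + s *\<^sub>R th)"
    proof (rule ray_invariant[OF x th])
      show "s > 0" "r\<^sup>2 / s > 0" using s r by auto
      show "s * (r\<^sup>2 / s) = v x / al" using s t by simp
    qed
    then show "f s - f (r\<^sup>2 / s) = 0" using s r by (simp add: f_def field_simps)
  qed (use r in auto)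
  then have "f' - f' * (- 1) = 0" by (rule DERIV_unique) simp
  then have "f' = 0" by simp
  then show ?thesis using r unfolding f'_def yr by simp
qed

end

section \<open>The radial equation\<close>

lemma esym_const:
  assumes "finite I" "\<And>i. i \<in> I \<Longrightarrow> l i = c"
  shows "esym I s l = real (card I choose s) * c ^ s"
proof -
  have "esym I s l = (\<Sum>S\<in>{S. S \<subseteq> I \<and> card S = s}. c ^ s)"
    unfolding esym_def
  proof (intro sum.cong refl)
    fix S assume S: "S \<in> {S. S \<subseteq> I \<and> card S = s}"
    have "(\<Prod>i\<in>S. l i) = (\<Prod>i\<in>S. c)" using S assms(2) by (intro prod.cong) auto
    then show "(\<Prod>i\<in>S. l i) = c ^ s" using S by simp
  qed
  then show ?thesis using n_subsets[OF assms(1)] by simp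
qed

lemma sigma_two_eigenvalues:
  fixes e :: "'n::finite"
  assumes l: "\<And>i. i \<noteq> e \<Longrightarrow> l i = a" "l e = b"
  shows "sigma (Suc s) (diag l) = real ((CARD('n) - 1) choose Suc s) * a ^ Suc s + b * (real ((CARD('n) - 1) choose s) * a ^ s)"
proof -
  have "sigma (Suc s) (diag l) = esym (insert e (UNIV - {e})) (Suc s) l" by (simp add: sigma_on_diag insert_absorb)
  also have "\<dots> = esym (UNIV - {e}) (Suc s) l + l e * esym (UNIV - {e}) s l" by (rule esym_insert) auto
  finally show ?thesis
    using esym_const[of "UNIV - {e}" l a "Suc s"] esym_const[of "UNIV - {e}" l a s] l
    by (simp add: card_Diff_singleton)
qed

text \<open>The formulas on the axis divide by \<open>d^2 - t^2\<close>, so derivatives are known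
  only off \<open>d\<close>; continuity bridges the gap.\<close>

lemma const_except_point:
  fixes f :: "real \<Rightarrow> real"
  assumes c: "continuous_on {0..} f" and d: "d > 0" and t: "t \<ge> 0"
    and D: "\<And>t. t > 0 \<Longrightarrow> t \<noteq> d \<Longrightarrow> (f has_real_derivative 0) (at t)"
  shows "f t = f d"
proof -
  consider "t < d" | "t = d" | "d < t" by linarith
  then show ?thesis
  proof cases
    case 1
    have "f d = f t"
      by (rule DERIV_isconst_end[OF 1]) (use t D 1 in \<open>auto intro: continuous_on_subset[OF c]\<close>)
    then show ?thesis by simp
  next
    case 3
    show ?thesis
      by (rule DERIV_isconst_end[OF 3]) (use d D 3 in \<open>auto intro: continuous_on_subset[OF c]\<close>)
  qed simp
qed

text \<open>All the spheres about boundary points \<open>x\<close> of squared radius \<open>v x / al\<close> pass through the point at height \<open>d\<close>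
  above \<open>xb\<close>, so \<open>v\<close> is rotationally symmetric about it in the hyperbolic sense; on the axis through it the
  equation becomes an ordinary differential equation.\<close>

locale half_space_centered = half_space_solution e k c0 v Dv D2v al cc
  for e :: "'n::finite" and k c0 v Dv D2v al cc +
  fixes xb :: "real^'n" and d :: real
  assumes xb: "xb $ e = 0" and d: "d > 0"
    and bq: "\<And>x. x $ e = 0 \<Longrightarrow> v x = al * ((norm (x - xb))\<^sup>2 + d\<^sup>2)"
begin

abbreviation "e1 \<equiv> axis e (1::real) :: real^'n"

definition "g t = v (xb + t *\<^sub>R e1)"
definition "g1 t = Dv (xb + t *\<^sub>R e1) \<bullet> e1"
definition "g2 t = (D2v (xb + t *\<^sub>R e1) *v e1) \<bullet> e1"
text \<open>The value that the sphere symmetries force on the tangential second derivatives of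
  \<open>v\<close> at height \<open>t\<close> on the axis.\<close>

definition "m t = 2 * (g t - t * g1 t) / (d\<^sup>2 - t\<^sup>2)"

lemma D2sym: "y \<in> H \<Longrightarrow> a \<bullet> (D2v y *v b) = b \<bullet> (D2v y *v a)"
  using C2_symmetric_half_space[OF C2] by (metis dot_lmul_matrix inner_commute transpose_matrix_vector)

lemma axisH: "t \<ge> 0 \<Longrightarrow> xb + t *\<^sub>R e1 \<in> H"
  using ray_in_H[OF xb, of e1] by simp

text \<open>Every point beside the axis lies on an invariant sphere, and \<open>mirror_eq\<close>
  there gives \<open>ph ep * (ep^2 + d^2 - t^2) = 2 * ep * K ep\<close>. The values at
  \<open>ep = 0\<close> yield the gradient and the derivatives yield the Hessian.\<close>

lemma axis_tangential:
  assumes t: "t > 0" "t \<noteq> d" and xi: "xi $ e = 0" "norm xi = 1"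
  shows "Dv (xb + t *\<^sub>R e1) \<bullet> xi = 0" "xi \<bullet> (D2v (xb + t *\<^sub>R e1) *v xi) = m t"
proof -
  let ?a = "xb + t *\<^sub>R e1"
  have dt: "d\<^sup>2 - t\<^sup>2 \<noteq> 0" using t d by (simp add: power2_eq_iff)
  have inH: "?a + ep *\<^sub>R xi \<in> H" for ep using xi xb t by (simp add: closed_half_space_def)
  define K where "K ep = v (?a + ep *\<^sub>R xi) - t * (Dv (?a + ep *\<^sub>R xi) \<bullet> e1)" for ep
  define ph where "ph ep = Dv (?a + ep *\<^sub>R xi) \<bullet> xi" for ep
  have xe: "xi \<bullet> e1 = 0" using xi by (simp add: inner_axis)
  have xx: "xi \<bullet> xi = 1" using xi by (simp add: norm_eq_1)
  have eq: "ph ep * (ep\<^sup>2 + d\<^sup>2 - t\<^sup>2) = 2 * ep * K ep" if ep: "ep \<noteq> 0" for ep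
  proof -
    \<comment> \<open>The position of the centre is the solution of
      \<open>(ep - c)^2 + t^2 = c^2 + d^2\<close>, which says that the sphere about \<open>x\<close>
      passes through the displaced point.\<close>
    define c where "c = (ep\<^sup>2 + t\<^sup>2 - d\<^sup>2) / (2 * ep)"
    define x where "x = xb + c *\<^sub>R xi"
    let ?y = "?a + ep *\<^sub>R xi"
    have x: "x $ e = 0" using xb xi by (simp add: x_def)
    have yx: "?y - x = (ep - c) *\<^sub>R xi + t *\<^sub>R e1" by (simp add: x_def algebra_simps)
    have c2: "2 * ep * c = ep\<^sup>2 + t\<^sup>2 - d\<^sup>2" using ep by (simp add: c_def)
    have "(norm (?y - x))\<^sup>2 = (ep - c)\<^sup>2 + t\<^sup>2"
      unfolding yx power2_norm_eq_inner using xe xx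
      by (simp add: inner_add_left inner_add_right inner_commute power2_eq_square)
    also have "\<dots> = c\<^sup>2 + d\<^sup>2" using c2 by (simp add: power2_diff mult.commute mult.left_commute)
    also have "\<dots> = v x / al" using bq[OF x] al xi by (simp add: x_def)
    finally have "Dv ?y \<bullet> (?y - x) = v ?y"
      by (intro mirror_eq[OF x]) (use xb xi t in auto)
    then have "(ep - c) * ph ep + t * (Dv ?y \<bullet> e1) = v ?y"
      unfolding yx ph_def by (simp add: inner_add_right)
    then have "K ep = (ep - c) * ph ep" unfolding K_def by linarith
    then have P: "(2 * ep * (ep - c)) * ph ep = 2 * ep * K ep" by simp
    have Q: "2 * ep * (ep - c) = ep\<^sup>2 + d\<^sup>2 - t\<^sup>2" using c2 by (simp add: algebra_simps power2_eq_square)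
    show ?thesis using P unfolding Q by (simp only: mult.commute[of "ph ep"])
  qed
  have dv: "((\<lambda>ep. v (?a + ep *\<^sub>R xi)) has_real_derivative Dv (?a + ep *\<^sub>R xi) \<bullet> xi) (at ep)"
    and dD: "((\<lambda>ep. Dv (?a + ep *\<^sub>R xi) \<bullet> z) has_real_derivative (D2v (?a + ep *\<^sub>R xi) *v xi) \<bullet> z) (at ep)" for ep z
    using C2_line[OF C2, of UNIV ?a xi ep] inH by auto
  have dph: "(ph has_real_derivative (D2v ?a *v xi) \<bullet> xi) (at 0)"
    unfolding ph_def using dD[of xi 0] by simp
  obtain K' where dK: "(K has_real_derivative K') (at 0)"
    unfolding K_def using DERIV_diff[OF dv DERIV_cmult[OF dD[of e1 0], of t]] by blast
  have L: "((\<lambda>ep. ph ep * (ep\<^sup>2 + d\<^sup>2 - t\<^sup>2)) has_real_derivative (D2v ?a *v xi) \<bullet> xi * (d\<^sup>2 - t\<^sup>2)) (at 0)"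
    by (rule derivative_eq_intros dph refl | simp)+
  have R: "((\<lambda>ep. 2 * ep * K ep) has_real_derivative 2 * K 0) (at 0)"
    by (rule derivative_eq_intros dK refl | simp)+
  have p0: "ph 0 = 0"
  proof -
    have "(\<lambda>ep. ph ep * (ep\<^sup>2 + d\<^sup>2 - t\<^sup>2)) \<midarrow>0\<rightarrow> ph 0 * (0\<^sup>2 + d\<^sup>2 - t\<^sup>2)"
      using DERIV_isCont[OF L] by (simp add: isCont_def)
    moreover have "(\<lambda>ep. 2 * ep * K ep) \<midarrow>0\<rightarrow> 2 * 0 * K 0"
      using DERIV_isCont[OF R] by (simp add: isCont_def)
    then have "(\<lambda>ep. ph ep * (ep\<^sup>2 + d\<^sup>2 - t\<^sup>2)) \<midarrow>0\<rightarrow> 2 * 0 * K 0"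
      by (rule Lim_transform_eventually) (auto simp: eventually_at_filter eq)
    ultimately have "ph 0 * (0\<^sup>2 + d\<^sup>2 - t\<^sup>2) = 2 * 0 * K 0" by (rule LIM_unique)
    then show ?thesis using dt by simp
  qed
  then show "Dv ?a \<bullet> xi = 0" by (simp add: ph_def)
  have "ph ep * (ep\<^sup>2 + d\<^sup>2 - t\<^sup>2) = 2 * ep * K ep" for ep using eq[of ep] p0 by (cases "ep = 0") auto
  then have "(D2v ?a *v xi) \<bullet> xi * (d\<^sup>2 - t\<^sup>2) = 2 * K 0" using L R DERIV_unique by (metis (no_types, lifting) ext)
  then have "(D2v ?a *v xi) \<bullet> xi = 2 * K 0 / (d\<^sup>2 - t\<^sup>2)" using dt by (simp add: field_simps)
  then show "xi \<bullet> (D2v ?a *v xi) = m t" by (simp add: K_def m_def g_def g1_def inner_commute)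
qed

lemma axis_line:
  assumes "t > 0"
  shows "(g has_real_derivative g1 t) (at t)" "(g1 has_real_derivative g2 t) (at t)"
    "((\<lambda>t. Dv (xb + t *\<^sub>R e1) \<bullet> z) has_real_derivative (D2v (xb + t *\<^sub>R e1) *v e1) \<bullet> z) (at t)"
proof -
  have S: "xb + s *\<^sub>R e1 \<in> H" if "s \<in> {0<..}" for s using axisH[of s] that by simp
  have at: "at t within {0<..} = at t" using assms by (intro at_within_open) auto
  have tt: "t \<in> {0<..}" using assms by simp
  show "(g has_real_derivative g1 t) (at t)"
    using C2_line(1)[OF C2 S tt] by (simp add: at g_def[abs_def] g1_def)
  show *: "((\<lambda>t. Dv (xb + t *\<^sub>R e1) \<bullet> z) has_real_derivative (D2v (xb + t *\<^sub>R e1) *v e1) \<bullet> z) (at t)" for z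
    using C2_line(2)[OF C2 S tt, of z] by (simp add: at)
  show "(g1 has_real_derivative g2 t) (at t)"
    using *[of e1] by (simp add: g1_def[abs_def] g2_def)
qed

text \<open>The tangential gradient vanishes along the axis, so its derivative along the axis does
  too.\<close>

lemma axis_mixed:
  assumes t: "t > 0" "t \<noteq> d" and xi: "xi $ e = 0" "norm xi = 1"
  shows "e1 \<bullet> (D2v (xb + t *\<^sub>R e1) *v xi) = 0"
proof -
  have "((\<lambda>t. 0) has_real_derivative (D2v (xb + t *\<^sub>R e1) *v e1) \<bullet> xi) (at t)"
    by (rule has_field_derivative_transform_within_open[OF axis_line(3)[OF t(1)], of "{0<..} - {d}"])
       (use t axis_tangential(1)[OF _ _ xi] in \<open>auto intro!: open_Diff\<close>)
  then have "(D2v (xb + t *\<^sub>R e1) *v e1) \<bullet> xi = 0" by (rule DERIV_unique) simp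
  then show ?thesis using D2sym[OF axisH, of t e1 xi] t by (simp add: inner_commute)
qed

definition "lT t = g t * m t - (g1 t)\<^sup>2 / 2"
definition "lN t = g t * g2 t - (g1 t)\<^sup>2 / 2"

abbreviation "A t \<equiv> schouten_v (v (xb + t *\<^sub>R e1)) (Dv (xb + t *\<^sub>R e1)) (D2v (xb + t *\<^sub>R e1))"

text \<open>The quadratic form of the Hessian is constant on tangential unit vectors, the mixed
  entries vanish, and the gradient is vertical, so all terms are diagonal at once.\<close>

lemma A_axis:
  assumes t: "t > 0" "t \<noteq> d"
  shows "A t = diag (\<lambda>i. if i = e then lN t else lT t)"
    and "i \<noteq> e \<Longrightarrow> D2v (xb + t *\<^sub>R e1) $ i $ i = m t"
proof -
  let ?a = "xb + t *\<^sub>R e1"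
  have entry: "D2v ?a $ i $ j = axis i 1 \<bullet> (D2v ?a *v axis j 1)" for i j
    by (simp add: inner_axis' matrix_vector_mult_basis column_def)
  have ax: "axis i (1::real) $ e = 0" if "i \<noteq> e" for i using that by (simp add: axis_def)
  have ii: "D2v ?a $ i $ i = m t" if "i \<noteq> e" for i
    unfolding entry by (rule axis_tangential(2)[OF t ax[OF that]]) simp
  show "i \<noteq> e \<Longrightarrow> D2v ?a $ i $ i = m t" by (rule ii)
  have aH: "?a \<in> H" using axisH t by simp
  have ij: "D2v ?a $ i $ j = 0" if "i \<noteq> e" "j \<noteq> e" "i \<noteq> j" for i j
  proof -
    \<comment> \<open>Polarization: the unit vector in the direction of
      \<open>axis i 1 + axis j 1\<close> isolates the off-diagonal entry.\<close>
    define c where "c = 1 / sqrt 2"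
    have cc: "c * c = 1 / 2" by (simp add: c_def)
    define xi :: "real^'n" where "xi = c *\<^sub>R (axis i 1 + axis j 1)"
    have "(axis i 1 + axis j (1::real)) \<bullet> (axis i 1 + axis j 1 :: real^'n) = 2"
      using that by (simp add: inner_add_left inner_add_right inner_axis_axis)
    then have "xi \<bullet> xi = 1" using cc by (simp add: xi_def)
    then have nx: "norm xi = 1" by (simp add: norm_eq_1)
    have "xi \<bullet> (D2v ?a *v xi) = m t"
      by (rule axis_tangential(2)[OF t _ nx]) (use that in \<open>simp add: xi_def axis_def\<close>)
    moreover have "xi \<bullet> (D2v ?a *v xi) = (c * c) * (D2v ?a $ i $ i + D2v ?a $ i $ j + D2v ?a $ j $ i + D2v ?a $ j $ j)"
      unfolding entry xi_def
      by (simp add: matrix_vector_mult_scaleR matrix_vector_right_distrib inner_add_left inner_add_right algebra_simps)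
    moreover have "D2v ?a $ j $ i = D2v ?a $ i $ j" unfolding entry by (rule D2sym[OF aH])
    ultimately show ?thesis using ii that by (simp add: cc)
  qed
  have ej: "D2v ?a $ e $ j = 0" if "j \<noteq> e" for j
    unfolding entry by (rule axis_mixed[OF t ax[OF that]]) simp
  have je: "D2v ?a $ j $ e = 0" if "j \<noteq> e" for j
    using ej[OF that] unfolding entry by (simp only: D2sym[OF aH, of "axis j 1"])
  have ee: "D2v ?a $ e $ e = g2 t" unfolding entry g2_def by (rule inner_commute)
  have Dva: "Dv ?a = g1 t *\<^sub>R e1"
  proof -
    have "Dv ?a $ i = (g1 t *\<^sub>R e1) $ i" for i
    proof (cases "i = e")
      case False
      have "Dv ?a \<bullet> axis i 1 = 0" by (rule axis_tangential(1)[OF t ax[OF False]]) simp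
      then have "Dv ?a $ i = 0" by (simp add: inner_axis)
      moreover have "e1 $ i = 0" using False by (simp add: axis_def)
      ultimately show ?thesis by simp
    qed (simp add: g1_def inner_axis)
    then show ?thesis by (simp add: vec_eq_iff)
  qed
  have "(norm (Dv ?a))\<^sup>2 = (g1 t)\<^sup>2" unfolding Dva by simp
  then have "A t $ i $ j = diag (\<lambda>i. if i = e then lN t else lT t) $ i $ j" for i j
    using ii[of i] ij[of i j] ej[of j] je[of i] ee
    by (auto simp: schouten_v_def diag_def mat_def lN_def lT_def g_def)
  then show "A t = diag (\<lambda>i. if i = e then lN t else lT t)" by (simp add: vec_eq_iff)
qed

text \<open>The eigenvalues are \<open>lT\<close> with multiplicity \<open>n - 1\<close> and
  \<open>lN\<close> once; the binomials are removed by
  \<open>k * (n choose k) = n * (n - 1 choose k - 1)\<close>. The positivity of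
  \<open>sigma 1\<close> is kept to fix a sign later.\<close>

lemma axis_eq:
  assumes t: "t > 0" "t \<noteq> d"
  shows "real k * (lT t ^ (k - 1) * (lN t - lT t)) = real CARD('n) * (2 ^ k - lT t ^ k)"
    and "(real CARD('n) - 1) * lT t + lN t > 0"
proof -
  let ?n = "CARD('n)"
  have aH: "xb + t *\<^sub>R e1 \<in> H" using axisH t by simp
  have sg: "sigma k (A t) = 2 ^ k * real (?n choose k)" and Gm: "garding_cone k (A t)"
    using sol aH by (auto simp: solution_on_def)
  obtain q where q: "k = Suc q" using k by (cases k) auto
  obtain N where N: "?n = Suc N" using n2 by (cases "?n") auto
  let ?l = "\<lambda>i. if i = e then lN t else lT t"
  have s: "sigma (Suc j) (A t) = real (N choose Suc j) * lT t ^ Suc j + lN t * (real (N choose j) * lT t ^ j)" for j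
    unfolding A_axis(1)[OF t] using sigma_two_eigenvalues[of e ?l "lT t" "lN t" j] N by simp
  have "sigma 1 (A t) > 0" using Gm k by (auto simp: garding_cone_def)
  then show "(real ?n - 1) * lT t + lN t > 0" using s[of 0] by (simp add: N)
  have ch: "real (?n choose k) = real (N choose Suc q) + real (N choose q)" unfolding N q by simp
  have ab: "real k * real (?n choose k) = real ?n * real (N choose q)"
    unfolding N q by (metis Suc_times_binomial of_nat_mult)
  have "real (N choose q) * (lT t ^ q * (lN t - lT t)) = real (?n choose k) * (2 ^ k - lT t ^ k)"
    using sg s[of q] ch unfolding q by (simp add: algebra_simps)
  then have "real ?n * real (N choose q) * (lT t ^ q * (lN t - lT t)) = real ?n * (real (?n choose k) * (2 ^ k - lT t ^ k))"
    by simp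
  then have "real (?n choose k) * (real k * (lT t ^ q * (lN t - lT t))) = real (?n choose k) * (real ?n * (2 ^ k - lT t ^ k))"
    unfolding ab[symmetric] by (simp add: mult_ac)
  moreover have "real (?n choose k) \<noteq> 0" using k by simp
  ultimately show "real k * (lT t ^ (k - 1) * (lN t - lT t)) = real ?n * (2 ^ k - lT t ^ k)"
    by (simp add: q)
qed

lemma gpos: "t \<ge> 0 \<Longrightarrow> g t > 0"
  using vpos[OF axisH] by (simp add: g_def)

lemma deriv_m:
  assumes t: "t > 0" "t \<noteq> d"
  shows "(m has_real_derivative 2 * t * (m t - g2 t) / (d\<^sup>2 - t\<^sup>2)) (at t)"
proof -
  have dt: "d\<^sup>2 - t\<^sup>2 \<noteq> 0" using t d by (simp add: power2_eq_iff)
  have "((\<lambda>t. 2 * (g t - t * g1 t) / (d\<^sup>2 - t\<^sup>2)) has_real_derivative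
     (2 * (g1 t - (g1 t + t * g2 t)) * (d\<^sup>2 - t\<^sup>2) - 2 * (g t - t * g1 t) * (- (2 * t))) / ((d\<^sup>2 - t\<^sup>2) * (d\<^sup>2 - t\<^sup>2))) (at t)"
    using dt by (auto intro!: derivative_eq_intros axis_line[OF t(1)])
  moreover have "(2 * (g1 t - (g1 t + t * g2 t)) * (d\<^sup>2 - t\<^sup>2) - 2 * (g t - t * g1 t) * (- (2 * t))) / ((d\<^sup>2 - t\<^sup>2) * (d\<^sup>2 - t\<^sup>2))
     = 2 * t * (m t - g2 t) / (d\<^sup>2 - t\<^sup>2)"
  proof -
    have mm: "2 * (g t - t * g1 t) = m t * (d\<^sup>2 - t\<^sup>2)" using dt by (simp add: m_def)
    have "2 * (g1 t - (g1 t + t * g2 t)) * (d\<^sup>2 - t\<^sup>2) - 2 * (g t - t * g1 t) * (- (2 * t)) = 2 * t * (m t - g2 t) * (d\<^sup>2 - t\<^sup>2)"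
      unfolding mm by (simp add: algebra_simps)
    then show ?thesis using dt by simp
  qed
  ultimately show ?thesis by (simp add: m_def[abs_def])
qed

text \<open>The first integral of the radial equation; it vanishes because \<open>X\<close> does at \<open>t = d\<close>.\<close>

definition "X t = (d\<^sup>2 - t\<^sup>2) / g t"

lemma deriv_first_integral:
  assumes t: "t > 0" "t \<noteq> d"
  shows "((\<lambda>t. (2 ^ k - lT t ^ k) * X t ^ CARD('n)) has_real_derivative 0) (at t)"
proof -
  let ?n = "CARD('n)"
  have dt: "d\<^sup>2 - t\<^sup>2 \<noteq> 0" using t d by (simp add: power2_eq_iff)
  have g0: "g t > 0" using gpos t by simp
  define X' where "X' = (- (2 * t) * g t - (d\<^sup>2 - t\<^sup>2) * g1 t) / (g t * g t)"
  have dX: "(X has_real_derivative X') (at t)"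
    unfolding X_def[abs_def] X'_def using g0 by (auto intro!: derivative_eq_intros axis_line[OF t(1)])
  define lT' where "lT' = g t * (2 * t * (m t - g2 t) / (d\<^sup>2 - t\<^sup>2)) + g1 t * m t - g1 t * g2 t"
  have dl: "(lT has_real_derivative lT') (at t)"
    unfolding lT_def[abs_def] lT'_def by (auto intro!: derivative_eq_intros axis_line[OF t(1)] deriv_m[OF t] simp: algebra_simps)
  have X0: "X t \<noteq> 0" using dt g0 by (simp add: X_def)
  \<comment> \<open>The variations of \<open>lT\<close> and of \<open>X\<close> are linked through
    \<open>lN - lT\<close>, the quantity that \<open>axis_eq\<close> expresses by
    \<open>2^k - lT^k\<close>; hence the product is conserved.\<close>
  have lX: "lT' * X t = (lN t - lT t) * X'"
    unfolding lT'_def X_def lN_def lT_def X'_def using dt g0 by (simp add: field_simps)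
  have "((\<lambda>t. (2 ^ k - lT t ^ k) * X t ^ ?n) has_real_derivative
     (- (real k * lT t ^ (k - 1) * lT')) * X t ^ ?n + (real ?n * X t ^ (?n - 1) * X') * (2 ^ k - lT t ^ k)) (at t)"
    by (auto intro!: derivative_eq_intros dX dl)
  moreover have "X t ^ ?n = X t * X t ^ (?n - 1)" using n2 by (simp flip: power_Suc)
  then have "(- (real k * lT t ^ (k - 1) * lT')) * X t ^ ?n + (real ?n * X t ^ (?n - 1) * X') * (2 ^ k - lT t ^ k)
    = X t ^ (?n - 1) * (- (real k * lT t ^ (k - 1) * (lT' * X t)) + X' * (real ?n * (2 ^ k - lT t ^ k)))"
    by (simp add: algebra_simps)
  moreover have "- (real k * lT t ^ (k - 1) * (lT' * X t)) + X' * (real ?n * (2 ^ k - lT t ^ k)) = 0"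
    unfolding lX axis_eq(1)[OF t, symmetric] by (simp add: algebra_simps)
  ultimately show ?thesis by simp
qed

lemma continuous_axis: "continuous_on {0..} (\<lambda>t. xb + t *\<^sub>R e1)" "(\<lambda>t. xb + t *\<^sub>R e1) ` {0..} \<subseteq> H"
  using axisH by (auto intro!: continuous_intros)

lemmas cont_axis = continuous_on_compose2[OF cont(1) continuous_axis] continuous_on_compose2[OF cont(2) continuous_axis]
  continuous_on_compose2[OF cont(3) continuous_axis]

text \<open>The conserved quantity is 0, so \<open>lT\<close> is 2 or -2 and \<open>lN = lT\<close>;
  the value -2 would make \<open>sigma 1\<close> negative.\<close>

lemma lT_lN_eq_2:
  assumes t: "t > 0" "t \<noteq> d"
  shows "lT t = 2 \<and> lN t = 2"
proof -
  let ?n = "CARD('n)"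
  obtain i where i: "i \<noteq> e" by (rule obtain_tangential_axis)
  \<comment> \<open>A diagonal entry of \<open>A\<close> replaces \<open>lT\<close>: it agrees with
    \<open>lT\<close> off \<open>d\<close> and is continuous at \<open>d\<close>, where the formula
    for \<open>m\<close> divides by zero.\<close>
  define F where "F t = (2 ^ k - (A t $ i $ i) ^ k) * X t ^ ?n" for t
  have Ai: "A t $ i $ i = lT t" if "t > 0" "t \<noteq> d" for t
    unfolding A_axis(1)[OF that] using i by (simp add: diag_def)
  have cA: "continuous_on {0..} (\<lambda>t. A t $ i $ i)" unfolding schouten_v_def by (intro continuous_intros cont_axis) auto
  have cg: "continuous_on {0..} g" using cont_axis(1) by (simp add: g_def[abs_def])
  have cF: "continuous_on {0..} F"
    unfolding F_def X_def using gpos by (intro continuous_intros cA cg) force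
  have "F t = F d"
  proof (rule const_except_point[OF cF d])
    fix s assume s: "s > 0" "s \<noteq> d"
    show "(F has_real_derivative 0) (at s)"
      by (rule has_field_derivative_transform_within_open[OF deriv_first_integral[OF s], of "{0<..} - {d}"])
         (use s Ai in \<open>auto intro!: open_Diff simp: F_def\<close>)
  qed (use t in simp)
  also have "F d = 0" using n2 by (simp add: F_def X_def)
  finally have "F t = 0" .
  moreover have "X t \<noteq> 0" using t d gpos[of t] by (simp add: X_def power2_eq_iff)
  ultimately have l: "lT t ^ k = 2 ^ k" using Ai[OF t] by (simp add: F_def)
  then have "\<bar>lT t\<bar> ^ k = 2 ^ k" by (metis abs_numeral power_abs)
  then have "\<bar>lT t\<bar> = 2" using k power_eq_imp_eq_base[of "\<bar>lT t\<bar>" k 2] by simp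
  then have l2: "lT t = 2 \<or> lT t = - 2" by linarith
  have "real k * (lT t ^ (k - 1) * (lN t - lT t)) = 0" using axis_eq(1)[OF t] l by simp
  then have eq: "lN t = lT t" using l2 k by auto
  have "lT t \<noteq> - 2"
  proof
    assume a: "lT t = - 2"
    have "(real ?n - 1) * (- 2) - 2 > (0::real)" using axis_eq(2)[OF t] eq a by simp
    then show False using n2 by simp
  qed
  then show ?thesis using l2 eq by auto
qed

text \<open>Equal eigenvalues give \<open>g2 = m\<close>, hence \<open>m\<close> is constant by
  \<open>deriv_m\<close> and \<open>g\<close> is a quadratic polynomial.\<close>

lemma axis_formula:
  obtains be where "\<And>t. t \<ge> 0 \<Longrightarrow> g t = al * (t\<^sup>2 + d\<^sup>2) + be * t" "4 * al\<^sup>2 * d\<^sup>2 - be\<^sup>2 = 4"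
proof -
  obtain i where i: "i \<noteq> e" by (rule obtain_tangential_axis)
  define mu where "mu t = D2v (xb + t *\<^sub>R e1) $ i $ i" for t
  have mum: "mu t = m t" if "t > 0" "t \<noteq> d" for t using A_axis(2)[OF that i] by (simp add: mu_def)
  have gm: "g2 t = m t" if "t > 0" "t \<noteq> d" for t
  proof -
    have "g t * g2 t = g t * m t" using lT_lN_eq_2[OF that] unfolding lT_def lN_def by linarith
    then show ?thesis using gpos[of t] that by simp
  qed
  have cmu: "continuous_on {0..} mu" unfolding mu_def by (intro continuous_intros cont_axis)
  have dmu: "(mu has_real_derivative 0) (at t)" if t: "t > 0" "t \<noteq> d" for t
    by (rule has_field_derivative_transform_within_open[of m _ _ "{0<..} - {d}"])
       (use t mum deriv_m[OF t] gm[OF t] in \<open>auto intro!: open_Diff\<close>)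
  define M where "M = mu d"
  have mM: "m t = M" if "t > 0" "t \<noteq> d" for t
    using const_except_point[OF cmu d _ dmu, of t] mum[OF that] that by (simp add: M_def)
  have cg1: "continuous_on {0..} g1" unfolding g1_def[abs_def] by (intro continuous_intros cont_axis)
  have cg: "continuous_on {0..} g" using cont_axis(1) by (simp add: g_def[abs_def])
  define be where "be = g1 0"
  have cc: "g1 t - M * t = g1 d - M * d" if "t \<ge> 0" for t
  proof (rule const_except_point[OF _ d that])
    show "continuous_on {0..} (\<lambda>t. g1 t - M * t)" by (intro continuous_intros cg1)
    show "((\<lambda>t. g1 t - M * t) has_real_derivative 0) (at t)" if t: "t > 0" "t \<noteq> d" for t
      using gm[OF t] mM[OF t] by (auto intro!: derivative_eq_intros axis_line[OF t(1)])
  qed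
  have g1f: "g1 t = be + M * t" if "t \<ge> 0" for t using cc[OF that] cc[of 0] by (simp add: be_def)
  have cc2: "g t - be * t - M / 2 * t\<^sup>2 = g d - be * d - M / 2 * d\<^sup>2" if "t \<ge> 0" for t
  proof (rule const_except_point[OF _ d that])
    show "continuous_on {0..} (\<lambda>t. g t - be * t - M / 2 * t\<^sup>2)" by (intro continuous_intros cg)
    show "((\<lambda>t. g t - be * t - M / 2 * t\<^sup>2) has_real_derivative 0) (at t)" if t: "t > 0" for t
      using g1f[of t] t by (auto intro!: derivative_eq_intros axis_line[OF t])
  qed
  have g0: "g 0 = al * d\<^sup>2" using bq[OF xb] by (simp add: g_def)
  have gf: "g t = al * d\<^sup>2 + be * t + M / 2 * t\<^sup>2" if "t \<ge> 0" for t
    using cc2[OF that] cc2[of 0] g0 by simp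
  \<comment> \<open>Any positive height other than \<open>d\<close> serves: there the definition of
    \<open>m\<close> gives \<open>M = 2 * al\<close>, and \<open>lT = 2\<close> gives the relation
    for \<open>be\<close>.\<close>
  define t0 where "t0 = d / 2"
  have t0: "t0 > 0" "t0 \<noteq> d" "t0 \<ge> 0" using d by (auto simp: t0_def)
  have dt: "d\<^sup>2 - t0\<^sup>2 \<noteq> 0" using t0 d by (simp add: power2_eq_iff)
  have "M * (d\<^sup>2 - t0\<^sup>2) = 2 * (g t0 - t0 * g1 t0)" using mM[OF t0(1,2)] dt by (simp add: m_def field_simps)
  then have "M * d\<^sup>2 = 2 * al * d\<^sup>2"
    unfolding gf[OF t0(3)] g1f[OF t0(3)] by (simp add: algebra_simps power2_eq_square)
  then have M: "M = 2 * al" using d by simp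
  have "g t0 * M - (g1 t0)\<^sup>2 / 2 = 2" using lT_lN_eq_2[OF t0(1,2)] mM[OF t0(1,2)] by (simp add: lT_def)
  moreover have "g t0 * M - (g1 t0)\<^sup>2 / 2 = 2 * al\<^sup>2 * d\<^sup>2 - be\<^sup>2 / 2"
    unfolding gf[OF t0(3)] g1f[OF t0(3)] M by (simp add: power2_eq_square field_simps)
  ultimately have "4 * al\<^sup>2 * d\<^sup>2 - be\<^sup>2 = 4" by simp
  moreover have "g t = al * (t\<^sup>2 + d\<^sup>2) + be * t" if "t \<ge> 0" for t
    using gf[OF that] M by (simp add: algebra_simps)
  ultimately show ?thesis using that by blast
qed

text \<open>A point off the axis is carried to an axis point by one of the invariant inversions, and
  \<open>ray_invariant\<close> transports the formula from there.\<close>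

lemma solution_formula:
  obtains be where "4 * al\<^sup>2 * d\<^sup>2 - be\<^sup>2 = 4"
    "\<And>y. y \<in> H \<Longrightarrow> v y = al * ((norm (y - xb))\<^sup>2 + d\<^sup>2) + be * y $ e"
proof -
  obtain be where be: "\<And>t. t \<ge> 0 \<Longrightarrow> g t = al * (t\<^sup>2 + d\<^sup>2) + be * t" "4 * al\<^sup>2 * d\<^sup>2 - be\<^sup>2 = 4"
    using axis_formula by blast
  have "v y = al * ((norm (y - xb))\<^sup>2 + d\<^sup>2) + be * y $ e" if y: "y \<in> H" for y
  proof (cases "y $ e = 0")
    case True
    then show ?thesis using bq by simp
  next
    case False
    then have ye: "y $ e > 0" using y by (simp add: closed_half_space_def)
    define Y where "Y = y - xb"
    have Ye: "Y $ e = y $ e" using xb by (simp add: Y_def)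
    show ?thesis
    proof (cases "tproj e Y = 0")
      case True
      have "Y = (y $ e) *\<^sub>R e1"
        using True Ye by (auto simp: vec_eq_iff tproj_def axis_def) metis
      then have yy: "y = xb + (y $ e) *\<^sub>R e1" by (simp add: Y_def algebra_simps)
      have "norm (y - xb) = y $ e" using ye \<open>Y = (y $ e) *\<^sub>R e1\<close> by (simp add: Y_def)
      moreover have "v y = g (y $ e)" using yy by (simp add: g_def)
      ultimately show ?thesis using be(1)[of "y $ e"] ye by simp
    next
      case False
      then have "(norm (tproj e Y))\<^sup>2 > 0" by simp
      then have nY: "(norm Y)\<^sup>2 > (y $ e)\<^sup>2" unfolding norm_tproj_sq Ye by simp
      \<comment> \<open>\<open>s / (2 * d)\<close> is the hyperbolic cosine of the distance from
        \<open>y\<close> to the common fixed point; the invariant inversions preserve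
        \<open>s\<close>.\<close>
      define s where "s = ((norm Y)\<^sup>2 + d\<^sup>2) / (y $ e)"
      have sy: "s * y $ e = (norm Y)\<^sup>2 + d\<^sup>2" using ye by (simp add: s_def)
      have "2 * d * y $ e \<le> (y $ e)\<^sup>2 + d\<^sup>2" using sum_squares_bound[of "y $ e" d] by (simp add: mult_ac)
      then have "2 * d * y $ e < s * y $ e" using nY sy by linarith
      then have s2: "2 * d < s" using ye by simp
      define D where "D = s\<^sup>2 - 4 * d\<^sup>2"
      have D: "D > 0" using power_strict_mono[OF s2, of 2] d by (simp add: D_def power_mult_distrib)
      have Ds: "sqrt D < s"
      proof -
        have "D < s\<^sup>2" using d by (simp add: D_def)
        then show ?thesis using s2 d real_less_lsqrt[of s D] D by (simp add: real_sqrt_less_iff real_less_lsqrt)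
      qed
      have root: "\<tau>\<^sup>2 + d\<^sup>2 = s * \<tau>" if "\<tau> = (s + sqrt D) / 2 \<or> \<tau> = (s - sqrt D) / 2" for \<tau>
      proof -
        have "(2 * \<tau> - s)\<^sup>2 = D" using that D by (auto simp: field_simps)
        then show ?thesis unfolding D_def by (simp add: power2_eq_square algebra_simps)
      qed
      \<comment> \<open>Two axis points have the same invariant \<open>s\<close>. One at a height
        different from \<open>y $ e\<close> is taken, so that the ratio \<open>c\<close> differs
        from 1.\<close>
      obtain \<tau> where \<tau>: "\<tau> > 0" "\<tau>\<^sup>2 + d\<^sup>2 = s * \<tau>" "\<tau> \<noteq> y $ e"
      proof (cases "y $ e = (s + sqrt D) / 2")
        case True
        have "(s - sqrt D) / 2 \<noteq> y $ e" using True D by simp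
        moreover have "(s - sqrt D) / 2 > 0" using Ds by simp
        ultimately show ?thesis using that[of "(s - sqrt D) / 2"] root by blast
      next
        case False
        have "(s + sqrt D) / 2 > 0" using D s2 d by (simp add: add_pos_pos)
        then show ?thesis using that[of "(s + sqrt D) / 2"] root False by metis
      qed
      define c where "c = \<tau> / y $ e"
      have c: "c > 0" "c \<noteq> 1" using \<tau> ye by (auto simp: c_def)
      have cy: "c * y $ e = \<tau>" using ye by (simp add: c_def)
      \<comment> \<open>The point where the line through \<open>Y\<close> and the axis point meets
        the hyperplane; it is the centre of the required inversion, relative to
        \<open>xb\<close>.\<close>
      define w where "w = (1 / (1 - c)) *\<^sub>R (\<tau> *\<^sub>R e1 - c *\<^sub>R Y)"
      have weq: "\<tau> *\<^sub>R e1 = w + c *\<^sub>R (Y - w)"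
      proof -
        have "(1 - c) *\<^sub>R w = \<tau> *\<^sub>R e1 - c *\<^sub>R Y" using c by (simp add: w_def)
        then show ?thesis by (simp add: algebra_simps)
      qed
      have we: "w $ e = 0" using Ye cy by (simp add: w_def)
      define x where "x = xb + w"
      have x: "x $ e = 0" using we xb by (simp add: x_def)
      define P where "P = Y - w"
      have yx: "y - x = P" by (simp add: P_def x_def Y_def)
      have Pe: "P $ e = y $ e" using we Ye by (simp add: P_def)
      \<comment> \<open>The product of the distances from the centre to the two points equals the
        squared radius \<open>v x / al\<close>. This is where equality of the invariants
        \<open>s\<close> enters.\<close>
      have key: "c * (norm P)\<^sup>2 = (norm w)\<^sup>2 + d\<^sup>2"
      proof -
        have "\<tau>\<^sup>2 = (norm (\<tau> *\<^sub>R e1))\<^sup>2" by simp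
        also have "\<dots> = (norm w)\<^sup>2 + 2 * c * (w \<bullet> P) + c\<^sup>2 * (norm P)\<^sup>2"
          unfolding weq P_def[symmetric] power2_norm_eq_inner
          by (simp add: inner_add_left inner_add_right inner_commute power2_eq_square)
        finally have 1: "\<tau>\<^sup>2 = (norm w)\<^sup>2 + 2 * c * (w \<bullet> P) + c\<^sup>2 * (norm P)\<^sup>2" .
        have "Y = w + P" by (simp add: P_def)
        then have 2: "(norm Y)\<^sup>2 = (norm w)\<^sup>2 + 2 * (w \<bullet> P) + (norm P)\<^sup>2"
          unfolding power2_norm_eq_inner by (simp add: inner_add_left inner_add_right inner_commute)
        have "s * \<tau> = c * (s * y $ e)" by (simp add: cy[symmetric])
        then have "\<tau>\<^sup>2 + d\<^sup>2 = c * ((norm Y)\<^sup>2 + d\<^sup>2)" by (simp only: \<tau>(2) sy)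
        then have "(1 - c) * ((norm w)\<^sup>2 + d\<^sup>2 - c * (norm P)\<^sup>2) = 0"
          unfolding 1 2 by (simp add: algebra_simps power2_eq_square)
        then show ?thesis using c by simp
      qed
      have P0: "norm P > 0" using Pe ye by auto
      define th where "th = P /\<^sub>R norm P"
      have th: "norm th = 1" "th $ e > 0" using P0 Pe ye by (auto simp: th_def)
      have "norm P * v (x + (c * norm P) *\<^sub>R th) = c * norm P * v (x + norm P *\<^sub>R th)"
      proof (rule ray_invariant[OF x th])
        show "norm P * (c * norm P) = v x / al"
          using key bq[OF x] al by (simp add: x_def power2_eq_square mult_ac)
      qed (use P0 c in auto)
      moreover have "x + norm P *\<^sub>R th = y" using P0 yx by (simp add: th_def) (metis add.commute diff_add_cancel)
      moreover have "x + (c * norm P) *\<^sub>R th = xb + \<tau> *\<^sub>R e1" using P0 weq by (simp add: th_def x_def P_def)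
      ultimately have "g \<tau> = c * v y" using P0 by (simp add: g_def)
      moreover have "g \<tau> = (al * s + be) * \<tau>" using be(1)[of \<tau>] \<tau> by (simp add: algebra_simps)
      ultimately have "c * v y = (al * s + be) * (c * y $ e)" using cy by simp
      then have "v y = (al * s + be) * y $ e" using c by simp
      also have "\<dots> = al * (s * y $ e) + be * y $ e" by (simp add: algebra_simps)
      finally show ?thesis unfolding sy by (simp add: Y_def)
    qed
  qed
  then show ?thesis using that be(2) by blast
qed

end

section \<open>The theorem\<close>

lemma has_derivative_powr_pos:
  fixes f :: "'a::real_normed_vector \<Rightarrow> real"
  assumes "(f has_derivative f') (at y within S)" "f y > 0"
  shows "((\<lambda>y. f y powr r) has_derivative (\<lambda>h. r * f y powr (r - 1) * f' h)) (at y within S)"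
proof -
  have "((\<lambda>z. z powr r) has_derivative (*) (r * f y powr (r - 1))) (at (f y))"
    using has_real_derivative_powr[OF assms(2)] by (simp add: has_field_derivative_def)
  from has_derivative_compose[OF assms(1) this] show ?thesis by simp
qed

lemma Bk_eq_Bop:
  fixes g :: "real^'n"
  assumes "1 \<le> k"
  shows "Bk e k a g M = boundary_op e k (- (2 / (real CARD('n) - 2)) * a powr (- real CARD('n) / (real CARD('n) - 2)) * g $ e) (schouten a g M)"
proof -
  have "{..<k} = insert 0 {1..k-1}" using assms by auto
  then show ?thesis unfolding Bk_def boundary_op_def Let_def by (simp add: sigma_on_0)
qed

definition cv :: "(real^'n \<Rightarrow> real) \<Rightarrow> real^'n \<Rightarrow> real" where
  "cv u y = u y powr (- 2 / (real CARD('n) - 2))"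

definition cDv :: "(real^'n \<Rightarrow> real) \<Rightarrow> (real^'n \<Rightarrow> real^'n) \<Rightarrow> real^'n \<Rightarrow> real^'n" where
  "cDv u Du y = (- (2 / (real CARD('n) - 2)) * u y powr (- real CARD('n) / (real CARD('n) - 2))) *\<^sub>R Du y"

definition cD2v :: "(real^'n \<Rightarrow> real) \<Rightarrow> (real^'n \<Rightarrow> real^'n) \<Rightarrow> (real^'n \<Rightarrow> real^'n^'n) \<Rightarrow> real^'n \<Rightarrow> real^'n^'n" where
  "cD2v u Du D2u y = (- (2 / (real CARD('n) - 2)) * u y powr (- real CARD('n) / (real CARD('n) - 2))) *\<^sub>R D2u y
     + (2 * real CARD('n) / (real CARD('n) - 2)\<^sup>2 * u y powr (- real CARD('n) / (real CARD('n) - 2) - 1)) *\<^sub>R outer (Du y)"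

lemma C2_conformal:
  fixes u :: "real^'n \<Rightarrow> real"
  assumes n: "CARD('n) \<ge> 3" and C: "C2_with S u Du D2u" and pos: "\<And>y. y \<in> S \<Longrightarrow> u y > 0"
  shows "C2_with S (cv u) (cDv u Du) (cD2v u Du D2u)"
proof -
  define N where "N = real CARD('n)"
  have N: "N - 2 > 0" using n by (simp add: N_def)
  have du: "(u has_derivative (\<lambda>h. Du y \<bullet> h)) (at y within S)" "(Du has_derivative (\<lambda>h. D2u y *v h)) (at y within S)" if "y \<in> S" for y
    using C that by (auto simp: C2_with_def)
  have ex: "- (2 / (N - 2)) - 1 = - (N / (N - 2))" using N by (simp add: field_simps)
  have 1: "(cv u has_derivative (\<lambda>h. cDv u Du y \<bullet> h)) (at y within S)" if y: "y \<in> S" for y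
    unfolding cv_def cDv_def N_def[symmetric]
    by (rule has_derivative_eq_rhs[OF has_derivative_powr_pos[OF du(1)[OF y] pos[OF y]]]) (simp add: ex)
  have 2: "(cDv u Du has_derivative (\<lambda>h. cD2v u Du D2u y *v h)) (at y within S)" if y: "y \<in> S" for y
    unfolding cDv_def cD2v_def N_def[symmetric]
    by (rule has_derivative_eq_rhs[OF has_derivative_scaleR[OF has_derivative_mult_right[OF has_derivative_powr_pos[OF du(1)[OF y] pos[OF y]]] du(2)[OF y]]])
       (simp add: fun_eq_iff matrix_vector_mult_add_rdistrib matrix_vector_mult_diff_rdistrib outer_mult_vec power2_eq_square mult_ac flip: scaleR_matrix_vector_assoc)
  note cc = C2_with_continuous[OF C]
  have 3: "continuous_on S (cD2v u Du D2u)"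
    unfolding cD2v_def using pos by (intro continuous_intros cc) force+
  show ?thesis unfolding C2_with_def using 1 2 3 by blast
qed

lemma schouten_conformal:
  fixes u :: "real^'n \<Rightarrow> real"
  assumes n: "CARD('n) \<ge> 3" and pos: "u y > 0"
  shows "schouten (u y) (Du y) (D2u y) = schouten_v (cv u y) (cDv u Du y) (cD2v u Du D2u y)"
proof -
  define N where "N = real CARD('n)"
  define a where "a = u y"
  define D where "D = N - 2"
  have D: "D \<noteq> 0" "N = D + 2" using n by (auto simp: N_def D_def)
  have e1: "a powr (- 2 / (N - 2)) * a powr (- N / (N - 2)) = a powr (- (N + 2) / (N - 2))"
  proof -
    have "- 2 / (N - 2) + - N / (N - 2) = - (N + 2) / (N - 2)"
      unfolding D_def[symmetric] using D by (simp add: field_simps)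
    then show ?thesis by (simp only: powr_add[symmetric])
  qed
  have e2: "a powr (- 2 / (N - 2)) * a powr (- N / (N - 2) - 1) = a powr (- 2 * N / (N - 2))"
  proof -
    have "- 2 / (N - 2) + (- N / (N - 2) - 1) = - 2 * N / (N - 2)"
      unfolding D_def[symmetric] using D by (simp add: field_simps)
    then show ?thesis by (simp only: powr_add[symmetric])
  qed
  have e3: "(a powr (- N / (N - 2)))\<^sup>2 = a powr (- 2 * N / (N - 2))"
    unfolding power2_eq_square powr_add[symmetric] by (simp add: field_simps)
  have "(norm (cDv u Du y))\<^sup>2 = 4 / (N - 2)\<^sup>2 * a powr (- 2 * N / (N - 2)) * (norm (Du y))\<^sup>2"
    unfolding cDv_def N_def[symmetric] a_def[symmetric] norm_scaleR power_mult_distrib power2_abs e3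
    by (simp add: power_divide)
  then have "schouten_v (cv u y) (cDv u Du y) (cD2v u Du D2u y)
    = (- (2 / (N - 2)) * (a powr (- 2 / (N - 2)) * a powr (- N / (N - 2)))) *\<^sub>R D2u y
     + (2 * N / (N - 2)\<^sup>2 * (a powr (- 2 / (N - 2)) * a powr (- N / (N - 2) - 1))) *\<^sub>R outer (Du y)
     - (2 / (N - 2)\<^sup>2 * a powr (- 2 * N / (N - 2)) * (norm (Du y))\<^sup>2) *\<^sub>R mat 1"
    unfolding schouten_v_def cv_def cD2v_def N_def[symmetric] a_def[symmetric] by (simp add: scaleR_add_right scaleR_diff_right mult_ac)
  then show ?thesis
    unfolding e1 e2 schouten_def Let_def N_def[symmetric] a_def[symmetric]
    by (simp add: vec_eq_iff outer_def mat_def)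
qed

text \<open>The powers are such that \<open>cv u y = |y|^2 * cv z (y / |y|^2)\<close>. The
  first-order expansion of \<open>cv z\<close> at 0, multiplied by \<open>|y|^2\<close>, becomes an
  expansion at infinity with error \<open>o(|y|)\<close>.\<close>

lemma conformal_expansion:
  fixes u z :: "real^'n \<Rightarrow> real"
  assumes n: "CARD('n) \<ge> 3"
    and C: "C2_on (cball 0 1 \<inter> closed_half_space e) z"
    and pos: "\<forall>x\<in>cball 0 1 \<inter> closed_half_space e. z x > 0"
    and zu: "\<forall>x\<in>cball 0 1 \<inter> closed_half_space e. x \<noteq> 0 \<longrightarrow> z x = norm x powr (2 - real CARD('n)) * u (x /\<^sub>R (norm x)\<^sup>2)"
    and upos: "\<forall>x\<in>closed_half_space e. u x > 0"
  obtains al cc where "al > 0" "\<And>ep. ep > 0 \<Longrightarrow> \<exists>B. \<forall>y\<in>closed_half_space e. norm y \<ge> B \<longrightarrow>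
       \<bar>cv u y - al * (norm y)\<^sup>2 - cc \<bullet> y\<bar> \<le> ep * norm y"
proof -
  let ?S = "cball 0 1 \<inter> closed_half_space e"
  obtain Dz D2z where Cz: "C2_with ?S z Dz D2z" using C by (auto simp: C2_on_def)
  define N where "N = real CARD('n)"
  have N: "N - 2 > 0" using n by (simp add: N_def)
  have 0: "0 \<in> ?S" by (simp add: closed_half_space_def)
  have "C2_with ?S (cv z) (cDv z Dz) (cD2v z Dz D2z)" by (rule C2_conformal[OF n Cz]) (use pos in auto)
  then have D: "(cv z has_derivative (\<lambda>h. cDv z Dz 0 \<bullet> h)) (at 0 within ?S)" using 0 by (auto simp: C2_with_def)
  show ?thesis
  proof (rule that[of "cv z 0" "cDv z Dz 0"])
    show "cv z 0 > 0" using bspec[OF pos 0] by (simp add: cv_def)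
    fix ep :: real assume "ep > 0"
    then obtain \<delta> where \<delta>: "\<delta> > 0" "\<And>x. x \<in> ?S \<Longrightarrow> norm (x - 0) < \<delta> \<Longrightarrow>
       norm (cv z x - cv z 0 - cDv z Dz 0 \<bullet> (x - 0)) \<le> ep * norm (x - 0)"
      using D unfolding has_derivative_within_alt by meson
    show "\<exists>B. \<forall>y\<in>closed_half_space e. norm y \<ge> B \<longrightarrow> \<bar>cv u y - cv z 0 * (norm y)\<^sup>2 - cDv z Dz 0 \<bullet> y\<bar> \<le> ep * norm y"
    proof (intro exI[of _ "max 1 (2 / \<delta>)"] ballI impI)
      fix y assume y: "y \<in> closed_half_space e" "norm y \<ge> max 1 (2 / \<delta>)"
      have ny: "norm y \<ge> 1" "norm y \<ge> 2 / \<delta>" "norm y > 0" using y by auto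
      define r where "r = norm y"
      have r: "r \<ge> 1" "r > 0" "1 / r < \<delta>" using ny \<delta> by (auto simp: r_def field_simps)
      define x where "x = y /\<^sub>R r\<^sup>2"
      have "norm x = inverse (r\<^sup>2) * r" by (simp add: x_def r_def)
      then have nx: "norm x = 1 / r" using r by (simp add: power2_eq_square field_simps)
      have xS: "x \<in> ?S" using y r by (simp add: nx closed_half_space_def) (simp add: x_def)
      have x0: "x \<noteq> 0" using nx r by auto
      have "x /\<^sub>R (norm x)\<^sup>2 = (inverse ((1 / r)\<^sup>2) * inverse (r\<^sup>2)) *\<^sub>R y" unfolding nx by (simp add: x_def)
      also have "inverse ((1 / r)\<^sup>2) * inverse (r\<^sup>2) = 1" using r by (simp add: power_divide)
      finally have "x /\<^sub>R (norm x)\<^sup>2 = y" by simp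
      then have "z x = (1 / r) powr (2 - N) * u y" using zu xS x0 by (simp add: nx N_def)
      then have "cv z x = ((1 / r) powr (2 - N)) powr (- 2 / (N - 2)) * cv u y"
        using upos y r by (simp add: cv_def N_def powr_mult less_imp_le)
      also have "((1 / r) powr (2 - N)) powr (- 2 / (N - 2)) = (1 / r)\<^sup>2"
      proof -
        have "(2 - N) * (- 2 / (N - 2)) = 2" using N by (simp add: field_simps)
        then show ?thesis using r by (simp only: powr_powr) (simp add: powr_numeral)
      qed
      finally have "cv u y = r\<^sup>2 * cv z x" using r by (simp add: power_divide)
      moreover have "y = r\<^sup>2 *\<^sub>R x" using r by (simp add: x_def)
      ultimately have "cv u y - cv z 0 * r\<^sup>2 - cDv z Dz 0 \<bullet> y = r\<^sup>2 * (cv z x - cv z 0 - cDv z Dz 0 \<bullet> (x - 0))"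
        by (simp add: algebra_simps)
      then have "\<bar>cv u y - cv z 0 * r\<^sup>2 - cDv z Dz 0 \<bullet> y\<bar> = r\<^sup>2 * norm (cv z x - cv z 0 - cDv z Dz 0 \<bullet> (x - 0))"
        by (simp add: abs_mult)
      also have "\<dots> \<le> r\<^sup>2 * (ep * norm (x - 0))" using \<delta>(2)[OF xS] r nx by (intro mult_left_mono) auto
      also have "\<dots> = ep * r" using r by (simp add: nx power2_eq_square)
      finally show "\<bar>cv u y - cv z 0 * (norm y)\<^sup>2 - cDv z Dz 0 \<bullet> y\<bar> \<le> ep * norm y" by (simp add: r_def)
    qed
  qed
qed

theorem theorem3p1:
  fixes u :: "real^'n \<Rightarrow> real" and Du :: "real^'n \<Rightarrow> real^'n"
    and D2u :: "real^'n \<Rightarrow> real^'n^'n" and e :: 'n and k :: nat and c0 :: real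
  assumes n3: "CARD('n) \<ge> 3"
    and k: "1 \<le> k" "k \<le> CARD('n)"
    and c0: "c0 > 0"
    and C2: "C2_with (closed_half_space e) u Du D2u"
    and pos: "\<forall>x\<in>closed_half_space e. u x > 0"
    and eq: "\<forall>x\<in>closed_half_space e.
               sigma k (schouten (u x) (Du x) (D2u x)) = 2 ^ k * real (CARD('n) choose k)"
    and cone: "\<forall>x\<in>closed_half_space e. \<forall>j\<in>{1..k}.
               sigma j (schouten (u x) (Du x) (D2u x)) > 0"
    and bdry: "\<forall>x. x $ e = 0 \<longrightarrow> Bk e k (u x) (Du x) (D2u x) = c0"
    and ext: "\<exists>v. C2_on (cball 0 1 \<inter> closed_half_space e) v
               \<and> (\<forall>x\<in>cball 0 1 \<inter> closed_half_space e. v x > 0)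
               \<and> (\<forall>x\<in>cball 0 1 \<inter> closed_half_space e. x \<noteq> 0 \<longrightarrow>
                    v x = norm x powr (2 - real CARD('n)) * u (x /\<^sub>R (norm x)^2))"
  shows "\<exists>b>0. \<exists>xbar :: real^'n. \<forall>x\<in>closed_half_space e.
           u x = (sqrt b / (1 + b * (norm (x - xbar))^2)) powr ((real CARD('n) - 2) / 2)"
proof -
  let ?H = "closed_half_space e" and ?N = "real CARD('n)"
  have pos': "\<And>y. y \<in> ?H \<Longrightarrow> u y > 0" using pos by blast
  note Cv = C2_conformal[OF n3 C2 pos']
  have sch: "schouten (u y) (Du y) (D2u y) = schouten_v (cv u y) (cDv u Du y) (cD2v u Du D2u y)" if "y \<in> ?H" for y
    by (rule schouten_conformal[of u y Du D2u, OF n3 pos'[OF that]])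
  have "solution_on e k c0 ?H (cv u) (cDv u Du) (cD2v u Du D2u)"
    unfolding solution_on_def
  proof (intro conjI ballI impI)
    show "C2_with ?H (cv u) (cDv u Du) (cD2v u Du D2u)" by (rule Cv) auto
    fix y assume y: "y \<in> ?H"
    show "cv u y > 0" using pos'[OF y] by (simp add: cv_def)
    have "transpose (cD2v u Du D2u y) = cD2v u Du D2u y"
      by (rule C2_symmetric_half_space[OF Cv y]) auto
    then show "garding_cone k (schouten_v (cv u y) (cDv u Du y) (cD2v u Du D2u y))"
      using cone y by (auto simp: garding_cone_def sch[OF y, symmetric]) (simp add: sch[OF y] schouten_v_def transpose_minus transpose_scaleR)
    show "sigma k (schouten_v (cv u y) (cDv u Du y) (cD2v u Du D2u y)) = 2 ^ k * real (CARD('n) choose k)"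
      using eq y by (simp add: sch[OF y, symmetric])
    assume "y $ e = 0"
    then show "boundary_op e k (cDv u Du y $ e) (schouten_v (cv u y) (cDv u Du y) (cD2v u Du D2u y)) = c0"
      using bdry Bk_eq_Bop[OF k(1), of e "u y" "Du y" "D2u y"] by (simp add: sch[OF y] cDv_def)
  qed
  moreover obtain z where z: "C2_on (cball 0 1 \<inter> ?H) z" "\<forall>x\<in>cball 0 1 \<inter> ?H. z x > 0"
      "\<forall>x\<in>cball 0 1 \<inter> ?H. x \<noteq> 0 \<longrightarrow> z x = norm x powr (2 - ?N) * u (x /\<^sub>R (norm x)\<^sup>2)"
    using ext by blast
  obtain al cc where al: "al > 0" and asym: "\<And>ep. ep > 0 \<Longrightarrow> \<exists>B. \<forall>y\<in>?H. norm y \<ge> B \<longrightarrow>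
       \<bar>cv u y - al * (norm y)\<^sup>2 - cc \<bullet> y\<bar> \<le> ep * norm y"
    using conformal_expansion[OF n3 z pos] by blast
  ultimately interpret half_space_solution e k c0 "cv u" "cDv u Du" "cD2v u Du D2u" al cc
    using n3 k c0 by unfold_locales auto
  obtain xb d where xd: "xb $ e = 0" "d > 0" "\<And>x. x $ e = 0 \<Longrightarrow> cv u x = al * ((norm (x - xb))\<^sup>2 + d\<^sup>2)"
    using bdry_center by blast
  interpret half_space_centered e k c0 "cv u" "cDv u Du" "cD2v u Du D2u" al cc xb d
    using xd by unfold_locales auto
  obtain be where be: "4 * al\<^sup>2 * d\<^sup>2 - be\<^sup>2 = 4"
    "\<And>y. y \<in> ?H \<Longrightarrow> cv u y = al * ((norm (y - xb))\<^sup>2 + d\<^sup>2) + be * y $ e"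
    using solution_formula by blast
  \<comment> \<open>Completing the square in the normal direction; by \<open>be(1)\<close> the
    constant that remains is \<open>1 / al\<close>.\<close>
  define xbar where "xbar = xb - (be / (2 * al)) *\<^sub>R axis e 1"
  have v: "cv u y = al * (norm (y - xbar))\<^sup>2 + 1 / al" if y: "y \<in> ?H" for y
  proof -
    define t where "t = be / (2 * al)"
    have "(norm (y - xbar))\<^sup>2 = (norm ((y - xb) + t *\<^sub>R axis e 1))\<^sup>2"
      by (simp add: xbar_def t_def algebra_simps)
    also have "\<dots> = (norm (y - xb))\<^sup>2 + 2 * t * (y - xb) $ e + t\<^sup>2"
      unfolding power2_norm_eq_inner by (simp add: inner_add_left inner_add_right inner_axis inner_axis' power2_eq_square algebra_simps)
    finally have "al * (norm (y - xbar))\<^sup>2 + 1 / al = al * (norm (y - xb))\<^sup>2 + (al * 2 * t) * y $ e + (al * t\<^sup>2 + 1 / al)"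
      using xd(1) by (simp add: algebra_simps)
    also have "al * 2 * t = be" using al by (simp add: t_def)
    also have "al * t\<^sup>2 + 1 / al = al * d\<^sup>2"
    proof -
      have "al * t\<^sup>2 + 1 / al = (be\<^sup>2 + 4) / (4 * al)" using al by (simp add: t_def field_simps power2_eq_square)
      also have "be\<^sup>2 + 4 = 4 * al\<^sup>2 * d\<^sup>2" using be(1) by simp
      finally show ?thesis using al by (simp add: power2_eq_square)
    qed
    finally show ?thesis using be(2)[OF y] by (simp add: algebra_simps)
  qed
  show ?thesis
  \<comment> \<open>From \<open>v = al * |y - xbar|^2 + 1 / al\<close> one gets
    \<open>1 / v = al / (1 + al^2 * |y - xbar|^2)\<close>, hence \<open>b = al^2\<close>.\<close>
  proof (intro exI[of _ "al\<^sup>2"] exI[of _ xbar] conjI ballI)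
    show "al\<^sup>2 > 0" using al by simp
    fix y assume y: "y \<in> ?H"
    have N: "?N - 2 > 0" using n3 by simp
    have vp: "cv u y > 0" using pos'[OF y] by (simp add: cv_def)
    have "sqrt (al\<^sup>2) / (1 + al\<^sup>2 * (norm (y - xbar))\<^sup>2) = 1 / cv u y"
    proof -
      have "1 + al\<^sup>2 * (norm (y - xbar))\<^sup>2 = al * cv u y"
        unfolding v[OF y] using al by (simp add: algebra_simps power2_eq_square)
      then show ?thesis using al by simp
    qed
    also have "1 / cv u y = u y powr (2 / (?N - 2))"
      by (simp add: cv_def powr_minus_divide[symmetric])
    also have "\<dots> powr ((?N - 2) / 2) = u y"
    proof -
      have "2 / (?N - 2) * ((?N - 2) / 2) = 1" using N by simp
      then show ?thesis using pos'[OF y] by (simp only: powr_powr) simp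
    qed
    finally show "u y = (sqrt (al\<^sup>2) / (1 + al\<^sup>2 * (norm (y - xbar))\<^sup>2)) powr ((?N - 2) / 2)" by simp
  qed
qed


end
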